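(* The graded collection $\mathscr{S}$ with $\mathscr{S}(n)=\mathbf{k}u_n\oplus\mathbf{k}v_n$, $|u_n|=0$, $|v_n|=1$ ($n\geq 1$), endowed with the family of operations $\{\Delta_T\}_T$ described in the context, forms a coaugmented homotopy cooperad, whose strict counit is the natural projection $\varepsilon:\mathscr{S}\twoheadrightarrow\mathbf{k}u_1\cong\mathcal{I}$ and whose coaugmentation is the natural embedding $\eta:\mathcal{I}\cong\mathbf{k}u_1\hookrightarrow\mathscr{S}$.
   Context: $\mathbf{k}$ is a field of characteristic $0$; everything is nonsymmetric and homologically graded. $\mathcal{I}$ is the unit collection ($\mathbf{k}$ in arity $1$, degree $0$). $\mathfrak{T}$ is the set of planar rooted trees all of whose vertices have arity $\geq 1$, with at least one vertex; the weight $\omega(T)$ is the number of vertices. Vertices of $T$ are ordered in planar order (starting from the root and going clockwise along the tree). For a graded collection $\mathcal{C}$, $\mathcal{C}^{\otimes T}$ is the tensor product, in the planar order of vertices, of the spaces $\mathcal{C}(\text{arity of the vertex})$; it is identified with the corresponding space of trees of shape $T$ decorated by elements of $\mathcal{C}$. Coaugmented homotopy cooperad: a graded collection $\mathcal{C}$ with operations $\Delta_T:\mathcal{C}(n)\to\mathcal{C}^{\otimes T}$ of degree $\omega(T)-2$, one for each $T\in\mathfrak{T}$ with $n$ leaves, such that for each $c$ only finitely many $\Delta_T(c)$ are nonzero, with a strict counit $\varepsilon:\mathcal{C}\to\mathcal{I}$ (for a weight $2$ tree one of whose vertices has arity $1$, applying $\varepsilon$ to that vertex in $\Delta_T(c)$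 recovers $c$; for a tree of any weight other than $2$, applying $\varepsilon$ to any vertex of $\Delta_T(c)$ gives $0$) and a coaugmentation $\eta:\mathcal{I}\to\mathcal{C}$ with $\varepsilon\eta=\mathrm{id}$ which is compatible with the operations ($\Delta_T(\eta(1))=\eta(1)\otimes\eta(1)$ for the weight $2$ tree with both vertices of arity $1$, and $\Delta_T(\eta(1))=0$ for all other $T$), and satisfying the quadratic homotopy-coassociativity relations. Writing $\overline{\mathcal{C}}=\mathcal{C}/\eta(\mathcal{I})$ with induced operations $\overline{\Delta}_T$, these quadratic relations are equivalent to: the degree $-1$ derivation $\partial$ of the free graded operad generated by $s^{-1}\overline{\mathcal{C}}$ determined on generators by $\partial(s^{-1}c)=-\sum_{T}(s^{-1})^{\otimes T}\circ\overline{\Delta}_T(c)$ (with Koszul signs) satisfies $\partial^2=0$. The operations on $\mathscr{S}$: (1) Type (I): for $1\leq j\leq n$, $1\leq i\leq n-j+1$, let $T$ be the weight $2$ tree whose root vertex has arity $n-j+1$ and whose second vertex, of arity $j$, is attached to the $i$-th input of the root. Then $\Delta_T(u_n)=u_{n-j+1}\otimes u_j$, and $\Delta_T(v_n)$ is the sum of $v_n\otimes u_1$ if $j=1$ and of $u_1\otimes v_n$ if $j=n$ (so it is $0$ if $2\leq j\leq n-1$, and is $v_1\otimes u_1+u_1\otimes v_1$ if $n=1$). (2) Type (II), weight $p+1\geq 3$, for $n\geq 2$: for data $2\leq p\leq n$, $0\leq t\leq p$, $r_1,\dots,r_p\geq 1$ with $r_1+\cdots+r_p=n$, $1\leq i_h\leq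 r_h$ for $1\leq h\leq t$, and $1\leq k_t<\cdots<k_{p-1}\leq p$, consider the tree in which the first $t$ vertices form a chain from the root, of arities $r_1,\dots,r_t$, the $m$-th vertex being attached to the $i_{m-1}$-th input of the $(m-1)$-th vertex for $2\leq m\leq t$; the $(t+1)$-th vertex has arity $p$ and is attached to the $i_t$-th input of the $t$-th vertex (it is the root if $t=0$); and the remaining $p-t$ vertices, of arities $r_{t+1},\dots,r_p$, are attached respectively to the $k_t$-th, $k_{t+1}$-th, $\dots$, $k_{p-1}$-th inputs of the $(t+1)$-th vertex. Each such datum contributes to $\Delta_T(v_n)$, for its tree $T$, the term $$(-1)^{\frac{p(p-1)}{2}}\ v_{r_1}\otimes\cdots\otimes v_{r_t}\otimes u_p\otimes v_{r_{t+1}}\otimes\cdots\otimes v_{r_p}$$ (i.e. the tree decorated by $u_p$ at the $(t+1)$-th vertex and by $v$'s at all other vertices); $\Delta_T(v_n)$ is the sum of these contributions over all data giving the tree $T$. (3) All other values $\Delta_T(u_n)$, $\Delta_T(v_n)$ are zero. *)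

theory Defs
  imports Complex_Main "HOL-Library.Poly_Mapping"
begin

text \<open>
  Vector spaces are presented by bases: the space freely spanned by a type \<open>'b\<close> is
  \<open>'b \<Rightarrow>\<^sub>0 'k\<close>, and subspaces spanned by part of the basis are described by conditions on \<open>Poly_Mapping.keys\<close>.  In particular the tensor product of based
  spaces is the space spanned by tuples (here: decorated trees) of basis elements.
\<close>

section \<open>Free modules\<close>

definition pm_scale :: "'k::field \<Rightarrow> ('a \<Rightarrow>\<^sub>0 'k) \<Rightarrow> ('a \<Rightarrow>\<^sub>0 'k)" where
  "pm_scale c x = Poly_Mapping.map ((*) c) x"

abbreviation basis_vec :: "'a \<Rightarrow> ('a \<Rightarrow>\<^sub>0 'k::field)" where
  "basis_vec b \<equiv> Poly_Mapping.single b 1"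

definition lin_ext :: "('a \<Rightarrow> ('b \<Rightarrow>\<^sub>0 'k::field)) \<Rightarrow> ('a \<Rightarrow>\<^sub>0 'k) \<Rightarrow> ('b \<Rightarrow>\<^sub>0 'k)" where
  "lin_ext f x = (\<Sum>a\<in>Poly_Mapping.keys x. pm_scale (Poly_Mapping.lookup x a) (f a))"

lemma lookup_pm_scale [simp]:
  "Poly_Mapping.lookup (pm_scale c x) a = c * Poly_Mapping.lookup x a"
  by (simp add: pm_scale_def Poly_Mapping.map.rep_eq when_def)

lemma vector_space_pm_scale: "vector_space (pm_scale :: 'k::field \<Rightarrow> ('a \<Rightarrow>\<^sub>0 'k) \<Rightarrow> _)"
  by unfold_locales (auto intro!: poly_mapping_eqI simp: lookup_add algebra_simps)

definition koszul :: "int \<Rightarrow> 'k::field" where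
  "koszul m = (if even m then 1 else - 1)"

section \<open>Planar trees\<close>

text \<open>
  \<open>Leaf\<close> is the trivial tree (no vertex); a vertex of arity \<open>n\<close> is a \<open>Node\<close> with
  \<open>n\<close> children.  Undecorated trees are elements of \<open>unit ptree\<close>.
\<close>

datatype 'a ptree = Leaf | Node 'a "'a ptree list"

definition shape :: "'a ptree \<Rightarrow> unit ptree" where
  "shape t = map_ptree (\<lambda>_. ()) t"

fun leaves :: "'a ptree \<Rightarrow> nat" where
  "leaves Leaf = 1"
| "leaves (Node a ts) = sum_list (map leaves ts)"

text \<open>Decorations and arities of the vertices, listed in planar order: root first, then the
  subtrees from left to right.\<close>

fun labels :: "'a ptree \<Rightarrow> 'a list" where
  "labels Leaf = []"
| "labels (Node a ts) = a # concat (map labels ts)"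

fun vertex_arities :: "'a ptree \<Rightarrow> nat list" where
  "vertex_arities Leaf = []"
| "vertex_arities (Node a ts) = length ts # concat (map vertex_arities ts)"

definition weight :: "'a ptree \<Rightarrow> nat" where
  "weight t = length (labels t)"

definition trees :: "unit ptree set" where
  "trees = {T. 1 \<le> weight T \<and> (\<forall>m\<in>set (vertex_arities T). 1 \<le> m)}"

text \<open>\<open>graft t i s\<close> attaches the root of \<open>s\<close> to the \<open>i\<close>-th leaf of \<open>t\<close> (counting from 1);
  \<open>labels_after t i\<close> lists the decorations of the vertices of \<open>t\<close> that follow this leaf in the
  planar order.\<close>

fun graft :: "'a ptree \<Rightarrow> nat \<Rightarrow> 'a ptree \<Rightarrow> 'a ptree"
  and graft_list :: "'a ptree list \<Rightarrow> nat \<Rightarrow> 'a ptree \<Rightarrow> 'a ptree list" where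
  "graft Leaf i s = s"
| "graft (Node a ts) i s = Node a (graft_list ts i s)"
| "graft_list [] i s = []"
| "graft_list (t # ts) i s =
     (if i \<le> leaves t then graft t i s # ts else t # graft_list ts (i - leaves t) s)"

fun labels_after :: "'a ptree \<Rightarrow> nat \<Rightarrow> 'a list"
  and labels_after_list :: "'a ptree list \<Rightarrow> nat \<Rightarrow> 'a list" where
  "labels_after Leaf i = []"
| "labels_after (Node a ts) i = labels_after_list ts i"
| "labels_after_list [] i = []"
| "labels_after_list (t # ts) i =
     (if i \<le> leaves t then labels_after t i @ concat (map labels ts)
      else labels_after_list ts (i - leaves t))"

text \<open>\<open>plug a n i s\<close>: a root vertex of arity \<open>n\<close> with \<open>s\<close> attached to its \<open>i\<close>-th input
  (counting from 1).\<close>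

definition corolla :: "'a \<Rightarrow> nat \<Rightarrow> 'a ptree" where
  "corolla a n = Node a (replicate n Leaf)"

definition plug :: "'a \<Rightarrow> nat \<Rightarrow> nat \<Rightarrow> 'a ptree \<Rightarrow> 'a ptree" where
  "plug a n i s = Node a ((replicate n Leaf)[i - 1 := s])"

section \<open>Graded collections, free operads and derivations\<close>

text \<open>A graded collection given by a homogeneous basis \<open>B\<close>, with arity and degree functions.\<close>

locale based_collection =
  fixes B :: "'b set" and ar :: "'b \<Rightarrow> nat" and deg :: "'b \<Rightarrow> int"
  assumes ar_pos: "b \<in> B \<Longrightarrow> 1 \<le> ar b"
begin

definition comp_space :: "nat \<Rightarrow> int \<Rightarrow> ('b \<Rightarrow>\<^sub>0 'k::field) set" where
  "comp_space n p = {x. \<forall>b\<in>Poly_Mapping.keys x. b \<in> B \<and> ar b = n \<and> deg b = p}"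

definition arity_space :: "nat \<Rightarrow> ('b \<Rightarrow>\<^sub>0 'k::field) set" where
  "arity_space n = {x. \<forall>b\<in>Poly_Mapping.keys x. b \<in> B \<and> ar b = n}"

definition dec_trees :: "'b set \<Rightarrow> 'b ptree set" where
  "dec_trees G = {t. set (labels t) \<subseteq> G \<and> map ar (labels t) = vertex_arities t}"

text \<open>The degree \<open>p\<close> part of the tensor product of the collection along the tree \<open>T\<close>.\<close>

definition tensor_space :: "unit ptree \<Rightarrow> int \<Rightarrow> ('b ptree \<Rightarrow>\<^sub>0 'k::field) set" where
  "tensor_space T p = {y. \<forall>t\<in>Poly_Mapping.keys y.
     t \<in> dec_trees B \<and> shape t = T \<and> sum_list (map deg (labels t)) = p}"

text \<open>
  The free graded operad generated by the desuspension of the span of \<open>G\<close> has as basis the trees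
  decorated by \<open>G\<close>, where a vertex decorated by \<open>b\<close> stands for \<open>s\<^sup>-\<^sup>1 b\<close>, of degree \<open>deg b - 1\<close>.
  The operad unit is \<open>Leaf\<close>.
\<close>

definition sdeg :: "'b list \<Rightarrow> int" where
  "sdeg bs = (\<Sum>b\<leftarrow>bs. deg b - 1)"

definition free_operad :: "'b set \<Rightarrow> nat \<Rightarrow> int \<Rightarrow> ('b ptree \<Rightarrow>\<^sub>0 'k::field) set" where
  "free_operad G n p = {x. \<forall>t\<in>Poly_Mapping.keys x.
     t \<in> dec_trees G \<and> leaves t = n \<and> sdeg (labels t) = p}"

text \<open>Partial composition: the decorations of \<open>s\<close> move past those of the vertices of \<open>t\<close> that
  follow the leaf \<open>i\<close>, whence the Koszul sign.\<close>

definition pcomp :: "('b ptree \<Rightarrow>\<^sub>0 'k::field) \<Rightarrow> nat \<Rightarrow> ('b ptree \<Rightarrow>\<^sub>0 'k) \<Rightarrow> ('b ptree \<Rightarrow>\<^sub>0 'k)" where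
  "pcomp x i y = lin_ext (\<lambda>t. lin_ext (\<lambda>s.
     Poly_Mapping.single (graft t i s)
       (koszul (sdeg (labels s) * sdeg (labels_after t i)))) y) x"

definition operad_derivation ::
  "'b set \<Rightarrow> (('b ptree \<Rightarrow>\<^sub>0 'k::field) \<Rightarrow> ('b ptree \<Rightarrow>\<^sub>0 'k)) \<Rightarrow> bool" where
  "operad_derivation G d \<longleftrightarrow>
     Vector_Spaces.linear pm_scale pm_scale d \<and>
     (\<forall>n p. \<forall>x\<in>free_operad G n p. d x \<in> free_operad G n (p - 1)) \<and>
     (\<forall>m p n q i. \<forall>x\<in>free_operad G m p. \<forall>y\<in>free_operad G n q. 1 \<le> i \<and> i \<le> m \<longrightarrow>
        d (pcomp x i y) = pcomp (d x) i y + pm_scale (koszul p) (pcomp x i (d y)))"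

text \<open>\<open>desusp\<close> is the tensor power of \<open>s\<^sup>-\<^sup>1\<close>: with \<open>w\<close> vertices, the 0-based \<open>i\<close>-th decoration
  is passed by the \<open>w - 1 - i\<close> copies of \<open>s\<^sup>-\<^sup>1\<close> belonging to the later vertices.\<close>

definition desusp :: "('b ptree \<Rightarrow>\<^sub>0 'k::field) \<Rightarrow> ('b ptree \<Rightarrow>\<^sub>0 'k)" where
  "desusp = lin_ext (\<lambda>t. Poly_Mapping.single t
     (koszul (\<Sum>i<weight t. (int (weight t) - 1 - int i) * deg (labels t ! i))))"

text \<open>If \<open>G = B - {e}\<close>, this is the projection of trees decorated by the collection to trees
  decorated by its quotient by the span of \<open>e\<close>.\<close>

definition reduce :: "'b set \<Rightarrow> ('b ptree \<Rightarrow>\<^sub>0 'k::field) \<Rightarrow> ('b ptree \<Rightarrow>\<^sub>0 'k)" where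
  "reduce G = lin_ext (\<lambda>t. if set (labels t) \<subseteq> G then basis_vec t else 0)"

definition reduced_basis :: "('k::field \<Rightarrow> ('b \<Rightarrow>\<^sub>0 'k)) \<Rightarrow> 'b set" where
  "reduced_basis \<eta> = {b \<in> B. basis_vec b \<noteq> \<eta> 1}"

definition apply_at ::
  "(('b \<Rightarrow>\<^sub>0 'k::field) \<Rightarrow> 'k) \<Rightarrow> nat \<Rightarrow> ('b ptree \<Rightarrow>\<^sub>0 'k) \<Rightarrow> ('b list \<Rightarrow>\<^sub>0 'k)" where
  "apply_at \<epsilon> i = lin_ext (\<lambda>t. Poly_Mapping.single
     (take i (labels t) @ drop (Suc i) (labels t)) (\<epsilon> (basis_vec (labels t ! i))))"

end

section \<open>Coaugmented homotopy cooperads\<close>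

text \<open>
  The basis is adapted to the coaugmentation: \<open>\<eta> 1\<close> is one of its elements, so that the remaining
  elements \<open>reduced_basis \<eta>\<close> give a basis of the quotient by the image of \<open>\<eta>\<close>.  Over a field every
  coaugmented graded collection has such a basis, since \<open>\<epsilon> (\<eta> 1) = 1\<close> forces \<open>\<eta> 1 \<noteq> 0\<close>.
  The values of \<open>\<Delta> T\<close> matter only on the component whose arity is the number of leaves of \<open>T\<close>.
\<close>

locale coaugmented_homotopy_cooperad = based_collection B ar deg
  for B :: "'b set" and ar :: "'b \<Rightarrow> nat" and deg :: "'b \<Rightarrow> int" +
  fixes \<Delta> :: "unit ptree \<Rightarrow> ('b \<Rightarrow>\<^sub>0 'k::field_char_0) \<Rightarrow> ('b ptree \<Rightarrow>\<^sub>0 'k)"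
    and \<epsilon> :: "('b \<Rightarrow>\<^sub>0 'k) \<Rightarrow> 'k"
    and \<eta> :: "'k \<Rightarrow> ('b \<Rightarrow>\<^sub>0 'k)"
  assumes Delta_linear: "T \<in> trees \<Longrightarrow> Vector_Spaces.linear pm_scale pm_scale (\<Delta> T)"
    and Delta_degree: "\<lbrakk>T \<in> trees; c \<in> comp_space (leaves T) p\<rbrakk>
          \<Longrightarrow> \<Delta> T c \<in> tensor_space T (p + int (weight T) - 2)"
    and Delta_finite: "c \<in> arity_space n \<Longrightarrow> finite {T \<in> trees. leaves T = n \<and> \<Delta> T c \<noteq> 0}"
    and counit_linear: "Vector_Spaces.linear pm_scale (*) \<epsilon>"
    and counit_degree: "\<lbrakk>c \<in> comp_space n p; (n, p) \<noteq> (1, 0)\<rbrakk> \<Longrightarrow> \<epsilon> c = 0"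
    and counit_weight_2: "\<lbrakk>T \<in> trees; c \<in> arity_space (leaves T); weight T = 2;
          i < 2; vertex_arities T ! i = 1\<rbrakk>
          \<Longrightarrow> apply_at \<epsilon> i (\<Delta> T c) = lin_ext (\<lambda>b. basis_vec [b]) c"
    and counit_other: "\<lbrakk>T \<in> trees; c \<in> arity_space (leaves T); weight T \<noteq> 2; i < weight T\<rbrakk>
          \<Longrightarrow> apply_at \<epsilon> i (\<Delta> T c) = 0"
    and coaug_linear: "Vector_Spaces.linear (*) pm_scale \<eta>"
    and coaug_degree: "\<eta> a \<in> comp_space 1 0"
    and coaug_adapted: "\<exists>e\<in>B. \<eta> 1 = basis_vec e"
    and counit_coaug: "\<epsilon> (\<eta> a) = a"
    and coaug_Delta_2: "\<Delta> (Node () [Node () [Leaf]]) (\<eta> 1) =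
          lin_ext (\<lambda>a. lin_ext (\<lambda>b. basis_vec (Node a [Node b [Leaf]])) (\<eta> 1)) (\<eta> 1)"
    and coaug_Delta_other: "\<lbrakk>T \<in> trees; leaves T = 1; T \<noteq> Node () [Node () [Leaf]]\<rbrakk>
          \<Longrightarrow> \<Delta> T (\<eta> 1) = 0"
    \<comment> \<open>Coassociativity up to homotopy: the derivation of the free operad (unique, since it is
        given on generators) extending the reduced operations squares to zero.\<close>
    and coassociative: "\<exists>d. operad_derivation (reduced_basis \<eta>) d \<and>
          (\<forall>b\<in>reduced_basis \<eta>. d (basis_vec (corolla b (ar b))) =
             - (\<Sum>T | T \<in> trees \<and> leaves T = ar b \<and> \<Delta> T (basis_vec b) \<noteq> 0.
                  desusp (reduce (reduced_basis \<eta>) (\<Delta> T (basis_vec b))))) \<and>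
          (\<forall>n p. \<forall>x\<in>free_operad (reduced_basis \<eta>) n p. d (d x) = 0)"

section \<open>The collection with basis \<open>u\<^sub>n, v\<^sub>n\<close>\<close>

datatype sbasis = U nat | V nat

fun S_ar :: "sbasis \<Rightarrow> nat" where
  "S_ar (U n) = n"
| "S_ar (V n) = n"

fun S_deg :: "sbasis \<Rightarrow> int" where
  "S_deg (U n) = 0"
| "S_deg (V n) = 1"

definition S_basis :: "sbasis set" where
  "S_basis = {b. 1 \<le> S_ar b}"

text \<open>All indices \<open>i\<close>, \<open>j\<close>, \<open>k\<close>, \<open>r\<close> below count from 1; the lists \<open>rs\<close>, \<open>is\<close>, \<open>ks\<close> are
  \<open>(r\<^sub>1, \<dots>, r\<^sub>p)\<close>, \<open>(i\<^sub>1, \<dots>, i\<^sub>t)\<close> and \<open>(k\<^sub>t, \<dots>, k\<^sub>p\<^sub>-\<^sub>1)\<close>.\<close>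

definition two_vertex :: "sbasis \<Rightarrow> nat \<Rightarrow> sbasis \<Rightarrow> sbasis ptree" where
  "two_vertex a i b = plug a (S_ar a) i (corolla b (S_ar b))"

definition typeI_data :: "nat \<Rightarrow> (nat \<times> nat) set" where
  "typeI_data n = {(j, i). 1 \<le> j \<and> j \<le> n \<and> 1 \<le> i \<and> i \<le> n - j + 1}"

definition typeII_data :: "nat \<Rightarrow> (nat \<times> nat \<times> nat list \<times> nat list \<times> nat list) set" where
  "typeII_data n = {(p, t, rs, is, ks).
     2 \<le> p \<and> p \<le> n \<and> t \<le> p \<and>
     length rs = p \<and> (\<forall>r\<in>set rs. 1 \<le> r) \<and> sum_list rs = n \<and>
     length is = t \<and> (\<forall>h<t. 1 \<le> is ! h \<and> is ! h \<le> rs ! h) \<and>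
     length ks = p - t \<and> sorted_wrt (<) ks \<and> (\<forall>k\<in>set ks. 1 \<le> k \<and> k \<le> p)}"

text \<open>The tree of a type II datum, already decorated by
  \<open>v\<^bsub>r\<^sub>1\<^esub> \<otimes> \<dots> \<otimes> v\<^bsub>r\<^sub>t\<^esub> \<otimes> u\<^sub>p \<otimes> v\<^bsub>r\<^sub>t\<^sub>+\<^sub>1\<^esub> \<otimes> \<dots> \<otimes> v\<^bsub>r\<^sub>p\<^esub>\<close>.\<close>

definition typeII_tree ::
  "nat \<Rightarrow> nat \<Rightarrow> nat list \<Rightarrow> nat list \<Rightarrow> nat list \<Rightarrow> sbasis ptree" where
  "typeII_tree p t rs is ks =
     foldr (\<lambda>(r, i) s. plug (V r) r i s) (zip (take t rs) is)
       (Node (U p)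
         (fold (\<lambda>(k, r) ts. ts[k - 1 := corolla (V r) r]) (zip ks (drop t rs))
           (replicate p Leaf)))"

fun S_Delta_basis :: "unit ptree \<Rightarrow> sbasis \<Rightarrow> (sbasis ptree \<Rightarrow>\<^sub>0 'k::field)" where
  "S_Delta_basis T (U n) =
     (\<Sum>(j, i)\<in>typeI_data n.
        if shape (two_vertex (U (n - j + 1)) i (U j)) = T
        then basis_vec (two_vertex (U (n - j + 1)) i (U j)) else 0)"
| "S_Delta_basis T (V n) =
     (\<Sum>(j, i)\<in>typeI_data n.
        if shape (two_vertex (U (n - j + 1)) i (U j)) = T
        then (if j = 1 then basis_vec (two_vertex (V n) i (U 1)) else 0)
           + (if j = n then basis_vec (two_vertex (U 1) i (V n)) else 0)
        else 0)
   + (\<Sum>(p, t, rs, is, ks)\<in>typeII_data n.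
        if shape (typeII_tree p t rs is ks) = T
        then Poly_Mapping.single (typeII_tree p t rs is ks) ((- 1) ^ (p * (p - 1) div 2))
        else 0)"

definition S_Delta :: "unit ptree \<Rightarrow> (sbasis \<Rightarrow>\<^sub>0 'k::field) \<Rightarrow> (sbasis ptree \<Rightarrow>\<^sub>0 'k)" where
  "S_Delta T = lin_ext (S_Delta_basis T)"

definition S_counit :: "(sbasis \<Rightarrow>\<^sub>0 'k::field) \<Rightarrow> 'k" where
  "S_counit x = Poly_Mapping.lookup x (U 1)"

definition S_coaug :: "'k::field \<Rightarrow> (sbasis \<Rightarrow>\<^sub>0 'k)" where
  "S_coaug a = Poly_Mapping.single (U 1) a"

end

theory Submission
  imports Defs
begin

text \<open>
  Write \<open>x\<^sub>n\<close> for the generator \<open>s\<^sup>-\<^sup>1 u\<^sub>n\<close> (\<open>n \<ge> 2\<close>, degree \<open>-1\<close>) and \<open>y\<^sub>n\<close> for \<open>s\<^sup>-\<^sup>1 v\<^sub>n\<close> (\<open>n \<ge> 1\<close>, degree \<open>0\<close>) of the free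
  operad.  Degrees, finiteness, counit and coaugmentation can be read off from the list of trees
  that occur in the decompositions.  The content is that the derivation \<open>d\<close> with the prescribed
  values on generators exists and squares to zero.

  The derivation acts on a decorated tree by replacing one vertex at a time by the value of its
  generator, with a Koszul sign; \<open>operad_derivation_deriv\<close> checks the Leibniz rule for any
  prescribed values of the right arity and degree.  As \<open>d\<close> is odd, the mixed terms cancel in \<open>d\<^sup>2\<close> of a
  composite, and every tree is a composite of corollas, so \<open>d\<^sup>2 = 0\<close> is a statement about generators
  (\<open>deriv_square\<close>).

  The desuspension turns the sign \<open>(-1)^(p(p-1)/2)\<close> of a type II term into \<open>(-1)^t\<close>
  (\<open>sum_degrees_desusp\<close>).  Hence \<open>d x\<^sub>n\<close> is minus the sum of all \<open>x\<^sub>a \<circ>\<^sub>i x\<^sub>b\<close> of arity \<open>n\<close>, and \<open>d y\<^sub>n\<close> is minus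
  the sum, with sign \<open>(-1)^t\<close>, of the trees of arity \<open>n\<close> consisting of a chain of \<open>t\<close> vertices \<open>y\<close>, then
  one \<open>x\<^sub>p\<close>, then \<open>p - t\<close> vertices \<open>y\<close> on distinct inputs of \<open>x\<^sub>p\<close>.

  The main tool is the product \<open>a * b\<close>, the sum over all partial compositions of \<open>b\<close> into \<open>a\<close>.  It is
  pre-Lie: the associator \<open>(a * b) * c - a * (b * c)\<close> only contains trees in which \<open>b\<close> and \<open>c\<close> sit on
  different leaves of \<open>a\<close>, so that it is symmetric, up to the Koszul sign, in \<open>b\<close> and \<open>c\<close>
  (\<open>star_pre_Lie\<close>).  Let \<open>x\<close> and \<open>y\<close> be the formal sums of all \<open>x\<^sub>n\<close> and of all \<open>y\<^sub>n\<close>.  Then \<open>d x = - x * x\<close>,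
  so \<open>d\<^sup>2 x\<close> is the associator of \<open>x, x, x\<close>, which equals its own negative.

  For \<open>y\<close>, let the crown \<open>B\<^sup>e\<close> be the sum of all \<open>x\<^sub>p\<close> whose inputs carry vertices \<open>y\<close>, except for exactly \<open>e\<close>
  free ones, and define the chain \<open>Z\<^sup>e\<close> by \<open>Z\<^sup>e = B\<^sup>e - y * Z\<^bsup>e+1\<^esup>\<close>.  Unfolding this recursion \<open>t\<close> times
  produces \<open>(-1)^t y * (y * \<dots> (y * B\<^bsup>e+t\<^esup>))\<close>, so \<open>d y = - Z\<^sup>0\<close> (\<open>chain_sum_typeII\<close>).  Write \<open>B\<^sup>e[w]\<close> for the crown
  with \<open>e\<close> free inputs and one further input that carries \<open>w\<close>.  Then
  \<open>B\<^sup>e * w = B\<^bsup>e-1\<^esup>[w] + B\<^sup>e[y * w]\<close> (\<open>crown_star\<close>; for \<open>e = 0\<close> the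
  first term is absent), and
  \<open>d B\<^sup>e = B\<^sup>e[Z\<^sup>0] - (\<Sum>i\<le>e. B\<^sup>i[B\<^bsup>e-i\<^esup>])\<close> (\<open>deriv_crown\<close>).  These two identities give
  \<open>d Z\<^sup>e = - (\<Sum>i=1..e. Z\<^sup>i * Z\<^bsup>e+1-i\<^esup>)\<close> by induction (\<open>deriv_chain\<close>): the crowns telescope, and what
  remains is the sum of the associators of \<open>y, Z\<^sup>a, Z\<^sup>b\<close> over \<open>a + b = e + 2\<close>, which vanishes by
  antisymmetry.  For \<open>e = 0\<close> the right-hand side is empty and \<open>d\<^sup>2 y = - d Z\<^sup>0 = 0\<close>.
\<close>

section \<open>Linear and bilinear extensions\<close>

lemma lookup_sum: "Poly_Mapping.lookup (sum f I) a = (\<Sum>i\<in>I. Poly_Mapping.lookup (f i) a)"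
  by (induction I rule: infinite_finite_induct) (simp_all add: lookup_add)

lemma pm_scale_simps [simp]:
  "pm_scale c 0 = 0" "pm_scale 0 x = 0" "pm_scale 1 x = x"
  "pm_scale a (pm_scale b x) = pm_scale (a * b) x"
  "pm_scale c (Poly_Mapping.single k b) = Poly_Mapping.single k (c * b)"
  "pm_scale (-1) x = - x"
  by (auto intro!: poly_mapping_eqI simp: lookup_single when_def)

lemma pm_scale_distribs:
  "pm_scale c (x + y) = pm_scale c x + pm_scale c y"
  "pm_scale c (x - y) = pm_scale c x - pm_scale c y"
  "pm_scale c (- x) = - pm_scale c x"
  "pm_scale (a + b) x = pm_scale a x + pm_scale b x"
  "pm_scale (- a) x = - pm_scale a x"
  by (auto intro!: poly_mapping_eqI simp: lookup_add lookup_minus algebra_simps)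

lemma pm_scale_sum: "pm_scale c (sum f I) = (\<Sum>i\<in>I. pm_scale c (f i))"
  by (auto intro!: poly_mapping_eqI simp: lookup_sum sum_distrib_left)

lemma lin_ext_superset:
  assumes "finite A" "Poly_Mapping.keys x \<subseteq> A"
  shows "lin_ext f x = (\<Sum>a\<in>A. pm_scale (Poly_Mapping.lookup x a) (f a))"
  unfolding lin_ext_def
  by (rule sum.mono_neutral_left) (use assms in \<open>auto simp: in_keys_iff\<close>)

lemma lin_ext_0 [simp]: "lin_ext f 0 = 0"
  by (simp add: lin_ext_def)

lemma lin_ext_add: "lin_ext f (x + y) = lin_ext f x + lin_ext f y"
proof -
  let ?A = "Poly_Mapping.keys x \<union> Poly_Mapping.keys y"
  have *: "finite ?A" "Poly_Mapping.keys (x + y) \<subseteq> ?A"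
    using Poly_Mapping.keys_add[of x y] by auto
  show ?thesis
    using * by (simp add: lin_ext_superset[of ?A] lookup_add pm_scale_distribs sum.distrib)
qed

lemma lin_ext_scale: "lin_ext f (pm_scale c x) = pm_scale c (lin_ext f x)"
proof -
  have "Poly_Mapping.keys (pm_scale c x) \<subseteq> Poly_Mapping.keys x"
    by (auto simp: in_keys_iff)
  then have "lin_ext f (pm_scale c x)
      = (\<Sum>a\<in>Poly_Mapping.keys x. pm_scale (Poly_Mapping.lookup (pm_scale c x) a) (f a))"
    by (simp only: lin_ext_superset finite_keys)
  then show ?thesis
    by (simp add: lin_ext_def pm_scale_sum)
qed

lemma lin_ext_single [simp]: "lin_ext f (Poly_Mapping.single a c) = pm_scale c (f a)"
  by (auto simp: lin_ext_superset[of "{a}"])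

lemma lin_ext_uminus: "lin_ext f (- x) = - lin_ext f x"
  using lin_ext_scale[of f "-1" x] by simp

lemma lin_ext_diff: "lin_ext f (x - y) = lin_ext f x - lin_ext f y"
  using lin_ext_add[of f x "- y"] by (simp add: lin_ext_uminus)

lemma lin_ext_sum: "lin_ext f (sum g I) = (\<Sum>i\<in>I. lin_ext f (g i))"
  by (induction I rule: infinite_finite_induct) (simp_all add: lin_ext_add)

lemmas lin_ext_simps = lin_ext_add lin_ext_scale lin_ext_uminus lin_ext_diff lin_ext_sum

lemma lin_ext_cong:
  "(\<And>a. a \<in> Poly_Mapping.keys x \<Longrightarrow> f a = g a) \<Longrightarrow> lin_ext f x = lin_ext g x"
  by (simp add: lin_ext_def)

lemma linear_lin_ext:
  fixes f :: "'a \<Rightarrow> ('b \<Rightarrow>\<^sub>0 'k::field)"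
  shows "Vector_Spaces.linear pm_scale pm_scale (lin_ext f)"
  by (simp add: Vector_Spaces.linear_iff vector_space_pm_scale lin_ext_simps)

text \<open>
  Identities between expressions that are linear in \<open>x\<close> are checked on basis elements.  Only the
  basis elements in the support matter, so homogeneity of \<open>x\<close> is available in the basis case.
\<close>

lemma pm_keys_induct [consumes 1, case_names zero add scale basis]:
  assumes "Poly_Mapping.keys x \<subseteq> S"
    and "P 0" "\<And>x y. P x \<Longrightarrow> P y \<Longrightarrow> P (x + y)" "\<And>c x. P x \<Longrightarrow> P (pm_scale c x)"
    and "\<And>t. t \<in> S \<Longrightarrow> P (basis_vec t)"
  shows "P x"
proof -
  have "x = lin_ext basis_vec x"
    by (rule poly_mapping_eqI)
       (simp add: lin_ext_def lookup_sum lookup_single when_def if_distrib in_keys_iff cong: if_cong)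
  moreover have "P (\<Sum>a\<in>A. pm_scale (Poly_Mapping.lookup x a) (basis_vec a))" if "finite A" "A \<subseteq> S" for A
    using that by (induction A rule: finite_induct) (auto simp del: pm_scale_simps(5) intro: assms)
  ultimately show ?thesis
    using assms(1) unfolding lin_ext_def by (metis finite_keys)
qed

definition bilin :: "('a \<Rightarrow> 'b \<Rightarrow> ('c \<Rightarrow>\<^sub>0 'k::field)) \<Rightarrow> ('a \<Rightarrow>\<^sub>0 'k) \<Rightarrow> ('b \<Rightarrow>\<^sub>0 'k) \<Rightarrow> ('c \<Rightarrow>\<^sub>0 'k)" where
  "bilin f x y = lin_ext (\<lambda>a. lin_ext (f a) y) x"

lemma lin_ext_fun_add: "lin_ext (\<lambda>a. f a + g a) x = lin_ext f x + lin_ext g x"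
  by (simp add: lin_ext_def pm_scale_distribs sum.distrib)

lemma lin_ext_fun_scale: "lin_ext (\<lambda>a. pm_scale c (f a)) x = pm_scale c (lin_ext f x)"
  by (simp add: lin_ext_def pm_scale_sum mult.commute)

lemma lin_ext_fun_0 [simp]: "lin_ext (\<lambda>a. 0) x = 0"
  by (simp add: lin_ext_def)

lemma bilin_0 [simp]: "bilin f 0 y = 0" "bilin f x 0 = 0"
  by (simp_all add: bilin_def)

lemma bilin_add: "bilin f (x + x') y = bilin f x y + bilin f x' y"
  "bilin f x (y + y') = bilin f x y + bilin f x y'"
  by (simp_all add: bilin_def lin_ext_add lin_ext_fun_add)

lemma bilin_scale: "bilin f (pm_scale c x) y = pm_scale c (bilin f x y)"
  "bilin f x (pm_scale c y) = pm_scale c (bilin f x y)"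
  by (simp_all add: bilin_def lin_ext_scale lin_ext_fun_scale)

lemma bilin_uminus: "bilin f (- x) y = - bilin f x y" "bilin f x (- y) = - bilin f x y"
  using bilin_scale(1)[of f "-1" x y] bilin_scale(2)[of f x "-1" y] by simp_all

lemma bilin_diff: "bilin f (x - x') y = bilin f x y - bilin f x' y"
  "bilin f x (y - y') = bilin f x y - bilin f x y'"
  using bilin_add(1)[of f x "-x'" y] bilin_add(2)[of f x y "-y'"] by (simp_all add: bilin_uminus)

lemma bilin_sum: "bilin f (sum g I) y = (\<Sum>i\<in>I. bilin f (g i) y)"
  "bilin f x (sum h I) = (\<Sum>i\<in>I. bilin f x (h i))"
  by (induction I rule: infinite_finite_induct) (simp_all add: bilin_add)

lemma bilin_single [simp]:
  "bilin f (Poly_Mapping.single a c) (Poly_Mapping.single b c') = pm_scale (c * c') (f a b)"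
  by (simp add: bilin_def)

lemmas bilin_simps = bilin_add bilin_scale bilin_uminus bilin_diff bilin_sum

lemma keys_pm_scale: "Poly_Mapping.keys (pm_scale c x) \<subseteq> Poly_Mapping.keys x"
  by (auto simp: in_keys_iff)

lemma keys_lin_ext: "Poly_Mapping.keys (lin_ext f x) \<subseteq> (\<Union>a\<in>Poly_Mapping.keys x. Poly_Mapping.keys (f a))"
  unfolding lin_ext_def using Poly_Mapping.keys_sum[of "\<lambda>a. pm_scale (Poly_Mapping.lookup x a) (f a)"]
    keys_pm_scale by fastforce

lemma keys_subset_add:
  "\<lbrakk>Poly_Mapping.keys x \<subseteq> S; Poly_Mapping.keys y \<subseteq> S\<rbrakk> \<Longrightarrow> Poly_Mapping.keys (x + y) \<subseteq> S"
  using Poly_Mapping.keys_add[of x y] by blast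

lemma keys_subset_lin_ext:
  "(\<And>a. a \<in> Poly_Mapping.keys x \<Longrightarrow> Poly_Mapping.keys (f a) \<subseteq> S) \<Longrightarrow> Poly_Mapping.keys (lin_ext f x) \<subseteq> S"
  using keys_lin_ext[of f x] by blast

lemma keys_subset_bilin:
  "(\<And>a b. \<lbrakk>a \<in> Poly_Mapping.keys x; b \<in> Poly_Mapping.keys y\<rbrakk> \<Longrightarrow> Poly_Mapping.keys (f a b) \<subseteq> S)
    \<Longrightarrow> Poly_Mapping.keys (bilin f x y) \<subseteq> S"
  unfolding bilin_def by (intro keys_subset_lin_ext) auto

lemma keys_subset_sum:
  "(\<And>i. i \<in> I \<Longrightarrow> Poly_Mapping.keys (f i) \<subseteq> S) \<Longrightarrow> Poly_Mapping.keys (sum f I) \<subseteq> S"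
  by (induction I rule: infinite_finite_induct) (simp_all add: keys_subset_add)

text \<open>
  The characteristic of the field enters the proof here, through the graded antisymmetry of
  associators of odd elements.
\<close>

lemma eq_uminus_imp_zero:
  fixes x :: "'a \<Rightarrow>\<^sub>0 'k::field_char_0"
  assumes "x = - x"
  shows "x = 0"
proof (rule poly_mapping_eqI)
  fix k
  have "Poly_Mapping.lookup x k = - Poly_Mapping.lookup x k"
    using assms by (metis lookup_uminus)
  then show "Poly_Mapping.lookup x k = Poly_Mapping.lookup 0 k"
    by simp
qed

text \<open>
  A decomposition map at the tree \<open>T\<close> only keeps the data of shape \<open>T\<close>; summing a linear map over all
  shapes restores the sum over all data.
\<close>

lemma sum_over_shapes:
  fixes f :: "('a \<Rightarrow>\<^sub>0 'k::field) \<Rightarrow> 'c::comm_monoid_add"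
  assumes "finite I" "finite Sh" "\<And>x. x \<in> I \<Longrightarrow> sh x \<in> Sh"
    and "f 0 = 0" "\<And>x y. f (x + y) = f x + f y"
  shows "(\<Sum>T\<in>Sh. f (\<Sum>x\<in>I. if sh x = T then g x else 0)) = (\<Sum>x\<in>I. f (g x))"
proof -
  have "f (sum h I) = (\<Sum>x\<in>I. f (h x))" for h
    using \<open>finite I\<close> by (induction I rule: finite_induct) (simp_all add: assms)
  then have "(\<Sum>T\<in>Sh. f (\<Sum>x\<in>I. if sh x = T then g x else 0)) = (\<Sum>x\<in>I. \<Sum>T\<in>Sh. f (if sh x = T then g x else 0))"
    by (simp add: sum.swap[of _ I])
  also have "\<dots> = (\<Sum>x\<in>I. \<Sum>T\<in>Sh. if sh x = T then f (g x) else 0)"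
    by (intro sum.cong refl) (simp add: assms(4))
  also have "\<dots> = (\<Sum>x\<in>I. f (g x))"
    using assms by (intro sum.cong refl) simp
  finally show ?thesis .
qed

lemma koszul_0 [simp]: "koszul 0 = 1" "koszul (-1) = -1" "koszul 1 = -1"
  by (simp_all add: koszul_def)

lemma koszul_add: "koszul (a + b) = (koszul a * koszul b :: 'k::field)"
  by (auto simp: koszul_def)

lemma sum_lessThan_add:
  "(\<Sum>i<a + b. f i) = (\<Sum>i<a. f i) + (\<Sum>i<(b::nat). f (a + i))" for f :: "nat \<Rightarrow> 'a::comm_monoid_add"
  by (induction b) (simp_all add: add.assoc)

lemma koszul_square [simp]: "koszul a * koszul a = (1 :: 'k::field)"
  by (auto simp: koszul_def)

section \<open>Planar trees: grafting and substitution\<close>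

abbreviation leaves_list :: "'a ptree list \<Rightarrow> nat" where
  "leaves_list ts \<equiv> sum_list (map leaves ts)"

abbreviation labels_list :: "'a ptree list \<Rightarrow> 'a list" where
  "labels_list ts \<equiv> concat (map labels ts)"

text \<open>
  Attaches the trees of a forest to the leaves of \<open>s\<close> from left to right.  The values are meaningful if
  the forest has as many trees as \<open>s\<close> has leaves.
\<close>

fun subst :: "'a ptree \<Rightarrow> 'a ptree list \<Rightarrow> 'a ptree"
  and subst_list :: "'a ptree list \<Rightarrow> 'a ptree list \<Rightarrow> 'a ptree list" where
  "subst Leaf ts = hd ts"
| "subst (Node a ss) ts = Node a (subst_list ss ts)"
| "subst_list [] ts = []"
| "subst_list (s # ss) ts = subst s (take (leaves s) ts) # subst_list ss (drop (leaves s) ts)"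

lemma length_graft_list [simp]: "length (graft_list ts i s) = length ts"
  by (induction ts arbitrary: i) auto

lemma length_subst_list [simp]: "length (subst_list ss ts) = length ss"
  by (induction ss arbitrary: ts) auto

lemma graft_list_append:
  "graft_list (ts @ ts') i s =
     (if i \<le> leaves_list ts \<and> 1 \<le> i then graft_list ts i s @ ts'
      else ts @ graft_list ts' (i - leaves_list ts) s)" if "1 \<le> i"
  using that
  by (induction ts arbitrary: i) auto

lemma labels_after_list_append:
  "labels_after_list (ts @ ts') i =
     (if i \<le> leaves_list ts then labels_after_list ts i @ labels_list ts'
      else labels_after_list ts' (i - leaves_list ts))" if "1 \<le> i"
  using that
  by (induction ts arbitrary: i) auto

lemma leaves_graft:
  "\<lbrakk>1 \<le> i; i \<le> leaves t\<rbrakk> \<Longrightarrow> leaves (graft t i s) + 1 = leaves t + leaves s"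
  "\<lbrakk>1 \<le> i; i \<le> leaves_list ts\<rbrakk> \<Longrightarrow> leaves_list (graft_list ts i s) + 1 = leaves_list ts + leaves s"
proof (induction t i s and ts i s rule: graft_graft_list.induct)
  case (4 t ts i s)
  then show ?case by (cases "i \<le> leaves t") force+
qed auto

lemma leaves_list_take_drop: "leaves_list (take n ts) + leaves_list (drop n ts) = leaves_list ts"
  by (metis append_take_drop_id map_append sum_list_append)

lemma labels_list_take_drop: "labels_list (take n ts) @ labels_list (drop n ts) = labels_list ts"
  by (metis append_take_drop_id concat_append map_append)

lemma leaves_subst:
  "length ts = leaves s \<Longrightarrow> leaves (subst s ts) = leaves_list ts"
  "length ts = leaves_list ss \<Longrightarrow> leaves_list (subst_list ss ts) = leaves_list ts"
proof (induction s ts and ss ts rule: subst_subst_list.induct)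
  case (1 ts)
  then show ?case by (cases ts) auto
next
  case (4 s ss ts)
  then show ?case
    using leaves_list_take_drop[of "leaves s" ts] by simp
qed auto

lemma take_graft_list:
  assumes "1 \<le> i" "n \<le> length ts"
  shows "take n (graft_list ts i s) =
      (if i \<le> leaves_list (take n ts) then graft_list (take n ts) i s else take n ts)"
    and "drop n (graft_list ts i s) =
      (if i \<le> leaves_list (take n ts) then drop n ts
       else graft_list (drop n ts) (i - leaves_list (take n ts)) s)"
  using graft_list_append[of i "take n ts" "drop n ts" s] assms by (auto simp: min_def)

text \<open>
  The leaves of \<open>subst s ts\<close> are those of the forest \<open>ts\<close>, with the same numbering, so it does not matter
  whether \<open>r\<close> is grafted before or after the substitution.
\<close>

lemma subst_graft:
  "\<lbrakk>length ts = leaves s; 1 \<le> i; i \<le> leaves_list ts\<rbrakk>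
     \<Longrightarrow> subst s (graft_list ts i r) = graft (subst s ts) i r"
  "\<lbrakk>length ts = leaves_list ss; 1 \<le> i; i \<le> leaves_list ts\<rbrakk>
     \<Longrightarrow> subst_list ss (graft_list ts i r) = graft_list (subst_list ss ts) i r"
proof (induction s ts and ss ts arbitrary: i and i rule: subst_subst_list.induct)
  case (1 ts)
  then show ?case by (cases ts) auto
next
  case (4 s ss ts)
  then show ?case
    using leaves_list_take_drop[of "leaves s" ts]
    by (auto simp: take_graft_list leaves_subst)
qed auto

lemma subst_replicate_Leaf:
  "\<lbrakk>length ts = leaves s; set ts \<subseteq> {Leaf}\<rbrakk> \<Longrightarrow> subst s ts = s"
  "\<lbrakk>length ts = leaves_list ss; set ts \<subseteq> {Leaf}\<rbrakk> \<Longrightarrow> subst_list ss ts = ss"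
proof (induction s ts and ss ts rule: subst_subst_list.induct)
  case (1 ts)
  then show ?case by (cases ts) auto
next
  case (4 s ss ts)
  have "set (take (leaves s) ts) \<subseteq> {Leaf}" "set (drop (leaves s) ts) \<subseteq> {Leaf}"
    using "4.prems"(2) set_take_subset[of "leaves s" ts] set_drop_subset[of "leaves s" ts] by blast+
  with 4 show ?case by simp
qed auto

lemma subst_list_append:
  "subst_list (ss @ ss') ts = subst_list ss (take (leaves_list ss) ts) @ subst_list ss' (drop (leaves_list ss) ts)"
  by (induction ss arbitrary: ts) (auto simp: min_def take_drop add.commute)

lemma subst_list_replicate_Leaf: "k \<le> length ts \<Longrightarrow> subst_list (replicate k Leaf) ts = take k ts"
proof (induction k arbitrary: ts)
  case (Suc k)
  then show ?case by (cases ts) auto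
qed auto

text \<open>
  Membership in \<open>dec_trees\<close>, as a predicate that can be unfolded vertex by vertex.
\<close>

definition well_labelled :: "'b set \<Rightarrow> ('b \<Rightarrow> nat) \<Rightarrow> 'b ptree \<Rightarrow> bool" where
  "well_labelled G ar t \<longleftrightarrow> set (labels t) \<subseteq> G \<and> map ar (labels t) = vertex_arities t"

lemma length_vertex_arities: "length (vertex_arities t) = length (labels t)"
  by (induction t) (auto simp: length_concat o_def cong: map_cong)

lemma concat_eq_iff_map:
  "(\<And>t. t \<in> set ts \<Longrightarrow> length (f t) = length (g t)) \<Longrightarrow>
     concat (map f ts) = concat (map g ts) \<longleftrightarrow> (\<forall>t\<in>set ts. f t = g t)"
  by (induction ts) auto

text \<open>
  The two lists compared at a tree have one entry for every vertex, so equality of their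
  concatenations over the subtrees splits into equality for each subtree.
\<close>

lemma well_labelled_simps [simp]:
  "well_labelled G ar Leaf"
  "well_labelled G ar (Node a ts) \<longleftrightarrow> a \<in> G \<and> ar a = length ts \<and> (\<forall>t\<in>set ts. well_labelled G ar t)"
proof -
  have "map ar (labels_list ts) = concat (map vertex_arities ts)
      \<longleftrightarrow> (\<forall>t\<in>set ts. map ar (labels t) = vertex_arities t)"
    using concat_eq_iff_map[of ts "map ar \<circ> labels" vertex_arities]
    by (simp add: map_concat length_vertex_arities)
  then show "well_labelled G ar (Node a ts)
      \<longleftrightarrow> a \<in> G \<and> ar a = length ts \<and> (\<forall>t\<in>set ts. well_labelled G ar t)"
    by (auto simp: well_labelled_def)
qed (simp add: well_labelled_def)

lemma well_labelled_graft:
  "\<lbrakk>well_labelled G ar t; well_labelled G ar s\<rbrakk> \<Longrightarrow> well_labelled G ar (graft t i s)"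
  "\<lbrakk>\<forall>t\<in>set ts. well_labelled G ar t; well_labelled G ar s\<rbrakk>
     \<Longrightarrow> \<forall>t\<in>set (graft_list ts i s). well_labelled G ar t"
  by (induction t i s and ts i s rule: graft_graft_list.induct) auto

lemma well_labelled_subst:
  "\<lbrakk>well_labelled G ar s; \<forall>t\<in>set ts. well_labelled G ar t; length ts = leaves s\<rbrakk>
     \<Longrightarrow> well_labelled G ar (subst s ts)"
  "\<lbrakk>\<forall>s\<in>set ss. well_labelled G ar s; \<forall>t\<in>set ts. well_labelled G ar t; length ts = leaves_list ss\<rbrakk>
     \<Longrightarrow> \<forall>t\<in>set (subst_list ss ts). well_labelled G ar t"
proof (induction s ts and ss ts rule: subst_subst_list.induct)
  case (1 ts)
  then show ?case by (cases ts) auto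
next
  case (4 s ss ts)
  moreover have "\<forall>t\<in>set (take (leaves s) ts). well_labelled G ar t"
    "\<forall>t\<in>set (drop (leaves s) ts). well_labelled G ar t"
    using "4.prems"(2) set_take_subset[of "leaves s" ts] set_drop_subset[of "leaves s" ts] by blast+
  moreover have "length (take (leaves s) ts) = leaves s" "length (drop (leaves s) ts) = leaves_list ss"
    using "4.prems"(3) by simp_all
  moreover have "well_labelled G ar s" "\<forall>s\<in>set ss. well_labelled G ar s"
    using "4.prems"(1) by auto
  ultimately have "well_labelled G ar (subst s (take (leaves s) ts))"
    "\<forall>t\<in>set (subst_list ss (drop (leaves s) ts)). well_labelled G ar t"
    using "4.IH" by blast+
  then show ?case
    by simp
qed auto

lemma well_labelled_mono: "well_labelled G ar t \<Longrightarrow> G \<subseteq> H \<Longrightarrow> well_labelled H ar t"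
  by (auto simp: well_labelled_def)

lemma labels_list_Nil: "labels_list ts = [] \<Longrightarrow> ts = replicate (length ts) Leaf"
proof (induction ts)
  case (Cons t ts)
  then show ?case by (cases t) auto
qed auto

lemma labels_list_single:
  "length (labels_list ts) = 1 \<Longrightarrow> \<exists>l r x j. ts = replicate l Leaf @ Node x (replicate j Leaf) # replicate r Leaf"
proof (induction ts)
  case (Cons t ts)
  show ?case
  proof (cases t)
    case Leaf
    with Cons obtain l r x j where "ts = replicate l Leaf @ Node x (replicate j Leaf) # replicate r Leaf" by auto
    with Leaf have "t # ts = replicate (Suc l) Leaf @ Node x (replicate j Leaf) # replicate r Leaf" by simp
    then show ?thesis by blast
  next
    case (Node x us)
    then have "labels_list us = []" "labels_list ts = []"
      using Cons.prems by auto
    then have "us = replicate (length us) Leaf" "ts = replicate (length ts) Leaf"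
      by (blast intro: labels_list_Nil)+
    then have "t # ts = replicate 0 Leaf @ Node x (replicate (length us) Leaf) # replicate (length ts) Leaf"
      using Node by simp
    then show ?thesis by blast
  qed
qed auto

lemma shape_simps [simp]: "shape Leaf = Leaf" "shape (Node a ts) = Node () (map shape ts)"
  by (simp_all add: shape_def)

lemma leaves_shape [simp]: "leaves (shape t) = leaves t"
  by (induction t) (auto simp: o_def cong: map_cong)

lemma vertex_arities_shape [simp]: "vertex_arities (shape t) = vertex_arities t"
  by (induction t) (auto simp: o_def cong: map_cong)

lemma weight_shape [simp]: "weight (shape t) = weight t"
  unfolding weight_def by (metis length_vertex_arities vertex_arities_shape)

section \<open>Degrees and Koszul signs\<close>

context based_collection
begin

lemma dec_trees_iff: "t \<in> dec_trees G \<longleftrightarrow> well_labelled G ar t"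
  by (simp add: dec_trees_def well_labelled_def)

lemma sdeg_simps [simp]:
  "sdeg [] = 0" "sdeg (b # bs) = deg b - 1 + sdeg bs" "sdeg (bs @ bs') = sdeg bs + sdeg bs'"
  by (simp_all add: sdeg_def)

abbreviation tdeg :: "'b ptree \<Rightarrow> int" where
  "tdeg t \<equiv> sdeg (labels t)"

abbreviation fdeg :: "'b ptree list \<Rightarrow> int" where
  "fdeg ts \<equiv> sdeg (labels_list ts)"

lemma tdeg_graft:
  "\<lbrakk>1 \<le> i; i \<le> leaves t\<rbrakk> \<Longrightarrow> tdeg (graft t i s) = tdeg t + tdeg s"
  "\<lbrakk>1 \<le> i; i \<le> leaves_list ts\<rbrakk> \<Longrightarrow> fdeg (graft_list ts i s) = fdeg ts + tdeg s"
  by (induction t i s and ts i s rule: graft_graft_list.induct) auto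

lemma fdeg_take_drop: "fdeg (take n ts) + fdeg (drop n ts) = fdeg ts"
  using labels_list_take_drop[of n ts] by (metis sdeg_simps(3))

lemma fdeg_0: "\<forall>t\<in>set ts. tdeg t = 0 \<Longrightarrow> fdeg ts = 0"
  by (induction ts) auto

lemma tdeg_subst:
  "length ts = leaves s \<Longrightarrow> tdeg (subst s ts) = tdeg s + fdeg ts"
  "length ts = leaves_list ss \<Longrightarrow> fdeg (subst_list ss ts) = fdeg ss + fdeg ts"
proof (induction s ts and ss ts rule: subst_subst_list.induct)
  case (1 ts)
  then show ?case by (cases ts) auto
next
  case (4 s ss ts)
  then show ?case
    using fdeg_take_drop[of "leaves s" ts] by simp
qed auto

text \<open>
  The exponent of the Koszul sign of a substitution.  All trees of the forest start to the right of
  \<open>s\<close>; those that go into the first tree of a forest \<open>s # ss\<close> move past the vertices of \<open>ss\<close>.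
\<close>

fun subst_sign :: "'b ptree \<Rightarrow> 'b ptree list \<Rightarrow> int"
  and subst_sign_list :: "'b ptree list \<Rightarrow> 'b ptree list \<Rightarrow> int" where
  "subst_sign Leaf ts = 0"
| "subst_sign (Node a ss) ts = subst_sign_list ss ts"
| "subst_sign_list [] ts = 0"
| "subst_sign_list (s # ss) ts = subst_sign s (take (leaves s) ts)
     + fdeg (take (leaves s) ts) * fdeg ss + subst_sign_list ss (drop (leaves s) ts)"

lemma subst_sign_0:
  "\<forall>t\<in>set ts. tdeg t = 0 \<Longrightarrow> subst_sign s ts = 0"
  "\<forall>t\<in>set ts. tdeg t = 0 \<Longrightarrow> subst_sign_list ss ts = 0"
proof (induction s ts and ss ts rule: subst_sign_subst_sign_list.induct)
  case (4 s ss ts)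
  have *: "\<forall>t\<in>set (take (leaves s) ts). tdeg t = 0" "\<forall>t\<in>set (drop (leaves s) ts). tdeg t = 0"
    using "4.prems" set_take_subset[of "leaves s" ts] set_drop_subset[of "leaves s" ts] by blast+
  with 4 fdeg_0[OF *(1)] show ?case by simp
qed auto

text \<open>
  Both ways of computing the sign move the labels of \<open>r\<close> to the same place: either they enter the
  forest first and then move along with the tree that contains them, or they enter the
  substituted tree directly.
\<close>

lemma subst_sign_graft:
  "\<lbrakk>length ts = leaves s; 1 \<le> i; i \<le> leaves_list ts\<rbrakk> \<Longrightarrow>
     even (subst_sign s (graft_list ts i r) + tdeg r * sdeg (labels_after_list ts i)
       + subst_sign s ts + tdeg r * sdeg (labels_after (subst s ts) i))"
  "\<lbrakk>length ts = leaves_list ss; 1 \<le> i; i \<le> leaves_list ts\<rbrakk> \<Longrightarrow>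
     even (subst_sign_list ss (graft_list ts i r) + tdeg r * sdeg (labels_after_list ts i)
       + subst_sign_list ss ts + tdeg r * sdeg (labels_after_list (subst_list ss ts) i))"
proof (induction s ts and ss ts arbitrary: i and i rule: subst_subst_list.induct)
  case (1 ts)
  then show ?case by (cases ts) auto
next
  case (4 s ss ts)
  let ?l = "take (leaves s) ts" and ?r = "drop (leaves s) ts"
  have ts: "labels_after_list ts i = (if i \<le> leaves_list ?l then labels_after_list ?l i @ labels_list ?r
      else labels_after_list ?r (i - leaves_list ?l))"
    using labels_after_list_append[of i ?l ?r] 4 by simp
  show ?case
  proof (cases "i \<le> leaves_list ?l")
    case True
    then have "even (subst_sign s (graft_list ?l i r) + tdeg r * sdeg (labels_after_list ?l i)
       + subst_sign s ?l + tdeg r * sdeg (labels_after (subst s ?l) i))"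
      using 4 by auto
    then show ?thesis
      using True 4 unfolding ts
      by (simp add: take_graft_list leaves_subst tdeg_graft tdeg_subst) (auto simp: algebra_simps even_add even_mult_iff)
  next
    case False
    let ?i = "i - leaves_list ?l"
    have "?i \<le> leaves_list ?r"
      using leaves_list_take_drop[of "leaves s" ts] 4 by simp
    then have "even (subst_sign_list ss (graft_list ?r ?i r) + tdeg r * sdeg (labels_after_list ?r ?i)
       + subst_sign_list ss ?r + tdeg r * sdeg (labels_after_list (subst_list ss ?r) ?i))"
      using 4 False by auto
    then show ?thesis
      using False 4 unfolding ts
      by (simp add: take_graft_list leaves_subst) (auto simp: algebra_simps even_add even_mult_iff)
  qed
qed auto

end

section \<open>The pre-Lie product of decorated trees\<close>

definition node :: "'a \<Rightarrow> ('a ptree list \<Rightarrow>\<^sub>0 'k::field) \<Rightarrow> ('a ptree \<Rightarrow>\<^sub>0 'k)" where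
  "node a = lin_ext (\<lambda>ts. basis_vec (Node a ts))"

definition cons_forest :: "('a ptree \<Rightarrow>\<^sub>0 'k::field) \<Rightarrow> ('a ptree list \<Rightarrow>\<^sub>0 'k) \<Rightarrow> ('a ptree list \<Rightarrow>\<^sub>0 'k)" where
  "cons_forest = bilin (\<lambda>t ts. basis_vec (t # ts))"

lemma node_0 [simp]: "node a 0 = 0"
  by (simp add: node_def)

lemma node_single [simp]: "node a (Poly_Mapping.single ts c) = Poly_Mapping.single (Node a ts) c"
  by (simp add: node_def)

lemmas node_simps = lin_ext_simps[where f = "\<lambda>ts. basis_vec (Node a ts)" for a, folded node_def]

lemma cons_forest_0 [simp]: "cons_forest 0 X = 0" "cons_forest x 0 = 0"
  by (simp_all add: cons_forest_def)

lemma cons_forest_single [simp]: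
  "cons_forest (Poly_Mapping.single t c) (Poly_Mapping.single ts c') = Poly_Mapping.single (t # ts) (c * c')"
  by (simp add: cons_forest_def)

lemmas cons_forest_simps = bilin_simps[where f = "\<lambda>(t :: 'a ptree) ts. basis_vec (t # ts)", folded cons_forest_def]

lemma keys_cons_forest:
  fixes x :: "'a ptree \<Rightarrow>\<^sub>0 'k::field"
  shows "Poly_Mapping.keys (cons_forest x X) \<subseteq>
  {t # ts |t ts. t \<in> Poly_Mapping.keys x \<and> ts \<in> Poly_Mapping.keys X}"
proof -
  have "Poly_Mapping.keys (cons_forest x X) \<subseteq>
    (\<Union>t\<in>Poly_Mapping.keys x. \<Union>ts\<in>Poly_Mapping.keys X. Poly_Mapping.keys (basis_vec (t # ts) :: 'a ptree list \<Rightarrow>\<^sub>0 'k))"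
    unfolding cons_forest_def bilin_def by (rule order.trans[OF keys_lin_ext] UN_mono subset_refl keys_lin_ext)+
  then show ?thesis by (auto split: if_splits)
qed

lemma keys_node: "Poly_Mapping.keys (node a X) \<subseteq> Node a ` Poly_Mapping.keys X"
  unfolding node_def by (rule order.trans[OF keys_lin_ext]) auto

definition fill :: "'a ptree list \<Rightarrow> 'a ptree list \<Rightarrow> ('a ptree \<Rightarrow>\<^sub>0 'k::field) \<Rightarrow> ('a ptree list \<Rightarrow>\<^sub>0 'k)" where
  "fill l r = lin_ext (\<lambda>t. basis_vec (l @ t # r))"

lemma fill_0 [simp]: "fill l r 0 = 0"
  by (simp add: fill_def)

lemmas fill_simps = lin_ext_simps[where f = "\<lambda>t :: 'a ptree. basis_vec (l @ t # r)" for l r, folded fill_def]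

lemma fill_Cons: "cons_forest (basis_vec t) (fill l r x) = fill (t # l) r x"
  by (induction rule: pm_keys_induct[OF subset_UNIV[of "Poly_Mapping.keys x"]])
     (auto simp: fill_def lin_ext_simps cons_forest_simps)

lemma fill_Nil: "cons_forest x (basis_vec r) = fill [] r x"
  by (induction rule: pm_keys_induct[OF subset_UNIV[of "Poly_Mapping.keys x"]])
     (auto simp: fill_def lin_ext_simps cons_forest_simps)

context based_collection
begin

text \<open>
  The sum of the partial compositions of \<open>s\<close> into all leaves of \<open>t\<close>, with their Koszul signs
  (\<open>insert_leaves_eq_sum\<close>).  The recursion over the tree does without the numbering of the leaves.
\<close>

fun insert_leaves :: "'b ptree \<Rightarrow> 'b ptree \<Rightarrow> ('b ptree \<Rightarrow>\<^sub>0 'k::field)"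
  and insert_leaves_list :: "'b ptree list \<Rightarrow> 'b ptree \<Rightarrow> ('b ptree list \<Rightarrow>\<^sub>0 'k::field)" where
  "insert_leaves Leaf s = basis_vec s"
| "insert_leaves (Node a ts) s = node a (insert_leaves_list ts s)"
| "insert_leaves_list [] s = 0"
| "insert_leaves_list (t # ts) s =
     pm_scale (koszul (tdeg s * fdeg ts)) (cons_forest (insert_leaves t s) (basis_vec ts))
     + cons_forest (basis_vec t) (insert_leaves_list ts s)"

definition star :: "('b ptree \<Rightarrow>\<^sub>0 'k::field) \<Rightarrow> ('b ptree \<Rightarrow>\<^sub>0 'k) \<Rightarrow> ('b ptree \<Rightarrow>\<^sub>0 'k)" where
  "star = bilin insert_leaves"

definition star_list :: "('b ptree list \<Rightarrow>\<^sub>0 'k::field) \<Rightarrow> ('b ptree \<Rightarrow>\<^sub>0 'k) \<Rightarrow> ('b ptree list \<Rightarrow>\<^sub>0 'k)" where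
  "star_list = bilin insert_leaves_list"

lemma star_0 [simp]: "star 0 y = 0" "star x 0 = 0" "star_list 0 y = 0" "star_list X 0 = 0"
  by (simp_all add: star_def star_list_def)

lemma star_single [simp]:
  "star (Poly_Mapping.single t c) (Poly_Mapping.single s c') = pm_scale (c * c') (insert_leaves t s)"
  "star_list (Poly_Mapping.single ts c) (Poly_Mapping.single s c') = pm_scale (c * c') (insert_leaves_list ts s)"
  by (simp_all add: star_def star_list_def)

lemmas star_simps = bilin_simps[where f = insert_leaves, folded star_def]

lemmas star_list_simps = bilin_simps[where f = insert_leaves_list, folded star_list_def]

definition homogeneous :: "int \<Rightarrow> ('b ptree \<Rightarrow>\<^sub>0 'k::field) set" where
  "homogeneous p = {x. Poly_Mapping.keys x \<subseteq> {t. tdeg t = p}}"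

definition homogeneous_forest :: "int \<Rightarrow> ('b ptree list \<Rightarrow>\<^sub>0 'k::field) set" where
  "homogeneous_forest p = {x. Poly_Mapping.keys x \<subseteq> {ts. fdeg ts = p}}"

lemma star_node: "star (node a X) y = node a (star_list X y)"
proof (induction rule: pm_keys_induct[OF subset_UNIV[of "Poly_Mapping.keys X"]])
  case (4 ts)
  show ?case
    by (induction rule: pm_keys_induct[OF subset_UNIV[of "Poly_Mapping.keys y"]])
      (auto simp: node_simps star_simps star_list_simps simp del: pm_scale_simps(5))
qed (auto simp: node_simps star_simps star_list_simps)

lemma homogeneous_basis [simp]: "basis_vec t \<in> homogeneous p \<longleftrightarrow> tdeg t = p" "basis_vec ts \<in> homogeneous_forest p \<longleftrightarrow> fdeg ts = p"
  by (auto simp: homogeneous_def homogeneous_forest_def)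

lemma free_operad_homogeneous: "x \<in> free_operad G n p \<Longrightarrow> x \<in> homogeneous p"
  by (auto simp: free_operad_def homogeneous_def)

lemma keys_insert_leaves:
  "Poly_Mapping.keys (insert_leaves t s :: 'b ptree \<Rightarrow>\<^sub>0 'k::field) \<subseteq>
    {r. tdeg r = tdeg t + tdeg s \<and> leaves r + 1 = leaves t + leaves s \<and>
        (well_labelled G ar t \<longrightarrow> well_labelled G ar s \<longrightarrow> well_labelled G ar r)}"
  "Poly_Mapping.keys (insert_leaves_list ts s :: 'b ptree list \<Rightarrow>\<^sub>0 'k) \<subseteq>
    {rs. fdeg rs = fdeg ts + tdeg s \<and> leaves_list rs + 1 = leaves_list ts + leaves s \<and> length rs = length ts \<and>
        ((\<forall>t\<in>set ts. well_labelled G ar t) \<longrightarrow> well_labelled G ar s \<longrightarrow> (\<forall>r\<in>set rs. well_labelled G ar r))}"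
proof (induction t s and ts s rule: insert_leaves_insert_leaves_list.induct)
  case (2 a ts s)
  show ?case
    unfolding insert_leaves.simps by (rule order.trans[OF keys_node]) (use 2 in force)
next
  case (4 t ts s)
  show ?case
    unfolding insert_leaves_list.simps
    by (intro keys_subset_add order.trans[OF keys_pm_scale] order.trans[OF keys_cons_forest]) (use 4 in fastforce)+
qed auto

lemma insert_leaves_homogeneous:
  "(insert_leaves t s :: 'b ptree \<Rightarrow>\<^sub>0 'k::field) \<in> homogeneous (tdeg t + tdeg s)"
  "(insert_leaves_list ts s :: 'b ptree list \<Rightarrow>\<^sub>0 'k) \<in> homogeneous_forest (fdeg ts + tdeg s)"
  using keys_insert_leaves(1)[of t s UNIV] keys_insert_leaves(2)[of ts s UNIV]
  by (force simp: homogeneous_def homogeneous_forest_def)+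

lemma star_free_operad:
  fixes x y :: "'b ptree \<Rightarrow>\<^sub>0 'k::field"
  assumes x: "x \<in> free_operad G n p" and y: "y \<in> free_operad G m q"
  shows "star x y \<in> free_operad G (n + m - 1) (p + q)"
proof -
  have "Poly_Mapping.keys (star x y) \<subseteq> {t. t \<in> dec_trees G \<and> leaves t = n + m - 1 \<and> tdeg t = p + q}"
    unfolding star_def
  proof (rule keys_subset_bilin)
    fix t s assume "t \<in> Poly_Mapping.keys x" "s \<in> Poly_Mapping.keys y"
    then show "Poly_Mapping.keys (insert_leaves t s :: 'b ptree \<Rightarrow>\<^sub>0 'k)
        \<subseteq> {t. t \<in> dec_trees G \<and> leaves t = n + m - 1 \<and> tdeg t = p + q}"
      using x y keys_insert_leaves(1)[of t s G] by (fastforce simp: free_operad_def dec_trees_iff)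
  qed
  then show ?thesis
    by (auto simp: free_operad_def)
qed

text \<open>
  An insertion into a forest happens in its first tree, where \<open>y\<close> has to pass the labels of the
  other trees, or in one of the other trees.
\<close>

lemma star_list_cons:
  assumes X: "X \<in> homogeneous_forest q" and y: "y \<in> homogeneous p"
  shows "star_list (cons_forest x X) y =
    pm_scale (koszul (p * q)) (cons_forest (star x y) X) + cons_forest x (star_list X y)"
  using X[unfolded homogeneous_forest_def mem_Collect_eq]
proof (induction rule: pm_keys_induct)
  case (basis ts)
  show ?case using y[unfolded homogeneous_def mem_Collect_eq]
  proof (induction rule: pm_keys_induct)
    case (basis s)
    show ?case
      using \<open>ts \<in> _\<close> basis
      by (induction rule: pm_keys_induct[OF subset_UNIV[of "Poly_Mapping.keys x"]])
        (auto simp: cons_forest_simps star_simps star_list_simps pm_scale_distribs mult.commute simp del: pm_scale_simps(5))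
  qed (auto simp: cons_forest_simps star_simps star_list_simps pm_scale_distribs mult.commute)
qed (auto simp: cons_forest_simps star_simps star_list_simps pm_scale_distribs mult.commute)

definition assoc_tree :: "'b ptree \<Rightarrow> 'b ptree \<Rightarrow> 'b ptree \<Rightarrow> ('b ptree \<Rightarrow>\<^sub>0 'k::field)" where
  "assoc_tree t s r = star (insert_leaves t s) (basis_vec r) - star (basis_vec t) (insert_leaves s r)"

definition assoc_list :: "'b ptree list \<Rightarrow> 'b ptree \<Rightarrow> 'b ptree \<Rightarrow> ('b ptree list \<Rightarrow>\<^sub>0 'k::field)" where
  "assoc_list ts s r = star_list (insert_leaves_list ts s) (basis_vec r) - star_list (basis_vec ts) (insert_leaves s r)"

lemma star_list_nil [simp]: "star_list (basis_vec []) y = 0"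
proof (induction rule: pm_keys_induct[OF subset_UNIV[of "Poly_Mapping.keys y"]])
qed (auto simp: star_list_simps)

lemma star_Leaf [simp]: "star (basis_vec Leaf) y = y"
proof (induction rule: pm_keys_induct[OF subset_UNIV[of "Poly_Mapping.keys y"]])
qed (auto simp: star_simps)

lemma star_Node: "star (basis_vec (Node a ts)) y = node a (star_list (basis_vec ts) y)"
  using star_node[of a "basis_vec ts" y] by simp

text \<open>
  No signs occur when all the labels that \<open>s\<close> has to pass are even.
\<close>

lemma insert_leaves_list_degree_0:
  assumes "\<forall>t\<in>set ts. tdeg t = 0"
  shows "(insert_leaves_list ts s :: _ \<Rightarrow>\<^sub>0 'k::field) =
    (\<Sum>j<length ts. fill (take j ts) (drop (Suc j) ts) (insert_leaves (ts ! j) s))"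
  using assms
  by (induction ts)
     (simp_all add: sum.lessThan_Suc_shift cons_forest_simps fill_Cons fill_Nil fdeg_0 del: sum.lessThan_Suc)

lemma star_Node_degree_0:
  fixes y :: "'b ptree \<Rightarrow>\<^sub>0 'k::field"
  assumes "\<forall>t\<in>set ts. tdeg t = 0"
  shows "star (basis_vec (Node a ts)) y =
    (\<Sum>j<length ts. node a (fill (take j ts) (drop (Suc j) ts) (star (basis_vec (ts ! j)) y)))"
  by (induction rule: pm_keys_induct[OF subset_UNIV[of "Poly_Mapping.keys y"]])
     (auto simp: star_simps node_simps fill_simps insert_leaves_list_degree_0[OF assms] sum.distrib pm_scale_sum)

text \<open>
  In the associator, the trees in which \<open>r\<close> is attached to \<open>s\<close> cancel.  In the remaining ones \<open>s\<close> and \<open>r\<close>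
  occupy two different leaves, and attaching them in the other order yields the same tree up to the
  sign of exchanging them.  In the recursion over a forest \<open>t # ts\<close> the two leaves lie both in
  \<open>t\<close>, both in \<open>ts\<close>, or one in each; the last case gives the terms \<open>C\<close>.
\<close>

lemma pre_Lie_tree:
  "(assoc_tree t s r :: 'b ptree \<Rightarrow>\<^sub>0 'k::field) = pm_scale (koszul (tdeg s * tdeg r)) (assoc_tree t r s)"
  "(assoc_list ts s r :: 'b ptree list \<Rightarrow>\<^sub>0 'k) = pm_scale (koszul (tdeg s * tdeg r)) (assoc_list ts r s)"
proof (induction t s and ts s arbitrary: r and r rule: insert_leaves_insert_leaves_list.induct)
  case (1 s)
  show ?case by (simp add: assoc_tree_def)
next
  case (2 a ts s)
  have "(assoc_tree (Node a ts) s r :: 'b ptree \<Rightarrow>\<^sub>0 'k) = node a (assoc_list ts s r)" for s r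
    by (simp add: assoc_tree_def assoc_list_def star_node star_Node node_simps)
  then show ?case
    using 2 by (metis node_simps(2))
next
  case 3
  then show ?case by (simp add: assoc_list_def)
next
  case (4 t ts s)
  define C :: "'b ptree \<Rightarrow> 'b ptree \<Rightarrow> ('b ptree list \<Rightarrow>\<^sub>0 'k)" where "C s r = pm_scale (koszul (tdeg s * fdeg ts)) (cons_forest (insert_leaves t s) (insert_leaves_list ts r))
    + pm_scale (koszul (tdeg r * (fdeg ts + tdeg s))) (cons_forest (insert_leaves t r) (insert_leaves_list ts s))" for s r
  have key: "(assoc_list (t # ts) s r :: 'b ptree list \<Rightarrow>\<^sub>0 'k) = pm_scale (koszul ((tdeg s + tdeg r) * fdeg ts)) (cons_forest (assoc_tree t s r) (basis_vec ts))
      + cons_forest (basis_vec t) (assoc_list ts s r) + C s r" for s r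
  proof -
    have 1: "(star_list (cons_forest (insert_leaves t s) (basis_vec ts)) (basis_vec r) :: 'b ptree list \<Rightarrow>\<^sub>0 'k) =
      pm_scale (koszul (tdeg r * fdeg ts)) (cons_forest (star (insert_leaves t s) (basis_vec r)) (basis_vec ts))
      + cons_forest (insert_leaves t s) (insert_leaves_list ts r)"
      by (subst star_list_cons[where p = "tdeg r" and q = "fdeg ts"]) auto
    have 2: "(star_list (cons_forest (basis_vec t) (insert_leaves_list ts s)) (basis_vec r) :: 'b ptree list \<Rightarrow>\<^sub>0 'k) =
      pm_scale (koszul (tdeg r * (fdeg ts + tdeg s))) (cons_forest (insert_leaves t r) (insert_leaves_list ts s))
      + cons_forest (basis_vec t) (star_list (insert_leaves_list ts s) (basis_vec r))"
      by (subst star_list_cons[where p = "tdeg r" and q = "fdeg ts + tdeg s"]) (auto intro: insert_leaves_homogeneous)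
    have 3: "(star_list (basis_vec (t # ts)) (insert_leaves s r) :: 'b ptree list \<Rightarrow>\<^sub>0 'k) =
      pm_scale (koszul ((tdeg s + tdeg r) * fdeg ts)) (cons_forest (star (basis_vec t) (insert_leaves s r)) (basis_vec ts))
      + cons_forest (basis_vec t) (star_list (basis_vec ts) (insert_leaves s r))"
      using star_list_cons[where p = "tdeg s + tdeg r" and q = "fdeg ts" and x = "basis_vec t" and X = "basis_vec ts" and y = "insert_leaves s r :: 'b ptree \<Rightarrow>\<^sub>0 'k"]
      by (auto intro: insert_leaves_homogeneous)
    have "(star_list (insert_leaves_list (t # ts) s) (basis_vec r) :: 'b ptree list \<Rightarrow>\<^sub>0 'k) =
      pm_scale (koszul ((tdeg s + tdeg r) * fdeg ts)) (cons_forest (star (insert_leaves t s) (basis_vec r)) (basis_vec ts))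
      + cons_forest (basis_vec t) (star_list (insert_leaves_list ts s) (basis_vec r)) + C s r"
      by (simp add: star_list_simps 1 2 C_def pm_scale_distribs distrib_right koszul_add)
    then show ?thesis
      unfolding assoc_list_def[of "t # ts"] 3
      by (simp add: assoc_tree_def assoc_list_def cons_forest_simps pm_scale_distribs)
  qed
  have "pm_scale (koszul (tdeg s * tdeg r)) (C r s) = C s r"
    by (auto simp: C_def pm_scale_distribs koszul_def)
  then show ?case
    unfolding key 4 by (simp add: pm_scale_distribs cons_forest_simps mult.commute[of "koszul (tdeg s * tdeg r)"]) (simp add: algebra_simps)
qed

lemma star_pre_Lie:
  assumes y: "y \<in> homogeneous p" and z: "z \<in> homogeneous q"
  shows "star (star x y) z - star x (star y z) =
    pm_scale (koszul (p * q)) (star (star x z) y - star x (star z y))"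
  using y[unfolded homogeneous_def mem_Collect_eq]
proof (induction rule: pm_keys_induct)
  case (basis s)
  show ?case using z[unfolded homogeneous_def mem_Collect_eq]
  proof (induction rule: pm_keys_induct)
    case (basis r)
    show ?case
    proof (induction rule: pm_keys_induct[OF subset_UNIV[of "Poly_Mapping.keys x"]])
      case (4 t)
      show ?case
        using \<open>s \<in> _\<close> \<open>r \<in> _\<close> pre_Lie_tree(1)[of t s r] by (simp add: assoc_tree_def)
    qed (auto simp: star_simps algebra_simps simp flip: pm_scale_distribs)
  qed (auto simp: star_simps algebra_simps simp flip: pm_scale_distribs)
qed (auto simp: star_simps algebra_simps simp flip: pm_scale_distribs)

end

section \<open>The derivation of a free operad with given values on the generators\<close>

text \<open>
  A vertex decorated by \<open>b\<close> stands for \<open>s\<^sup>-\<^sup>1 b\<close>, of degree \<open>deg b - 1\<close>, so a differential has to send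
  it to an element of degree \<open>deg b - 2\<close>.
\<close>

locale derivation_data = based_collection B ar deg
  for B :: "'b set" and ar :: "'b \<Rightarrow> nat" and deg :: "'b \<Rightarrow> int" +
  fixes G :: "'b set" and D :: "'b \<Rightarrow> ('b ptree \<Rightarrow>\<^sub>0 'k::field)"
  assumes D_mem: "b \<in> G \<Longrightarrow> D b \<in> free_operad G (ar b) (deg b - 2)"
begin

abbreviation wl :: "'b ptree \<Rightarrow> bool" where
  "wl \<equiv> well_labelled G ar"

definition local_part :: "'b \<Rightarrow> 'b ptree list \<Rightarrow> ('b ptree \<Rightarrow>\<^sub>0 'k)" where
  "local_part a ts = lin_ext (\<lambda>s. Poly_Mapping.single (subst s ts) (koszul (subst_sign s ts))) (D a)"

text \<open>
  The Leibniz rule: the differential hits the root, whose value receives the subtrees at its leaves,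
  or it passes the root and hits the forest of subtrees.
\<close>

fun deriv_tree :: "'b ptree \<Rightarrow> ('b ptree \<Rightarrow>\<^sub>0 'k)"
  and deriv_forest :: "'b ptree list \<Rightarrow> ('b ptree list \<Rightarrow>\<^sub>0 'k)" where
  "deriv_tree Leaf = 0"
| "deriv_tree (Node a ts) =
     local_part a ts + pm_scale (koszul (deg a - 1)) (node a (deriv_forest ts))"
| "deriv_forest [] = 0"
| "deriv_forest (t # ts) = cons_forest (deriv_tree t) (basis_vec ts)
     + pm_scale (koszul (tdeg t)) (cons_forest (basis_vec t) (deriv_forest ts))"

definition deriv :: "('b ptree \<Rightarrow>\<^sub>0 'k) \<Rightarrow> ('b ptree \<Rightarrow>\<^sub>0 'k)" where
  "deriv = lin_ext deriv_tree"

definition deriv_list :: "('b ptree list \<Rightarrow>\<^sub>0 'k) \<Rightarrow> ('b ptree list \<Rightarrow>\<^sub>0 'k)" where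
  "deriv_list = lin_ext deriv_forest"

definition pcomp_list :: "('b ptree list \<Rightarrow>\<^sub>0 'k) \<Rightarrow> nat \<Rightarrow> ('b ptree \<Rightarrow>\<^sub>0 'k) \<Rightarrow> ('b ptree list \<Rightarrow>\<^sub>0 'k)" where
  "pcomp_list X i = bilin (\<lambda>ts s. Poly_Mapping.single (graft_list ts i s)
       (koszul (tdeg s * sdeg (labels_after_list ts i)))) X"

lemma pcomp_bilin: "pcomp x i = bilin (\<lambda>t s. Poly_Mapping.single (graft t i s)
       (koszul (tdeg s * sdeg (labels_after t i)))) x"
  by (rule ext) (simp add: pcomp_def bilin_def)

lemma pcomp_0 [simp]: "pcomp 0 i y = 0" "pcomp x i 0 = 0" "pcomp_list 0 i y = 0" "pcomp_list X i 0 = 0"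
  by (simp_all add: pcomp_bilin pcomp_list_def)

lemmas pcomp_simps = bilin_simps[where f = "\<lambda>t s. Poly_Mapping.single (graft t i s)
       (koszul (tdeg s * sdeg (labels_after t i)) :: 'k)" for i, folded pcomp_bilin]

lemmas pcomp_list_simps = bilin_simps[where f = "\<lambda>ts s. Poly_Mapping.single (graft_list ts i s)
       (koszul (tdeg s * sdeg (labels_after_list ts i)) :: 'k)" for i, folded pcomp_list_def]

lemma pcomp_single [simp]:
  "pcomp (Poly_Mapping.single t c) i (Poly_Mapping.single s c') =
     Poly_Mapping.single (graft t i s) (c * c' * koszul (tdeg s * sdeg (labels_after t i)))"
  "pcomp_list (Poly_Mapping.single ts c) i (Poly_Mapping.single s c') =
     Poly_Mapping.single (graft_list ts i s) (c * c' * koszul (tdeg s * sdeg (labels_after_list ts i)))"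
  by (simp_all add: pcomp_bilin pcomp_list_def)

lemma deriv_0 [simp]: "deriv 0 = 0" "deriv_list 0 = 0"
  by (simp_all add: deriv_def deriv_list_def)

lemma deriv_single [simp]:
  "deriv (Poly_Mapping.single t c) = pm_scale c (deriv_tree t)"
  "deriv_list (Poly_Mapping.single ts c) = pm_scale c (deriv_forest ts)"
  by (simp_all add: deriv_def deriv_list_def)

lemmas deriv_simps = lin_ext_simps[where f = deriv_tree, folded deriv_def]

lemmas deriv_list_simps = lin_ext_simps[where f = deriv_forest, folded deriv_list_def]

definition tree_space :: "nat \<Rightarrow> int \<Rightarrow> 'b ptree set" where
  "tree_space n p = {t. wl t \<and> leaves t = n \<and> tdeg t = p}"

definition forest_space :: "nat \<Rightarrow> nat \<Rightarrow> int \<Rightarrow> 'b ptree list set" where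
  "forest_space l n p = {ts. length ts = l \<and> (\<forall>t\<in>set ts. wl t) \<and> leaves_list ts = n \<and> fdeg ts = p}"

lemma free_operad_iff: "x \<in> free_operad G n p \<longleftrightarrow> Poly_Mapping.keys x \<subseteq> tree_space n p"
  by (auto simp: free_operad_def tree_space_def dec_trees_iff)

lemma keys_D: "b \<in> G \<Longrightarrow> Poly_Mapping.keys (D b) \<subseteq> tree_space (ar b) (deg b - 2)"
  using D_mem by (simp add: free_operad_iff)

lemma keys_deriv:
  "wl t \<Longrightarrow> Poly_Mapping.keys (deriv_tree t) \<subseteq> tree_space (leaves t) (tdeg t - 1)"
  "\<forall>t\<in>set ts. wl t \<Longrightarrow>
     Poly_Mapping.keys (deriv_forest ts) \<subseteq> forest_space (length ts) (leaves_list ts) (fdeg ts - 1)"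
proof (induction t and ts rule: deriv_tree_deriv_forest.induct)
  case (2 a ts)
  have "Poly_Mapping.keys (local_part a ts) \<subseteq> tree_space (leaves_list ts) (deg a - 1 + fdeg ts - 1)"
    unfolding local_part_def
  proof (rule keys_subset_lin_ext)
    fix s assume "s \<in> Poly_Mapping.keys (D a)"
    with keys_D[of a] 2 have "wl s" "leaves s = length ts" "tdeg s = deg a - 2"
      by (auto simp: tree_space_def)
    then have "subst s ts \<in> tree_space (leaves_list ts) (deg a - 1 + fdeg ts - 1)"
      using 2 well_labelled_subst(1)[of G ar s ts] by (simp add: tree_space_def leaves_subst tdeg_subst)
    then show "Poly_Mapping.keys (Poly_Mapping.single (subst s ts) (koszul (subst_sign s ts) :: 'k))
        \<subseteq> tree_space (leaves_list ts) (deg a - 1 + fdeg ts - 1)"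
      by auto
  qed
  moreover have "Poly_Mapping.keys (pm_scale (koszul (deg a - 1)) (node a (deriv_forest ts)))
      \<subseteq> tree_space (leaves_list ts) (deg a - 1 + fdeg ts - 1)"
    using 2 keys_node[of a "deriv_forest ts"]
    by (intro order.trans[OF keys_pm_scale]) (force simp: forest_space_def tree_space_def)
  ultimately show ?case
    by (simp add: keys_subset_add)
next
  case (4 t ts)
  show ?case
    unfolding deriv_forest.simps
    by (intro keys_subset_add order.trans[OF keys_pm_scale] order.trans[OF keys_cons_forest])
       (use 4 in \<open>fastforce simp: forest_space_def tree_space_def\<close>)+
qed auto

lemma deriv_forest_degree_0:
  assumes "\<forall>t\<in>set ts. tdeg t = 0"
  shows "deriv_forest ts = (\<Sum>j<length ts. fill (take j ts) (drop (Suc j) ts) (deriv_tree (ts ! j)))"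
  using assms
  by (induction ts)
     (simp_all add: sum.lessThan_Suc_shift cons_forest_simps fill_Cons fill_Nil fdeg_0 del: sum.lessThan_Suc)

lemma pcomp_node: "pcomp (node a X) i y = node a (pcomp_list X i y)"
proof (induction rule: pm_keys_induct[OF subset_UNIV[of "Poly_Mapping.keys X"]])
  case (4 ts)
  show ?case
    by (induction rule: pm_keys_induct[OF subset_UNIV[of "Poly_Mapping.keys y"]])
      (auto simp: node_simps pcomp_simps pcomp_list_simps)
qed (auto simp: node_simps pcomp_simps pcomp_list_simps)

lemma pcomp_list_cons:
  assumes x: "Poly_Mapping.keys x \<subseteq> {t. leaves t = n}" and X: "X \<in> homogeneous_forest q" and y: "y \<in> homogeneous p"
  shows "pcomp_list (cons_forest x X) i y =
    (if i \<le> n then pm_scale (koszul (p * q)) (cons_forest (pcomp x i y) X)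
     else cons_forest x (pcomp_list X (i - n) y))"
  using x
proof (induction rule: pm_keys_induct)
  case (basis t)
  show ?case using X[unfolded homogeneous_forest_def mem_Collect_eq]
  proof (induction rule: pm_keys_induct)
    case (basis ts)
    show ?case using y[unfolded homogeneous_def mem_Collect_eq]
      by (induction rule: pm_keys_induct)
        (use \<open>t \<in> _\<close> \<open>ts \<in> _\<close> in \<open>auto simp: cons_forest_simps pcomp_simps pcomp_list_simps pm_scale_distribs
           koszul_add distrib_left mult.commute\<close>)
  qed (auto simp: cons_forest_simps pcomp_simps pcomp_list_simps pm_scale_distribs mult.commute)
qed (auto simp: cons_forest_simps pcomp_simps pcomp_list_simps pm_scale_distribs mult.commute)

lemma deriv_node: "deriv (node a X) =
    lin_ext (local_part a) X + pm_scale (koszul (deg a - 1)) (node a (deriv_list X))"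
  by (induction rule: pm_keys_induct[OF subset_UNIV[of "Poly_Mapping.keys X"]])
     (auto simp: node_simps lin_ext_simps deriv_simps deriv_list_simps pm_scale_distribs mult.commute)

lemma deriv_list_cons:
  assumes x: "x \<in> homogeneous p"
  shows "deriv_list (cons_forest x X) = cons_forest (deriv x) X + pm_scale (koszul p) (cons_forest x (deriv_list X))"
  using x[unfolded homogeneous_def mem_Collect_eq]
proof (induction rule: pm_keys_induct)
  case (basis t)
  show ?case
    by (induction rule: pm_keys_induct[OF subset_UNIV[of "Poly_Mapping.keys X"]])
       (use basis in \<open>auto simp: cons_forest_simps deriv_simps deriv_list_simps pm_scale_distribs mult.commute\<close>)
qed (auto simp: cons_forest_simps deriv_simps deriv_list_simps pm_scale_distribs mult.commute)

text \<open>
  Replacing the root does not affect the leaves of the forest, so \<open>s\<close> may be grafted before or after.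
  The sign on the right is the one of grafting into the forest; \<open>subst_sign_graft\<close> compares it with the
  one of grafting into the substituted trees.
\<close>

lemma local_part_graft:
  assumes "a \<in> G" "length ts = ar a" "1 \<le> i" "i \<le> leaves_list ts"
  shows "pcomp (local_part a ts) i (basis_vec s) =
    pm_scale (koszul (tdeg s * sdeg (labels_after_list ts i))) (local_part a (graft_list ts i s))"
proof -
  have "pcomp (local_part a ts) i (basis_vec s) =
    lin_ext (\<lambda>r. pcomp (Poly_Mapping.single (subst r ts) (koszul (subst_sign r ts))) i (basis_vec s)) (D a)"
    unfolding local_part_def
    by (induction rule: pm_keys_induct[OF subset_UNIV[of "Poly_Mapping.keys (D a)"]])
       (simp_all add: pcomp_simps lin_ext_simps del: pcomp_single pm_scale_simps(5))
  also have "\<dots> = lin_ext (\<lambda>r. pm_scale (koszul (tdeg s * sdeg (labels_after_list ts i)))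
      (Poly_Mapping.single (subst r (graft_list ts i s)) (koszul (subst_sign r (graft_list ts i s))))) (D a)"
  proof (rule lin_ext_cong)
    fix r assume "r \<in> Poly_Mapping.keys (D a)"
    with keys_D[of a] assms have "length ts = leaves r"
      by (auto simp: tree_space_def)
    then show "pcomp (Poly_Mapping.single (subst r ts) (koszul (subst_sign r ts) :: 'k)) i (basis_vec s) =
       pm_scale (koszul (tdeg s * sdeg (labels_after_list ts i)))
      (Poly_Mapping.single (subst r (graft_list ts i s)) (koszul (subst_sign r (graft_list ts i s))))"
      using subst_sign_graft(1)[of ts r i s] subst_graft(1)[of ts r i s] assms
      by (auto simp: koszul_def)
  qed
  also have "\<dots> = pm_scale (koszul (tdeg s * sdeg (labels_after_list ts i))) (local_part a (graft_list ts i s))"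
    unfolding local_part_def by (rule lin_ext_fun_scale)
  finally show ?thesis .
qed

text \<open>
  The Leibniz rule for partial compositions of trees, by recursion along the path to the leaf \<open>i\<close>.
  At the root the differential of the root itself is covered by \<open>local_part_graft\<close>; in a forest the
  signs of passing the trees beside the path have to be compared.
\<close>

lemma deriv_pcomp_tree:
  "\<lbrakk>wl t; wl s; 1 \<le> i; i \<le> leaves t\<rbrakk> \<Longrightarrow>
     deriv (pcomp (basis_vec t) i (basis_vec s)) = pcomp (deriv_tree t) i (basis_vec s)
       + pm_scale (koszul (tdeg t)) (pcomp (basis_vec t) i (deriv_tree s))"
  "\<lbrakk>\<forall>t\<in>set ts. wl t; wl s; 1 \<le> i; i \<le> leaves_list ts\<rbrakk> \<Longrightarrow>
     deriv_list (pcomp_list (basis_vec ts) i (basis_vec s)) = pcomp_list (deriv_forest ts) i (basis_vec s)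
       + pm_scale (koszul (fdeg ts)) (pcomp_list (basis_vec ts) i (deriv_tree s))"
proof (induction t i s and ts i s rule: graft_graft_list.induct)
  case (1 i s)
  have "pcomp (basis_vec Leaf) (Suc 0) y = y" for y :: "'b ptree \<Rightarrow>\<^sub>0 'k"
    by (induction rule: pm_keys_induct[OF subset_UNIV[of "Poly_Mapping.keys y"]])
       (auto simp: pcomp_simps)
  with 1 show ?case by simp
next
  case (2 a ts i s)
  have node: "pcomp (basis_vec (Node a ts)) i y = node a (pcomp_list (basis_vec ts) i y)" for y
    using pcomp_node[of a "basis_vec ts"] by simp
  have loc: "lin_ext (local_part a) (pcomp_list (basis_vec ts) i (basis_vec s))
      = pcomp (local_part a ts) i (basis_vec s)"
    using 2 by (simp add: local_part_graft)
  show ?case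
    using 2 unfolding node deriv_node loc deriv_tree.simps
    by (simp del: pcomp_single add: pcomp_node pcomp_simps node_simps pm_scale_distribs koszul_add add.assoc)
next
  case (3 i s)
  then show ?case by simp
next
  case (4 t ts i s)
  have ds: "deriv_tree s \<in> homogeneous (tdeg s - 1)" and dts: "deriv_forest ts \<in> homogeneous_forest (fdeg ts - 1)"
    using keys_deriv(1)[of s] keys_deriv(2)[of ts] 4
    by (auto simp: homogeneous_def homogeneous_forest_def tree_space_def forest_space_def)
  have dt: "Poly_Mapping.keys (deriv_tree t) \<subseteq> {t'. leaves t' = leaves t}"
    using keys_deriv(1)[of t] 4 by (auto simp: tree_space_def)
  have bt: "Poly_Mapping.keys (basis_vec t :: 'b ptree \<Rightarrow>\<^sub>0 'k) \<subseteq> {t'. leaves t' = leaves t}"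
    by simp
  have cons: "basis_vec (t # ts) = cons_forest (basis_vec t) (basis_vec ts :: _ \<Rightarrow>\<^sub>0 'k)"
    by simp
  note step = pcomp_list_cons[OF bt, of "basis_vec ts" "fdeg ts" "basis_vec s" "tdeg s" i]
    pcomp_list_cons[OF bt dts, of "basis_vec s" "tdeg s" i]
    pcomp_list_cons[OF dt, of "basis_vec ts" "fdeg ts" "basis_vec s" "tdeg s" i]
    pcomp_list_cons[OF bt _ ds, of "basis_vec ts" "fdeg ts" i]
  show ?case
  proof (cases "i \<le> leaves t")
    case True
    have "pcomp (basis_vec t) i (basis_vec s :: _ \<Rightarrow>\<^sub>0 'k) \<in> homogeneous (tdeg t + tdeg s :: int)"
      using True 4 by (auto simp: homogeneous_def tdeg_graft)
    note dl = deriv_list_cons[OF this, of "basis_vec ts"]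
    show ?thesis
      using True 4 unfolding cons deriv_forest.simps pcomp_list_simps
      by (simp add: step dl deriv_list_simps pcomp_list_simps cons_forest_simps pm_scale_distribs
          del: cons_forest_single pcomp_single)
        (auto simp: koszul_def cons_forest_simps)
  next
    case False
    have "(basis_vec t :: _ \<Rightarrow>\<^sub>0 'k) \<in> homogeneous (tdeg t)" by simp
    note dl = deriv_list_cons[OF this, of "pcomp_list (basis_vec ts) (i - leaves t) (basis_vec s)"]
    show ?thesis
      using False 4 unfolding cons deriv_forest.simps pcomp_list_simps
      by (simp add: step dl deriv_list_simps pcomp_list_simps cons_forest_simps pm_scale_distribs koszul_add
          del: cons_forest_single pcomp_single)
  qed
qed

text \<open>
  Leaves can be substituted without effect and have degree \<open>0\<close>, so only the value at the root survives.
\<close>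

lemma deriv_corolla:
  assumes "b \<in> G"
  shows "deriv (basis_vec (corolla b (ar b))) = D b"
proof -
  have "deriv_forest (replicate n Leaf) = 0" for n
    by (induction n) auto
  moreover have "local_part b (replicate (ar b) Leaf) = lin_ext basis_vec (D b)"
    unfolding local_part_def
  proof (rule lin_ext_cong)
    fix s assume "s \<in> Poly_Mapping.keys (D b)"
    then have "leaves s = ar b"
      using keys_D[OF assms] by (auto simp: tree_space_def)
    then show "Poly_Mapping.single (subst s (replicate (ar b) Leaf)) (koszul (subst_sign s (replicate (ar b) Leaf)))
        = (basis_vec s :: _ \<Rightarrow>\<^sub>0 'k)"
      by (simp add: subst_replicate_Leaf subst_sign_0 set_replicate_conv_if)
  qed
  moreover have "lin_ext basis_vec x = x" for x :: "'b ptree \<Rightarrow>\<^sub>0 'k"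
    by (induction rule: pm_keys_induct[OF subset_UNIV[of "Poly_Mapping.keys x"]]) (auto simp: lin_ext_simps)
  ultimately show ?thesis
    by (simp add: corolla_def)
qed

lemma deriv_free_operad:
  assumes "x \<in> free_operad G n p"
  shows "deriv x \<in> free_operad G n (p - 1)"
  using assms keys_deriv(1) unfolding free_operad_iff deriv_def
  by (intro keys_subset_lin_ext) (force simp: tree_space_def)

lemma deriv_pcomp:
  assumes x: "x \<in> free_operad G n p" and y: "y \<in> free_operad G m q" and i: "1 \<le> i" "i \<le> n"
  shows "deriv (pcomp x i y) = pcomp (deriv x) i y + pm_scale (koszul p) (pcomp x i (deriv y))"
  using x[unfolded free_operad_iff]
proof (induction rule: pm_keys_induct)
  case (basis t)
  show ?case
    using y[unfolded free_operad_iff]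
  proof (induction rule: pm_keys_induct)
    case (basis s)
    then show ?case
      using deriv_pcomp_tree(1)[of t s i] \<open>t \<in> _\<close> i by (simp add: tree_space_def del: pcomp_single)
  qed (simp_all add: pcomp_simps deriv_simps pm_scale_distribs mult.commute)
qed (simp_all add: pcomp_simps deriv_simps pm_scale_distribs mult.commute)

theorem operad_derivation_deriv: "operad_derivation G deriv"
  unfolding operad_derivation_def
  using deriv_free_operad deriv_pcomp linear_lin_ext[of deriv_tree] by (auto simp: deriv_def[symmetric])

text \<open>
  The two mixed terms \<open>d x \<circ>\<^sub>i d y\<close> cancel because \<open>d x\<close> and \<open>x\<close> have degrees of different parity.
\<close>

lemma deriv_square_pcomp:
  assumes x: "x \<in> free_operad G n p" and y: "y \<in> free_operad G m q" and i: "1 \<le> i" "i \<le> n"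
    and "deriv (deriv x) = 0" "deriv (deriv y) = 0"
  shows "deriv (deriv (pcomp x i y)) = 0"
  using assms deriv_pcomp[OF deriv_free_operad[OF x] y i] deriv_pcomp[OF x deriv_free_operad[OF y] i]
  by (simp add: deriv_pcomp[OF x y i] deriv_simps koszul_add[of p "-1", simplified] pm_scale_distribs)

text \<open>
  A tree is obtained from the corolla at its root by grafting the subtrees one at a time.  Going from
  right to left keeps the positions of the leaves that are still to be filled.
\<close>

lemma deriv_square_tree:
  assumes "\<And>b. b \<in> G \<Longrightarrow> deriv (D b) = 0" and "wl t"
  shows "deriv (deriv (basis_vec t)) = 0"
  using \<open>wl t\<close>
proof (induction t)
  case Leaf
  then show ?case by simp
next
  case (Node a ts)
  have "deriv (deriv (basis_vec (Node a (replicate k Leaf @ ts')))) = 0"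
    if "k + length ts' = ar a" "set ts' \<subseteq> set ts" for k ts'
    using that
  proof (induction ts' arbitrary: k)
    case Nil
    then show ?case
      using deriv_corolla[of a] assms(1)[of a] Node.prems by (simp add: corolla_def del: deriv_single)
  next
    case (Cons t ts')
    let ?x = "Node a (replicate (Suc k) Leaf @ ts')"
    have graft: "graft_list (replicate k Leaf @ Leaf # ts') (Suc k) t = replicate k Leaf @ t # ts'"
      by (subst graft_list_append) (auto simp: sum_list_replicate)
    have wl: "wl ?x" "wl t"
      using Cons.prems Node.prems by (auto simp: replicate_app_Cons_same)
    have t: "deriv (deriv (basis_vec t)) = 0"
      using Cons.prems Node.prems by (intro Node.IH) auto
    have x: "deriv (deriv (basis_vec ?x)) = 0"
      using Cons.prems by (intro Cons.IH) auto
    have "deriv (deriv (pcomp (basis_vec ?x) (Suc k) (basis_vec t))) = 0"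
      by (rule deriv_square_pcomp[where n = "leaves ?x" and p = "tdeg ?x" and m = "leaves t" and q = "tdeg t"])
         (use wl t x in \<open>auto simp: free_operad_iff tree_space_def sum_list_replicate\<close>)
    then have "pm_scale (koszul (tdeg t * sdeg (labels_after ?x (Suc k))))
       (deriv (deriv (basis_vec (Node a (replicate k Leaf @ t # ts'))))) = 0"
      using graft by (simp add: replicate_app_Cons_same deriv_simps)
    (* the grafting sign squares to 1, so it can be removed *)
    then have "pm_scale (koszul (tdeg t * sdeg (labels_after ?x (Suc k))) * koszul (tdeg t * sdeg (labels_after ?x (Suc k))))
       (deriv (deriv (basis_vec (Node a (replicate k Leaf @ t # ts'))))) = 0"
      by (metis pm_scale_simps(1,4))
    then show ?case by (simp del: deriv_single)
  qed
  from this[of 0 ts] show ?case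
    using Node.prems by simp
qed

theorem deriv_square:
  assumes "\<And>b. b \<in> G \<Longrightarrow> deriv (D b) = 0" and x: "x \<in> free_operad G n p"
  shows "deriv (deriv x) = 0"
  using x[unfolded free_operad_iff]
proof (induction rule: pm_keys_induct)
  case (basis t)
  then show ?case using deriv_square_tree[of t] assms(1) by (simp add: tree_space_def)
qed (simp_all add: deriv_simps)

lemma insert_leaves_eq_sum:
  "(insert_leaves t s :: _ \<Rightarrow>\<^sub>0 'k) = (\<Sum>i<leaves t. pcomp (basis_vec t) (Suc i) (basis_vec s))"
  "(insert_leaves_list ts s :: _ \<Rightarrow>\<^sub>0 'k) = (\<Sum>i<leaves_list ts. pcomp_list (basis_vec ts) (Suc i) (basis_vec s))"
proof (induction t s and ts s rule: insert_leaves_insert_leaves_list.induct)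
  case (2 a ts s)
  then show ?case
    using pcomp_node[of a "basis_vec ts" _ "basis_vec s"] by (simp add: node_simps del: pcomp_single)
next
  case (4 t ts s)
  have cons: "basis_vec (t # ts) = cons_forest (basis_vec t) (basis_vec ts :: _ \<Rightarrow>\<^sub>0 'k)"
    by simp
  have bt: "Poly_Mapping.keys (basis_vec t :: 'b ptree \<Rightarrow>\<^sub>0 'k) \<subseteq> {t'. leaves t' = leaves t}"
    by simp
  show ?case
    using 4 unfolding cons
    by (simp add: sum_lessThan_add pcomp_list_cons[OF bt, of "basis_vec ts" "fdeg ts" "basis_vec s" "tdeg s"]
       cons_forest_simps pm_scale_sum
        del: cons_forest_single pcomp_single)
qed auto

lemma star_eq_sum:
  fixes x y :: "'b ptree \<Rightarrow>\<^sub>0 'k"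
  assumes "Poly_Mapping.keys x \<subseteq> {t. leaves t = n}"
  shows "star x y = (\<Sum>i<n. pcomp x (Suc i) y)"
  using assms
proof (induction rule: pm_keys_induct)
  case (basis t)
  show ?case
    by (induction rule: pm_keys_induct[OF subset_UNIV[of "Poly_Mapping.keys y"]])
       (use basis in \<open>simp_all add: star_simps pcomp_simps sum.distrib pm_scale_sum insert_leaves_eq_sum del: pcomp_single\<close>)
qed (simp_all add: star_simps pcomp_simps sum.distrib pm_scale_sum)

theorem deriv_star:
  assumes x: "x \<in> free_operad G n p" and y: "y \<in> free_operad G m q"
  shows "deriv (star x y) = star (deriv x) y + pm_scale (koszul p) (star x (deriv y))"
proof -
  have *: "star z w = (\<Sum>i<n. pcomp z (Suc i) w)" if "z \<in> free_operad G n r" for z w :: "'b ptree \<Rightarrow>\<^sub>0 'k" and r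
    using that by (intro star_eq_sum) (auto simp: free_operad_iff tree_space_def)
  show ?thesis
    by (simp add: *[OF x] *[OF deriv_free_operad[OF x]] deriv_simps deriv_pcomp[OF x y] sum.distrib pm_scale_sum)
qed

end

section \<open>Families indexed by arity\<close>

context based_collection
begin

text \<open>
  A family stands for the formal sum of its components \<open>f n\<close> of arity \<open>n\<close>.  Composing an element of
  arity \<open>b\<close> into one of arity \<open>a\<close> yields arity \<open>a + b - 1\<close>, so the component of arity \<open>n\<close> of a product is a
  finite sum.
\<close>

definition fam_star :: "(nat \<Rightarrow> ('b ptree \<Rightarrow>\<^sub>0 'k::field)) \<Rightarrow> (nat \<Rightarrow> ('b ptree \<Rightarrow>\<^sub>0 'k)) \<Rightarrow> nat \<Rightarrow> ('b ptree \<Rightarrow>\<^sub>0 'k)" where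
  "fam_star f g n = (\<Sum>a=1..n. star (f a) (g (Suc n - a)))"

lemma fam_star_cong:
  "\<lbrakk>\<And>a. \<lbrakk>1 \<le> a; a \<le> n\<rbrakk> \<Longrightarrow> f a = f' a; \<And>a. \<lbrakk>1 \<le> a; a \<le> n\<rbrakk> \<Longrightarrow> g a = g' a\<rbrakk> \<Longrightarrow> fam_star f g n = fam_star f' g' n"
  unfolding fam_star_def by (intro sum.cong) auto

lemma fam_star_linear:
  "fam_star (\<lambda>n. f n - f' n) g n = fam_star f g n - fam_star f' g n"
  "fam_star (\<lambda>n. - f n) g n = - fam_star f g n"
  "fam_star f (\<lambda>n. - g n) n = - fam_star f g n"
  "fam_star f (\<lambda>n. 0) n = 0"
  "fam_star f (\<lambda>n. \<Sum>i\<in>I. h i n) n = (\<Sum>i\<in>I. fam_star f (h i) n)"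
proof -
  show "fam_star f (\<lambda>n. \<Sum>i\<in>I. h i n) n = (\<Sum>i\<in>I. fam_star f (h i) n)"
    unfolding fam_star_def star_simps by (rule sum.swap)
qed (simp_all add: fam_star_def star_simps sum.distrib sum_subtractf sum_negf)

lemma fam_pre_Lie:
  fixes f g h :: "nat \<Rightarrow> ('b ptree \<Rightarrow>\<^sub>0 'k::field)"
  assumes g: "\<And>n. 1 \<le> n \<Longrightarrow> g n \<in> homogeneous p" and h: "\<And>n. 1 \<le> n \<Longrightarrow> h n \<in> homogeneous q"
  shows "fam_star (fam_star f g) h n - fam_star f (fam_star g h) n =
    pm_scale (koszul (p * q)) (fam_star (fam_star f h) g n - fam_star f (fam_star h g) n)"
proof -
  (* both iterated products are sums over arities a, b and n + 2 - a - b *)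
  have left: "fam_star (fam_star f g) h n =
      (\<Sum>a=1..n. \<Sum>b=1..Suc n - a. star (star (f a) (g b)) (h (n + 2 - a - b)))" for f g h :: "nat \<Rightarrow> ('b ptree \<Rightarrow>\<^sub>0 'k)"
  proof -
    have "fam_star (fam_star f g) h n =
        (\<Sum>(m, a)\<in>Sigma {1..n} (\<lambda>m. {1..m}). star (star (f a) (g (Suc m - a))) (h (Suc n - m)))"
      by (simp add: fam_star_def star_simps sum.Sigma)
    also have "\<dots> = (\<Sum>(a, b)\<in>Sigma {1..n} (\<lambda>a. {1..Suc n - a}). star (star (f a) (g b)) (h (n + 2 - a - b)))"
      by (rule sum.reindex_bij_witness[of _ "\<lambda>(a, b). (a + b - 1, a)" "\<lambda>(m, a). (a, Suc m - a)"])
         (auto simp: Suc_diff_le)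
    finally show ?thesis
      by (simp add: sum.Sigma)
  qed
  have right: "fam_star f (fam_star g h) n =
      (\<Sum>a=1..n. \<Sum>b=1..Suc n - a. star (f a) (star (g b) (h (n + 2 - a - b))))" for f g h :: "nat \<Rightarrow> ('b ptree \<Rightarrow>\<^sub>0 'k)"
    unfolding fam_star_def star_simps
  proof (intro sum.cong refl)
    fix a b assume "a \<in> {1..n}" "b \<in> {1..Suc n - a}"
    then have "Suc (Suc n - a) - b = n + 2 - a - b"
      by auto
    then show "star (f a) (star (g b) (h (Suc (Suc n - a) - b))) = star (f a) (star (g b) (h (n + 2 - a - b)))"
      by simp
  qed
  have diff: "fam_star (fam_star f g) h n - fam_star f (fam_star g h) n =
      (\<Sum>a=1..n. \<Sum>b=1..Suc n - a. star (star (f a) (g b)) (h (n + 2 - a - b)) - star (f a) (star (g b) (h (n + 2 - a - b))))"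
    for f g h :: "nat \<Rightarrow> ('b ptree \<Rightarrow>\<^sub>0 'k)"
    by (simp only: left right sum_subtractf)
  have "fam_star (fam_star f g) h n - fam_star f (fam_star g h) n =
      (\<Sum>a=1..n. \<Sum>b=1..Suc n - a. pm_scale (koszul (p * q))
        (star (star (f a) (h (n + 2 - a - b))) (g b) - star (f a) (star (h (n + 2 - a - b)) (g b))))"
    unfolding diff by (intro sum.cong refl star_pre_Lie g h) auto
  also have "\<dots> = (\<Sum>a=1..n. \<Sum>b=1..Suc n - a. pm_scale (koszul (p * q))
        (star (star (f a) (h b)) (g (n + 2 - a - b)) - star (f a) (star (h b) (g (n + 2 - a - b)))))"
  proof (rule sum.cong[OF refl], goal_cases)
    case (1 a)
    show ?case
      by (rule sum.reindex_bij_witness[of _ "\<lambda>b. n + 2 - a - b" "\<lambda>b. n + 2 - a - b"]) (use 1 in auto)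
  qed
  also have "\<dots> = pm_scale (koszul (p * q)) (fam_star (fam_star f h) g n - fam_star f (fam_star h g) n)"
    unfolding diff by (simp add: pm_scale_sum)
  finally show ?thesis .
qed

end

context derivation_data
begin

lemma deriv_fam_star:
  assumes f: "\<And>n. 1 \<le> n \<Longrightarrow> f n \<in> free_operad G n p" and g: "\<And>n. 1 \<le> n \<Longrightarrow> g n \<in> free_operad G n q"
  shows "deriv (fam_star f g n) = fam_star (\<lambda>n. deriv (f n)) g n + pm_scale (koszul p) (fam_star f (\<lambda>n. deriv (g n)) n)"
proof -
  have "deriv (fam_star f g n) = (\<Sum>a=1..n. star (deriv (f a)) (g (Suc n - a)) + pm_scale (koszul p) (star (f a) (deriv (g (Suc n - a)))))"
    unfolding fam_star_def deriv_simps
  proof (rule sum.cong[OF refl])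
    fix a assume "a \<in> {1..n}"
    then show "deriv (star (f a) (g (Suc n - a))) =
        star (deriv (f a)) (g (Suc n - a)) + pm_scale (koszul p) (star (f a) (deriv (g (Suc n - a))))"
      by (intro deriv_star[OF f g]) auto
  qed
  then show ?thesis
    by (simp add: fam_star_def sum.distrib pm_scale_sum)
qed

end

section \<open>Crowns and chains\<close>

interpretation S: based_collection S_basis S_ar S_deg
  by unfold_locales (simp add: S_basis_def)

text \<open>
  The basis of the quotient by the coaugmentation, whose image is spanned by \<open>U 1\<close>.
\<close>

definition S_gens :: "sbasis set" where
  "S_gens = S_basis - {U 1}"

lemma S_gens_iff [simp]: "U n \<in> S_gens \<longleftrightarrow> 2 \<le> n" "V n \<in> S_gens \<longleftrightarrow> 1 \<le> n"
  by (auto simp: S_gens_def S_basis_def)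

definition v_corolla :: "nat \<Rightarrow> sbasis ptree" where
  "v_corolla r = corolla (V r) r"

lemma v_corolla_simps [simp]:
  "leaves (v_corolla r) = r" "labels (v_corolla r) = [V r]" "v_corolla r \<noteq> Leaf" "Leaf \<noteq> v_corolla r"
  "v_corolla r = v_corolla r' \<longleftrightarrow> r = r'" "well_labelled G S_ar (v_corolla r) \<longleftrightarrow> V r \<in> G"
  by (auto simp: v_corolla_def corolla_def sum_list_replicate map_replicate_const concat_replicate_trivial)

lemma free_operad_closed:
  "\<lbrakk>x \<in> S.free_operad G n p; y \<in> S.free_operad G n p\<rbrakk> \<Longrightarrow> x - y \<in> S.free_operad G n p"
  "x \<in> S.free_operad G n p \<Longrightarrow> - x \<in> S.free_operad G n p"
  "(\<And>i. i \<in> I \<Longrightarrow> f i \<in> S.free_operad G n p) \<Longrightarrow> sum f I \<in> S.free_operad G n p"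
proof -
  have *: "x \<in> S.free_operad G n p \<longleftrightarrow> Poly_Mapping.keys x \<subseteq> {t. well_labelled G S_ar t \<and> leaves t = n \<and> S.tdeg t = p}" for x
    by (auto simp: S.free_operad_def S.dec_trees_iff)
  show "x - y \<in> S.free_operad G n p" if "x \<in> S.free_operad G n p" "y \<in> S.free_operad G n p"
    using that Poly_Mapping.keys_diff[of x y] unfolding * by blast
  show "- x \<in> S.free_operad G n p" if "x \<in> S.free_operad G n p"
    using that unfolding * by (auto simp: in_keys_iff)
  show "sum f I \<in> S.free_operad G n p" if "\<And>i. i \<in> I \<Longrightarrow> f i \<in> S.free_operad G n p"
    using that unfolding * by (intro keys_subset_sum) auto
qed

lemma free_operad_basis_vec [simp]:
  "basis_vec t \<in> S.free_operad G n p \<longleftrightarrow> well_labelled G S_ar t \<and> leaves t = n \<and> S.tdeg t = p"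
  by (auto simp: S.free_operad_def S.dec_trees_iff)

text \<open>
  The forests that can sit on top of a vertex \<open>x\<^sub>p\<close> in a type II tree, with \<open>e\<close> free inputs and \<open>n\<close> leaves.
\<close>

definition tops :: "nat \<Rightarrow> nat \<Rightarrow> sbasis ptree list set" where
  "tops e n = {ts. set ts \<subseteq> insert Leaf (v_corolla ` {1..}) \<and> count_list ts Leaf = e \<and> leaves_list ts = n}"

lemma tops_leaves: "set ts \<subseteq> insert Leaf (v_corolla ` {1..}) \<Longrightarrow>
   length ts \<le> leaves_list ts \<and> count_list ts Leaf \<le> leaves_list ts \<and> set ts \<subseteq> insert Leaf (v_corolla ` {1..leaves_list ts})"
proof (induction ts)
  case (Cons t ts)
  then show ?case by fastforce
qed auto

lemma tops_bounds:
  assumes "ts \<in> tops e n"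
  shows "length ts \<le> n" "e \<le> n" "set ts \<subseteq> insert Leaf (v_corolla ` {1..n})"
  using tops_leaves[of ts] assms by (auto simp: tops_def)

lemma finite_tops: "finite (tops e n)"
proof (rule finite_subset)
  show "tops e n \<subseteq> {ts. set ts \<subseteq> insert Leaf (v_corolla ` {1..n}) \<and> length ts \<le> n}"
    using tops_bounds by blast
qed (intro finite_lists_length_le, simp)

lemma tops_degree: "ts \<in> tops e n \<Longrightarrow> t \<in> set ts \<Longrightarrow> S.tdeg t = 0"
  by (auto simp: tops_def)

lemma tops_well_labelled: "ts \<in> tops e n \<Longrightarrow> t \<in> set ts \<Longrightarrow> well_labelled S_gens S_ar t"
  by (auto simp: tops_def)

text \<open>
  At least two entries are required because \<open>x\<^sub>p\<close> is a generator only for \<open>p \<ge> 2\<close>.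
\<close>

definition crowns :: "nat \<Rightarrow> nat \<Rightarrow> sbasis ptree list set" where
  "crowns e n = {ts \<in> tops e n. 2 \<le> length ts}"

text \<open>
  The surroundings \<open>l @ _ # r\<close> of one more entry of a crown, where \<open>e\<close> and \<open>n\<close> count the other entries only.
\<close>

definition holes :: "nat \<Rightarrow> nat \<Rightarrow> (sbasis ptree list \<times> sbasis ptree list) set" where
  "holes e n = {(l, r). l @ r \<in> tops e n \<and> l @ r \<noteq> []}"

lemma finite_crowns: "finite (crowns e n)"
  using finite_tops by (simp add: crowns_def)

lemma finite_holes: "finite (holes e n)"
proof (rule finite_subset)
  show "holes e n \<subseteq> (\<lambda>(ts, k). (take k ts, drop k ts)) ` (tops e n \<times> {..n})"
  proof clarify
    fix l r assume *: "(l, r) \<in> holes e n"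
    then have "length l \<le> n"
      using tops_bounds(1)[of "l @ r" e n] by (auto simp: holes_def)
    then show "(l, r) \<in> (\<lambda>(ts, k). (take k ts, drop k ts)) ` (tops e n \<times> {..n})"
      using * by (intro rev_image_eqI[of "(l @ r, length l)"]) (auto simp: holes_def)
  qed
qed (use finite_tops in simp)

lemma holes_0 [simp]: "holes e 0 = {}"
  using tops_bounds(1)[of _ e 0] by (auto simp: holes_def)

lemma crowns_empty [simp]: "crowns e 0 = {}" "n < e \<Longrightarrow> crowns e n = {}"
  using tops_bounds(1)[of _ e 0] tops_bounds(2)[of _ e n] by (fastforce simp: crowns_def)+

lemma holes_empty [simp]: "n < e \<Longrightarrow> holes e n = {}"
  using tops_bounds(2)[of _ e n] by (fastforce simp: holes_def)

text \<open>
  A chosen entry of a crown is a free input, and the rest has one free input less, or a corolla of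
  some arity \<open>k\<close>, and the rest has as many free inputs as before.
\<close>

lemma sum_crowns_entries:
  fixes \<phi> :: "sbasis ptree list \<Rightarrow> sbasis ptree \<Rightarrow> sbasis ptree list \<Rightarrow> 'a::comm_monoid_add"
  shows "(\<Sum>ts\<in>crowns e n. \<Sum>j<length ts. \<phi> (take j ts) (ts ! j) (drop (Suc j) ts)) =
    (if 1 \<le> e then \<Sum>(l, r)\<in>holes (e - 1) (n - 1). \<phi> l Leaf r else 0)
    + (\<Sum>k=1..n. \<Sum>(l, r)\<in>holes e (n - k). \<phi> l (v_corolla k) r)"
proof -
  let ?X = "{(l, t, r). t \<in> insert Leaf (v_corolla ` {1..n}) \<and> l @ t # r \<in> crowns e n}"
  have "(\<Sum>ts\<in>crowns e n. \<Sum>j<length ts. \<phi> (take j ts) (ts ! j) (drop (Suc j) ts)) =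
     (\<Sum>(ts, j)\<in>Sigma (crowns e n) (\<lambda>ts. {..<length ts}). \<phi> (take j ts) (ts ! j) (drop (Suc j) ts))"
    by (simp add: sum.Sigma finite_crowns)
  also have "\<dots> = (\<Sum>(l, t, r)\<in>?X. \<phi> l t r)"
  proof (rule sum.reindex_bij_witness[of _ "\<lambda>(l, t, r). (l @ t # r, length l)"
          "\<lambda>(ts, j). (take j ts, ts ! j, drop (Suc j) ts)"], goal_cases)
    case (2 x)
    then obtain ts j where x: "x = (ts, j)" "ts \<in> crowns e n" "j < length ts" by auto
    moreover have "ts ! j \<in> insert Leaf (v_corolla ` {1..n})"
      using tops_bounds(3)[of ts e n] x nth_mem[of j ts] unfolding crowns_def by blast
    ultimately show ?case by (simp add: id_take_nth_drop[symmetric])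
  qed (auto simp: id_take_nth_drop[symmetric])
  also have "?X = (\<lambda>(l, r). (l, Leaf, r)) ` {(l, r). l @ Leaf # r \<in> crowns e n}
      \<union> (\<lambda>(k, l, r). (l, v_corolla k, r)) ` Sigma {1..n} (\<lambda>k. {(l, r). l @ v_corolla k # r \<in> crowns e n})"
    by (auto simp: image_iff)
  also have "{(l, r). l @ Leaf # r \<in> crowns e n} = (if 1 \<le> e then holes (e - 1) (n - 1) else {})"
  proof (cases n)
    case (Suc m)
    then show ?thesis
      by (cases e) (auto simp: crowns_def holes_def tops_def Suc_le_eq)
  qed auto
  also have "Sigma {1..n} (\<lambda>k. {(l, r). l @ v_corolla k # r \<in> crowns e n}) = Sigma {1..n} (\<lambda>k. holes e (n - k))"
    by (rule Sigma_cong) (auto simp: crowns_def holes_def tops_def Suc_le_eq)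
  also have "(\<Sum>(l, t, r)\<in>(\<lambda>(l, r). (l, Leaf, r)) ` (if 1 \<le> e then holes (e - 1) (n - 1) else {})
      \<union> (\<lambda>(k, l, r). (l, v_corolla k, r)) ` Sigma {1..n} (\<lambda>k. holes e (n - k)). \<phi> l t r) =
      (\<Sum>(l, r)\<in>(if 1 \<le> e then holes (e - 1) (n - 1) else {}). \<phi> l Leaf r)
      + (\<Sum>(k, l, r)\<in>Sigma {1..n} (\<lambda>k. holes e (n - k)). \<phi> l (v_corolla k) r)"
  proof -
    have 1: "(\<Sum>(l, t, r)\<in>(\<lambda>(l, r). (l, Leaf, r)) ` A. \<phi> l t r) = (\<Sum>(l, r)\<in>A. \<phi> l Leaf r)" for A
      by (subst sum.reindex) (auto simp: inj_on_def case_prod_unfold)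
    have 2: "(\<Sum>(l, t, r)\<in>(\<lambda>(k, l, r). (l, v_corolla k, r)) ` A. \<phi> l t r) = (\<Sum>(k, l, r)\<in>A. \<phi> l (v_corolla k) r)" for A
      by (subst sum.reindex) (auto simp: inj_on_def case_prod_unfold)
    show ?thesis
      unfolding 1[symmetric] 2[symmetric] by (rule sum.union_disjoint) (auto simp: finite_holes)
  qed
  finally show ?thesis
    by (simp add: sum.Sigma finite_holes case_prod_unfold)
qed

definition crown_sum :: "nat \<Rightarrow> nat \<Rightarrow> (sbasis ptree \<Rightarrow>\<^sub>0 'k::field)" where
  "crown_sum e n = (\<Sum>ts\<in>crowns e n. basis_vec (Node (U (length ts)) ts))"

definition fill_hole :: "sbasis ptree list \<Rightarrow> sbasis ptree list \<Rightarrow> (sbasis ptree \<Rightarrow>\<^sub>0 'k::field) \<Rightarrow> (sbasis ptree \<Rightarrow>\<^sub>0 'k)" where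
  "fill_hole l r x = node (U (length l + length r + 1)) (fill l r x)"

definition crown_at :: "nat \<Rightarrow> (nat \<Rightarrow> (sbasis ptree \<Rightarrow>\<^sub>0 'k::field)) \<Rightarrow> nat \<Rightarrow> (sbasis ptree \<Rightarrow>\<^sub>0 'k)" where
  "crown_at e W n = (\<Sum>m<n. \<Sum>(l, r)\<in>holes e m. fill_hole l r (W (n - m)))"

definition u_fam :: "nat \<Rightarrow> (sbasis ptree \<Rightarrow>\<^sub>0 'k::field)" where
  "u_fam n = (if 2 \<le> n then basis_vec (corolla (U n) n) else 0)"

definition v_fam :: "nat \<Rightarrow> (sbasis ptree \<Rightarrow>\<^sub>0 'k::field)" where
  "v_fam n = basis_vec (v_corolla n)"

text \<open>
  A crown of arity \<open>n\<close> has at most \<open>n\<close> free inputs, so the recursion may stop as soon as \<open>e\<close> exceeds \<open>n\<close>.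
\<close>

function chain_sum :: "nat \<Rightarrow> nat \<Rightarrow> (sbasis ptree \<Rightarrow>\<^sub>0 'k::field)" where
  "chain_sum e n = (if n < e then 0
     else crown_sum e n - (\<Sum>a=1..n. S.star (v_fam a) (chain_sum (Suc e) (Suc n - a))))"
  by pat_completeness auto
termination by (relation "measure (\<lambda>(e, n). Suc n - e)") auto

declare chain_sum.simps [simp del]

lemma crown_sum_less: "n < e \<Longrightarrow> crown_sum e n = 0"
  by (simp add: crown_sum_def)

lemma chain_sum_less: "n < e \<Longrightarrow> chain_sum e n = 0"
  by (simp add: chain_sum.simps)

lemma chain_sum_rec: "chain_sum e n = crown_sum e n - S.fam_star v_fam (chain_sum (Suc e)) n"
proof (cases "n < e")
  case True
  then have "S.fam_star v_fam (chain_sum (Suc e)) n = (S.fam_star v_fam (\<lambda>_. 0) n :: _ \<Rightarrow>\<^sub>0 'a)"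
    by (intro S.fam_star_cong) (auto simp: chain_sum_less)
  then show ?thesis
    using True by (simp add: crown_sum_less chain_sum_less S.fam_star_linear)
qed (simp add: chain_sum.simps[of e n] S.fam_star_def)

lemma fill_hole_simps:
  "fill_hole l r 0 = 0" "fill_hole l r (x + y) = fill_hole l r x + fill_hole l r y"
  "fill_hole l r (x - y) = fill_hole l r x - fill_hole l r y" "fill_hole l r (- x) = - fill_hole l r x"
  "fill_hole l r (sum g I) = (\<Sum>i\<in>I. fill_hole l r (g i))"
  "fill_hole l r (basis_vec t) = basis_vec (Node (U (length l + length r + 1)) (l @ t # r))"
  by (simp_all add: fill_hole_def fill_simps node_simps) (simp add: fill_def)

lemma crown_at_linear:
  "crown_at e (\<lambda>n. W n + W' n) n = crown_at e W n + crown_at e W' n"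
  "crown_at e (\<lambda>n. W n - W' n) n = crown_at e W n - crown_at e W' n"
  "crown_at e (\<lambda>n. - W n) n = - crown_at e W n"
  by (simp_all add: crown_at_def fill_hole_simps case_prod_unfold sum.distrib sum_subtractf sum_negf)

text \<open>
  A leaf of a crown is one of its \<open>e\<close> free inputs or a leaf of one of the corollas \<open>y\<^sub>k\<close> on top of it; in
  the second case the insertion produces the product of \<open>y\<^sub>k\<close> with \<open>W\<close>.
\<close>

lemma crown_star:
  "S.fam_star (crown_sum e) W n =
    (if 1 \<le> e then crown_at (e - 1) W n else 0) + crown_at e (S.fam_star v_fam W) n"
proof -
  have "S.star (basis_vec (Node (U (length ts)) ts)) w =
      (\<Sum>j<length ts. fill_hole (take j ts) (drop (Suc j) ts) (S.star (basis_vec (ts ! j)) w))"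
    if "ts \<in> crowns e a" for ts a and w :: "sbasis ptree \<Rightarrow>\<^sub>0 'a"
  proof -
    have "length (take j ts) + length (drop (Suc j) ts) + 1 = length ts" if "j < length ts" for j
      using that by simp
    then show ?thesis
      using that tops_degree[of ts e a]
      by (subst S.star_Node_degree_0) (auto simp: crowns_def fill_hole_def simp del: length_take length_drop)
  qed
  then have "S.fam_star (crown_sum e) W n = (\<Sum>a=1..n. \<Sum>ts\<in>crowns e a. \<Sum>j<length ts.
      fill_hole (take j ts) (drop (Suc j) ts) (S.star (basis_vec (ts ! j)) (W (Suc n - a))))"
    by (simp add: S.fam_star_def crown_sum_def S.star_simps)
  also have "\<dots> = (\<Sum>a=1..n. (if 1 \<le> e then \<Sum>(l, r)\<in>holes (e - 1) (a - 1). fill_hole l r (W (Suc n - a)) else 0)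
      + (\<Sum>k=1..a. \<Sum>(l, r)\<in>holes e (a - k). fill_hole l r (S.star (v_fam k) (W (Suc n - a)))))"
    by (subst sum_crowns_entries[where \<phi> = "\<lambda>l t r. fill_hole l r (S.star (basis_vec t) (W (Suc n - a)))" for a])
       (simp add: v_fam_def cong: if_cong)
  also have "\<dots> = (if 1 \<le> e then \<Sum>a=1..n. \<Sum>(l, r)\<in>holes (e - 1) (a - 1). fill_hole l r (W (Suc n - a)) else 0)
      + (\<Sum>a=1..n. \<Sum>k=1..a. \<Sum>(l, r)\<in>holes e (a - k). fill_hole l r (S.star (v_fam k) (W (Suc n - a))))"
    by (simp add: sum.distrib)
  also have "(\<Sum>a=1..n. \<Sum>(l, r)\<in>holes (e - 1) (a - 1). fill_hole l r (W (Suc n - a))) = crown_at (e - 1) W n"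
    unfolding crown_at_def by (rule sum.reindex_bij_witness[of _ Suc "\<lambda>a. a - 1"]) auto
  also have "(\<Sum>a=1..n. \<Sum>k=1..a. \<Sum>(l, r)\<in>holes e (a - k). fill_hole l r (S.star (v_fam k) (W (Suc n - a))))
      = (\<Sum>(a, k)\<in>Sigma {1..n} (\<lambda>a. {1..a}). \<Sum>(l, r)\<in>holes e (a - k). fill_hole l r (S.star (v_fam k) (W (Suc n - a))))"
    by (simp add: sum.Sigma)
  also have "\<dots> = (\<Sum>(m, k)\<in>Sigma {..<n} (\<lambda>m. {1..n - m}). \<Sum>(l, r)\<in>holes e m. fill_hole l r (S.star (v_fam k) (W (Suc (n - m) - k))))"
    by (rule sum.reindex_bij_witness[of _ "\<lambda>(m, k). (m + k, k)" "\<lambda>(a, k). (a - k, k)"])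
       (auto simp: Suc_diff_le)
  also have "\<dots> = (\<Sum>m<n. \<Sum>k=1..n - m. \<Sum>(l, r)\<in>holes e m. fill_hole l r (S.star (v_fam k) (W (Suc (n - m) - k))))"
    by (rule sum.Sigma[symmetric]) auto
  also have "\<dots> = (\<Sum>m<n. \<Sum>h\<in>holes e m. \<Sum>k=1..n - m. fill_hole (fst h) (snd h) (S.star (v_fam k) (W (Suc (n - m) - k))))"
    unfolding case_prod_unfold by (intro sum.cong refl sum.swap)
  also have "\<dots> = crown_at e (S.fam_star v_fam W) n"
    by (simp add: crown_at_def S.fam_star_def fill_hole_simps case_prod_unfold)
  finally show ?thesis .
qed

text \<open>
  The sign and the sum over type II data in the second equation are hidden in the recursion for
  chains; \<open>cobar_differential\<close> makes the connection to the decomposition maps.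
\<close>

fun S_diff :: "sbasis \<Rightarrow> (sbasis ptree \<Rightarrow>\<^sub>0 'k::field)" where
  "S_diff (U n) = - (\<Sum>j=2..<n. \<Sum>i=1..n - j + 1. basis_vec (two_vertex (U (n - j + 1)) i (U j)))"
| "S_diff (V n) = - chain_sum 0 n"

lemma v_fam_mem: "1 \<le> n \<Longrightarrow> v_fam n \<in> S.free_operad S_gens n 0"
  by (simp add: v_fam_def)

lemma star_v_fam: "S.star (v_fam a) (basis_vec s) = (\<Sum>i=1..a. basis_vec (plug (V a) a i s))"
proof -
  have "S.star (v_fam a) (basis_vec s) = (\<Sum>i<a. basis_vec (plug (V a) a (Suc i) s) :: _ \<Rightarrow>\<^sub>0 'a)"
    unfolding v_fam_def v_corolla_def corolla_def
    by (subst S.star_Node_degree_0) (auto simp: plug_def fill_def upd_conv_take_nth_drop intro!: sum.cong)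
  also have "\<dots> = (\<Sum>i=1..a. basis_vec (plug (V a) a i s))"
    by (rule sum.reindex_bij_witness[of _ "\<lambda>i. i - 1" Suc]) auto
  finally show ?thesis .
qed

lemma crown_sum_mem: "crown_sum e n \<in> S.free_operad S_gens n (-1)"
  unfolding crown_sum_def
proof (rule free_operad_closed(3))
  fix ts assume "ts \<in> crowns e n"
  then show "basis_vec (Node (U (length ts)) ts) \<in> S.free_operad S_gens n (-1)"
    using tops_degree[of ts e n] tops_well_labelled[of ts e n] S.fdeg_0[of ts]
    by (auto simp: crowns_def tops_def)
qed

lemma chain_sum_mem: "(chain_sum e n :: _ \<Rightarrow>\<^sub>0 'k::field) \<in> S.free_operad S_gens n (-1)"
proof (induction e n rule: chain_sum.induct)
  case (1 e n)
  show ?case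
  proof (cases "n < e")
    case True
    then show ?thesis by (simp add: chain_sum_less S.free_operad_def)
  next
    case False
    have "S.star (v_fam a) (chain_sum (Suc e) (Suc n - a) :: _ \<Rightarrow>\<^sub>0 'k) \<in> S.free_operad S_gens n (-1)" if "a \<in> {1..n}" for a
      using S.star_free_operad[OF v_fam_mem[of a] 1[OF False that]] that by simp
    then show ?thesis
      unfolding chain_sum.simps[of e n] using False crown_sum_mem by (auto intro!: free_operad_closed)
  qed
qed

lemma two_vertex_Node:
  "1 \<le> i \<Longrightarrow> i \<le> a \<Longrightarrow> two_vertex (U a) i (U j) =
     Node (U a) (replicate (i - 1) Leaf @ Node (U j) (replicate j Leaf) # replicate (a - i) Leaf)"
  by (simp add: two_vertex_def plug_def corolla_def upd_conv_take_nth_drop)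

lemma S_diff_mem: "b \<in> S_gens \<Longrightarrow> S_diff b \<in> S.free_operad S_gens (S_ar b) (S_deg b - 2)"
proof (cases b)
  case (U n)
  show ?thesis
    unfolding U S_diff.simps
    by (intro free_operad_closed)
       (auto simp: two_vertex_Node sum_list_replicate map_replicate_const concat_replicate_trivial)
next
  case (V n)
  then show ?thesis
    using chain_sum_mem[of 0 n] by (auto intro: free_operad_closed)
qed

interpretation SD: derivation_data S_basis S_ar S_deg S_gens "S_diff :: sbasis \<Rightarrow> (sbasis ptree \<Rightarrow>\<^sub>0 'k::field)"
  by unfold_locales (rule S_diff_mem)

section \<open>The differential of crowns and chains\<close>

text \<open>
  Splitting the root \<open>x\<^sub>p\<close> gathers \<open>j\<close> consecutive subtrees on a new vertex.
\<close>

lemma local_part_U: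
  assumes "length ts = p" "\<forall>t\<in>set ts. S.tdeg t = 0"
  shows "(SD.local_part (U p) ts :: _ \<Rightarrow>\<^sub>0 'k::field) = - (\<Sum>j=2..<p. \<Sum>i=1..p - j + 1. basis_vec
    (Node (U (p - j + 1)) (take (i - 1) ts @ Node (U j) (take j (drop (i - 1) ts)) # drop (i - 1 + j) ts)))"
proof -
  have "subst (two_vertex (U (p - j + 1)) i (U j)) ts =
      Node (U (p - j + 1)) (take (i - 1) ts @ Node (U j) (take j (drop (i - 1) ts)) # drop (i - 1 + j) ts)"
    if "j \<in> {2..<p}" "i \<in> {1..p - j + 1}" for i j
  proof -
    have "i - 1 \<le> length ts" "j \<le> length ts - (i - 1)" "length ts - (i - 1) - j = p - j + 1 - i" "1 \<le> i" "i \<le> p - j + 1"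
      using that assms(1) by auto
    then show ?thesis
      by (simp add: two_vertex_Node subst_list_append subst_list_replicate_Leaf sum_list_replicate add.commute)
  qed
  then show ?thesis
    using assms(2) by (simp add: SD.local_part_def lin_ext_simps S.subst_sign_0)
qed

text \<open>
  Gathering a block \<open>c\<close> of a crown on a new vertex yields a crown with a smaller crown in one of its
  holes; the free inputs are distributed over the two.
\<close>

lemma sum_crowns_blocks:
  fixes \<psi> :: "sbasis ptree list \<Rightarrow> sbasis ptree list \<Rightarrow> sbasis ptree list \<Rightarrow> 'a::comm_monoid_add"
  shows "(\<Sum>ts\<in>crowns e n. \<Sum>j=2..<length ts. \<Sum>i=1..length ts - j + 1.
      \<psi> (take (i - 1) ts) (take j (drop (i - 1) ts)) (drop (i - 1 + j) ts)) =
    (\<Sum>i\<le>e. \<Sum>m<n. \<Sum>(l, r)\<in>holes i m. \<Sum>c\<in>crowns (e - i) (n - m). \<psi> l c r)"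
proof -
  let ?X = "{(l, c, r). l @ r \<noteq> [] \<and> 2 \<le> length c \<and> l @ c @ r \<in> tops e n}"
  have "(\<Sum>ts\<in>crowns e n. \<Sum>j=2..<length ts. \<Sum>i=1..length ts - j + 1.
      \<psi> (take (i - 1) ts) (take j (drop (i - 1) ts)) (drop (i - 1 + j) ts)) =
    (\<Sum>(ts, j, i)\<in>Sigma (crowns e n) (\<lambda>ts. Sigma {2..<length ts} (\<lambda>j. {1..length ts - j + 1})).
      \<psi> (take (i - 1) ts) (take j (drop (i - 1) ts)) (drop (i - 1 + j) ts))"
    by (simp add: sum.Sigma finite_crowns del: sum.cl_ivl_Suc) (auto intro!: sum.cong)
  also have "\<dots> = (\<Sum>(l, c, r)\<in>?X. \<psi> l c r)"
  proof (rule sum.reindex_bij_witness[of _ "\<lambda>(l, c, r). (l @ c @ r, length c, length l + 1)"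
        "\<lambda>(ts, j, i). (take (i - 1) ts, take j (drop (i - 1) ts), drop (i - 1 + j) ts)"], goal_cases)
    case (1 x)
    then obtain ts j i where x: "x = (ts, j, i)" "ts \<in> crowns e n" "2 \<le> j" "j < length ts" "1 \<le> i" "i \<le> length ts - j + 1"
      by auto
    have "take (i - 1) ts @ take j (drop (i - 1) ts) @ drop (i - 1 + j) ts = ts"
      by (metis append_take_drop_id drop_drop add.commute)
    then show ?case using x by (auto simp: min_def)
  next
    case (2 x)
    then obtain ts j i where x: "x = (ts, j, i)" "ts \<in> crowns e n" "2 \<le> j" "j < length ts" "1 \<le> i" "i \<le> length ts - j + 1"
      by auto
    have "take (i - 1) ts @ take j (drop (i - 1) ts) @ drop (i - 1 + j) ts = ts"
      by (metis append_take_drop_id drop_drop add.commute)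
    then show ?case using x by (auto simp: crowns_def)
  next
    case (4 x)
    then show ?case by (auto simp: crowns_def)
  qed auto
  also have "\<dots> = (\<Sum>(i, m, (l, r), c)\<in>Sigma {..e} (\<lambda>i. Sigma {..<n} (\<lambda>m. Sigma (holes i m) (\<lambda>_. crowns (e - i) (n - m)))). \<psi> l c r)"
  proof (rule sum.reindex_bij_witness[of _ "\<lambda>(i, m, (l, r), c). (l, c, r)"
        "\<lambda>(l, c, r). (count_list (l @ r) Leaf, leaves_list (l @ r), (l, r), c)"], goal_cases)
    case (2 x)
    then obtain l c r where x: "x = (l, c, r)" "l @ r \<noteq> []" "2 \<le> length c" "l @ c @ r \<in> tops e n" by auto
    then have "length c \<le> leaves_list c"
      using tops_leaves[of c] by (auto simp: tops_def)
    with x show ?case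
      by (auto simp: tops_def holes_def crowns_def)
  qed (auto simp: tops_def holes_def crowns_def)
  also have "\<dots> = (\<Sum>i\<le>e. \<Sum>m<n. \<Sum>(l, r)\<in>holes i m. \<Sum>c\<in>crowns (e - i) (n - m). \<psi> l c r)"
    by (simp add: sum.Sigma finite_crowns finite_holes case_prod_unfold)
  finally show ?thesis .
qed

lemma deriv_v_corolla [simp]: "1 \<le> n \<Longrightarrow> SD.deriv_tree (v_corolla n) = - chain_sum 0 n"
  using SD.deriv_corolla[of "V n"] by (simp add: v_corolla_def)

text \<open>
  The differential either splits the vertex \<open>x\<^sub>p\<close>, which is the sum, or hits one of the vertices \<open>y\<^sub>k\<close> on top
  of it.  The latter contributes \<open>- Z\<^sup>0\<close> and passes the odd \<open>x\<^sub>p\<close>, so the sign is positive.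
\<close>

lemma deriv_crown:
  "SD.deriv (crown_sum e n :: _ \<Rightarrow>\<^sub>0 'k::field) =
    crown_at e (chain_sum 0) n - (\<Sum>i\<le>e. crown_at i (crown_sum (e - i)) n)"
proof -
  have "(SD.deriv_tree (Node (U (length ts)) ts) :: _ \<Rightarrow>\<^sub>0 'k) = SD.local_part (U (length ts)) ts
      - (\<Sum>j<length ts. fill_hole (take j ts) (drop (Suc j) ts) (SD.deriv_tree (ts ! j)))"
    if "ts \<in> crowns e n" for ts
  proof -
    have "length (take j ts) + length (drop (Suc j) ts) + 1 = length ts" if "j < length ts" for j
      using that by simp
    then show ?thesis
      using that tops_degree[of ts e n]
      by (simp add: crowns_def fill_hole_def SD.deriv_forest_degree_0 node_simps del: length_take length_drop)
  qed
  then have "SD.deriv (crown_sum e n :: _ \<Rightarrow>\<^sub>0 'k) = (\<Sum>ts\<in>crowns e n. SD.local_part (U (length ts)) ts)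
     - (\<Sum>ts\<in>crowns e n. \<Sum>j<length ts. fill_hole (take j ts) (drop (Suc j) ts) (SD.deriv_tree (ts ! j)))"
    by (simp add: crown_sum_def SD.deriv_simps sum_subtractf)
  also have "(\<Sum>ts\<in>crowns e n. \<Sum>j<length ts. fill_hole (take j ts) (drop (Suc j) ts) (SD.deriv_tree (ts ! j) :: _ \<Rightarrow>\<^sub>0 'k))
      = (\<Sum>k=1..n. \<Sum>(l, r)\<in>holes e (n - k). - fill_hole l r (chain_sum 0 k))"
    by (subst sum_crowns_entries[where \<phi> = "\<lambda>l t r. fill_hole l r (SD.deriv_tree t)"])
       (simp add: fill_hole_simps case_prod_unfold cong: if_cong)
  also have "\<dots> = (\<Sum>m<n. \<Sum>(l, r)\<in>holes e m. - fill_hole l r (chain_sum 0 (n - m)))"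
    by (rule sum.reindex_bij_witness[of _ "\<lambda>m. n - m" "\<lambda>k. n - k"]) auto
  also have "\<dots> = - crown_at e (chain_sum 0) n"
    by (simp add: crown_at_def sum_negf case_prod_unfold)
  also have "(\<Sum>ts\<in>crowns e n. SD.local_part (U (length ts)) ts :: _ \<Rightarrow>\<^sub>0 'k) =
     - (\<Sum>ts\<in>crowns e n. \<Sum>j=2..<length ts. \<Sum>i=1..length ts - j + 1. fill_hole (take (i - 1) ts) (drop (i - 1 + j) ts)
          (basis_vec (Node (U (length (take j (drop (i - 1) ts)))) (take j (drop (i - 1) ts)))))"
  proof (subst sum_negf[symmetric], rule sum.cong[OF refl])
    fix ts assume "ts \<in> crowns e n"
    then have "\<forall>t\<in>set ts. S.tdeg t = 0"
      using tops_degree[of ts e n] by (auto simp: crowns_def)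
    then show "SD.local_part (U (length ts)) ts = (- (\<Sum>j=2..<length ts. \<Sum>i=1..length ts - j + 1. fill_hole (take (i - 1) ts) (drop (i - 1 + j) ts)
          (basis_vec (Node (U (length (take j (drop (i - 1) ts)))) (take j (drop (i - 1) ts))))) :: _ \<Rightarrow>\<^sub>0 'k)"
      unfolding local_part_U[OF refl \<open>\<forall>t\<in>set ts. S.tdeg t = 0\<close>]
    proof (intro arg_cong[where f = uminus] sum.cong refl)
      fix j i assume "j \<in> {2..<length ts}" "i \<in> {1..length ts - j + 1}"
      then have "length (take j (drop (i - 1) ts)) = j"
        "length (take (i - 1) ts) + length (drop (i - 1 + j) ts) + 1 = length ts - j + 1"
        by auto
      then show "basis_vec (Node (U (length ts - j + 1))
            (take (i - 1) ts @ Node (U j) (take j (drop (i - 1) ts)) # drop (i - 1 + j) ts)) =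
          (fill_hole (take (i - 1) ts) (drop (i - 1 + j) ts)
            (basis_vec (Node (U (length (take j (drop (i - 1) ts)))) (take j (drop (i - 1) ts)))) :: _ \<Rightarrow>\<^sub>0 'k)"
        unfolding fill_hole_simps by (simp only:)
    qed
  qed
  also have "\<dots> = - (\<Sum>i\<le>e. crown_at i (crown_sum (e - i)) n)"
    by (subst sum_crowns_blocks[where \<psi> = "\<lambda>l c r. fill_hole l r (basis_vec (Node (U (length c)) c))"])
       (simp add: crown_at_def crown_sum_def fill_hole_simps case_prod_unfold)
  finally show ?thesis
    by simp
qed

lemma deriv_v_fam: "1 \<le> n \<Longrightarrow> SD.deriv (v_fam n) = - chain_sum 0 n"
  by (simp add: v_fam_def)

text \<open>
  The differential of the recursion \<open>Z\<^sup>e = B\<^sup>e - y * Z\<^bsup>e+1\<^esup>\<close> is compared with the sum on the right,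
  expanded by the same recursion for its left factors.  The crowns with a chain in a hole telescope,
  the crowns with a crown in a hole agree, the terms with \<open>y\<close> at the bottom agree by induction, and the
  associators left over add up to zero.
\<close>

theorem deriv_chain:
  "SD.deriv (chain_sum e n :: _ \<Rightarrow>\<^sub>0 'k::field_char_0) =
    - (\<Sum>i=1..e. S.fam_star (chain_sum i) (chain_sum (Suc e - i)) n)"
proof (induction "Suc n - e" arbitrary: e n rule: less_induct)
  case less
  define Z :: "nat \<Rightarrow> nat \<Rightarrow> (sbasis ptree \<Rightarrow>\<^sub>0 'k)" where "Z = chain_sum"
  define C :: "nat \<Rightarrow> nat \<Rightarrow> (sbasis ptree \<Rightarrow>\<^sub>0 'k)" where "C = crown_sum"
  define Y :: "nat \<Rightarrow> (sbasis ptree \<Rightarrow>\<^sub>0 'k)" where "Y = v_fam"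
  have rec: "Z k = (\<lambda>n. C k n - S.fam_star Y (Z (Suc k)) n)" for k
    unfolding Z_def C_def Y_def by (rule ext) (rule chain_sum_rec)
  have Yrec: "S.fam_star Y (Z (Suc k)) = (\<lambda>n. C k n - Z k n)" for k
    by (subst (2) rec) simp
  have mem: "Z k m \<in> S.free_operad S_gens m (-1)" "1 \<le> m \<Longrightarrow> Y m \<in> S.free_operad S_gens m 0" for k m
    unfolding Z_def Y_def by (simp_all add: chain_sum_mem v_fam_mem)
  (* P: associators; Q: terms with y at the bottom; T, R: crowns with a chain or a crown in a hole *)
  define P where "P a b = S.fam_star (S.fam_star Y (Z a)) (Z b) n - S.fam_star Y (S.fam_star (Z a) (Z b)) n" for a b
  define Q where "Q k = S.fam_star Y (S.fam_star (Z k) (Z (e + 2 - k))) n" for k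
  define T where "T k = crown_at k (Z (e - k)) n" for k
  define R where "R k = crown_at k (C (e - k)) n" for k
  have P_antisym: "P a b = - P b a" for a b
    unfolding P_def
    using S.fam_pre_Lie[of "Z a" "-1" "Z b" "-1" Y n] S.free_operad_homogeneous[OF mem(1)]
    by simp
  have "(\<Sum>a=1..e + 1. P a (e + 2 - a)) = (\<Sum>a=1..e + 1. P (e + 2 - a) a)"
    by (rule sum.reindex_bij_witness[of _ "\<lambda>a. e + 2 - a" "\<lambda>a. e + 2 - a"]) auto
  also have "\<dots> = - (\<Sum>a=1..e + 1. P a (e + 2 - a))"
    unfolding sum_negf[symmetric] by (intro sum.cong refl P_antisym)
  finally have P_sum: "(\<Sum>a=1..e + 1. P a (e + 2 - a)) = 0"
    by (rule eq_uminus_imp_zero)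
  have ins: "crown_at i (S.fam_star Y (Z (Suc e - i))) n = R i - T i" if "i \<le> e" for i
    using that Yrec[of "e - i"] by (simp add: Suc_diff_le R_def T_def crown_at_linear)
  have split: "S.fam_star (Z i) W n = S.fam_star (C i) W n - S.fam_star (S.fam_star Y (Z (Suc i))) W n" for i W
    by (subst rec) (rule S.fam_star_linear)
  have step: "S.fam_star (Z i) (Z (Suc e - i)) n = T (i - 1) - T i + R i - Q (Suc i) - P (Suc i) (e + 2 - Suc i)"
    if "1 \<le> i" "i \<le> e" for i
    using that ins[of i] crown_star[of i "Z (Suc e - i)" n]
    unfolding split by (simp add: C_def Y_def[symmetric] Q_def P_def T_def)
  have step0: "S.fam_star (Z 0) (Z (Suc e)) n = R 0 - T 0 - Q 1 - P 1 (e + 1)"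
    using ins[of 0] crown_star[of 0 "Z (Suc e)" n]
    unfolding split by (simp add: C_def Y_def[symmetric] Q_def P_def T_def)
  have telescope: "(\<Sum>i=1..e. T (i - 1) - T i) = T 0 - T e"
    by (induction e) auto
  have "(\<Sum>i=1..e. S.fam_star (Z i) (Z (Suc e - i)) n) =
      (\<Sum>i=1..e. T (i - 1) - T i + R i - Q (Suc i) - P (Suc i) (e + 2 - Suc i))"
    by (intro sum.cong refl step) auto
  also have "\<dots> = T 0 - T e + (\<Sum>i=1..e. R i) - (\<Sum>i=1..e. Q (Suc i)) - (\<Sum>i=1..e. P (Suc i) (e + 2 - Suc i))"
    by (simp only: sum.distrib sum_subtractf telescope[simplified sum_subtractf])
  finally have S: "(\<Sum>i=1..e. S.fam_star (Z i) (Z (Suc e - i)) n) = \<dots>" .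
  have shift: "(\<Sum>i=1..e + 1. F i) = F 1 + (\<Sum>i=1..e. F (Suc i))" for F :: "nat \<Rightarrow> (sbasis ptree \<Rightarrow>\<^sub>0 'k)"
    by (simp add: sum.atLeast_Suc_atMost_Suc_shift sum.atLeast_Suc_atMost del: sum.cl_ivl_Suc)
  have R: "(\<Sum>i\<le>e. R i) = R 0 + (\<Sum>i=1..e. R i)"
    by (simp add: atMost_atLeast0 sum.atLeast_Suc_atMost)
  show ?case
  proof (cases "n < e")
    (* no elements of arity n exist on either side, and the measure would not decrease *)
    case True
    have "S.fam_star (Z i) (Z (Suc e - i)) n = 0" if "1 \<le> i" "i \<le> e" for i
      unfolding S.fam_star_def
    proof (rule sum.neutral, rule ballI)
      fix a assume "a \<in> {1..n}"
      then have "a < i \<or> Suc n - a < Suc e - i"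
        using True that by auto
      then show "S.star (Z i a) (Z (Suc e - i) (Suc n - a)) = 0"
        unfolding Z_def by (auto simp: chain_sum_less)
    qed
    then show ?thesis
      using True unfolding Z_def by (simp add: chain_sum_less)
  next
    case False
    have "S.fam_star Y (\<lambda>m. SD.deriv (Z (Suc e) m)) n = S.fam_star Y (\<lambda>m. - (\<Sum>i=1..Suc e. S.fam_star (Z i) (Z (Suc (Suc e) - i)) m)) n"
      using False less unfolding Z_def by (intro S.fam_star_cong refl) auto
    also have "\<dots> = - (\<Sum>k=1..e + 1. Q k)"
      unfolding S.fam_star_linear Q_def by simp
    finally have dZ: "S.fam_star Y (\<lambda>m. SD.deriv (Z (Suc e) m)) n = - (\<Sum>k=1..e + 1. Q k)" .
    have dY: "S.fam_star (\<lambda>m. SD.deriv (Y m)) (Z (Suc e)) n = - S.fam_star (Z 0) (Z (Suc e)) n"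
      unfolding S.fam_star_linear(2)[symmetric] Y_def Z_def by (intro S.fam_star_cong refl deriv_v_fam)
    have "SD.deriv (Z e n) = SD.deriv (C e n) - SD.deriv (S.fam_star Y (Z (Suc e)) n)"
      by (subst rec) (rule SD.deriv_simps)
    also have "SD.deriv (S.fam_star Y (Z (Suc e)) n) =
        S.fam_star (\<lambda>m. SD.deriv (Y m)) (Z (Suc e)) n + S.fam_star Y (\<lambda>m. SD.deriv (Z (Suc e) m)) n"
      by (subst SD.deriv_fam_star[OF mem(2) mem(1)]) auto
    also have "SD.deriv (C e n) = T e - (\<Sum>i\<le>e. R i)"
      unfolding C_def deriv_crown by (simp add: T_def R_def Z_def C_def)
    finally have "SD.deriv (Z e n) = - (\<Sum>i=1..e. S.fam_star (Z i) (Z (Suc e - i)) n) - (P 1 (e + 1) + (\<Sum>i=1..e. P (Suc i) (e + 2 - Suc i)))"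
      unfolding dZ dY step0 S R shift by (simp add: algebra_simps)
    also have "P 1 (e + 1) + (\<Sum>i=1..e. P (Suc i) (e + 2 - Suc i)) = 0"
      using P_sum unfolding shift by simp
    finally show ?thesis
      unfolding Z_def by simp
  qed
qed

lemma u_fam_mem: "u_fam n \<in> S.free_operad S_gens n (-1)"
proof -
  have "corolla (U n) n = Node (U n) (replicate n Leaf)" by (simp add: corolla_def)
  moreover have "(0 :: sbasis ptree \<Rightarrow>\<^sub>0 'a) \<in> S.free_operad S_gens n (-1)"
    by (simp add: S.free_operad_def)
  ultimately show ?thesis
    by (simp add: u_fam_def sum_list_replicate map_replicate_const concat_replicate_trivial)
qed

text \<open>
  The factors of arities \<open>n - j + 1\<close> and \<open>j\<close> are both different from \<open>0\<close> exactly for \<open>2 \<le> j < n\<close>, and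
  the leaves of a corolla are its inputs.
\<close>

lemma deriv_u_fam: "SD.deriv (u_fam n :: _ \<Rightarrow>\<^sub>0 'k::field) = - S.fam_star u_fam u_fam n"
proof (cases "2 \<le> n")
  case True
  have corolla_star: "S.star (basis_vec (corolla (U a) a)) (basis_vec (corolla (U j) j)) =
     (\<Sum>i=1..a. basis_vec (two_vertex (U a) i (U j)) :: _ \<Rightarrow>\<^sub>0 'k)" for a j
  proof -
    have "S.star (basis_vec (corolla (U a) a)) (basis_vec (corolla (U j) j)) =
       (\<Sum>i<a. basis_vec (two_vertex (U a) (Suc i) (U j)) :: _ \<Rightarrow>\<^sub>0 'k)"
      unfolding corolla_def[of "U a"]
      by (subst S.star_Node_degree_0) (auto simp: two_vertex_Node corolla_def fill_def intro!: sum.cong)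
    also have "\<dots> = (\<Sum>i=1..a. basis_vec (two_vertex (U a) i (U j)))"
      by (rule sum.reindex_bij_witness[of _ "\<lambda>i. i - 1" Suc]) auto
    finally show ?thesis .
  qed
  have "S.fam_star u_fam u_fam n = (\<Sum>a\<in>{2..<n}. S.star (u_fam a) (u_fam (Suc n - a)) :: _ \<Rightarrow>\<^sub>0 'k)"
    unfolding S.fam_star_def by (rule sum.mono_neutral_right) (auto simp: u_fam_def)
  also have "\<dots> = (\<Sum>j\<in>{2..<n}. S.star (u_fam (n - j + 1)) (u_fam j))"
    by (rule sum.reindex_bij_witness[of _ "\<lambda>j. n - j + 1" "\<lambda>a. Suc n - a"]) auto
  also have "\<dots> = (\<Sum>j=2..<n. \<Sum>i=1..n - j + 1. basis_vec (two_vertex (U (n - j + 1)) i (U j)))"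
    by (rule sum.cong) (auto simp: u_fam_def corolla_star[of "Suc (n - _)", simplified] corolla_star)
  finally show ?thesis
    using True SD.deriv_corolla[of "U n"] by (simp add: u_fam_def del: SD.deriv_single)
next
  case False
  then have "S.star (u_fam a) (u_fam (Suc n - a)) = (0 :: _ \<Rightarrow>\<^sub>0 'k)" for a
    by (simp add: u_fam_def)
  then show ?thesis
    using False by (simp add: u_fam_def S.fam_star_def)
qed

lemma deriv_square_x: "SD.deriv (SD.deriv (u_fam n :: _ \<Rightarrow>\<^sub>0 'k::field_char_0)) = 0"
proof -
  let ?X = "u_fam :: nat \<Rightarrow> (sbasis ptree \<Rightarrow>\<^sub>0 'k)"
  have mem: "?X n \<in> S.homogeneous (-1)" for n
    using S.free_operad_homogeneous[OF u_fam_mem] .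
  have "S.fam_star (S.fam_star ?X ?X) ?X n - S.fam_star ?X (S.fam_star ?X ?X) n =
      - (S.fam_star (S.fam_star ?X ?X) ?X n - S.fam_star ?X (S.fam_star ?X ?X) n)"
    using S.fam_pre_Lie[of ?X "-1" ?X "-1" ?X n] mem by simp
  then have "S.fam_star (S.fam_star ?X ?X) ?X n - S.fam_star ?X (S.fam_star ?X ?X) n = 0"
    by (rule eq_uminus_imp_zero)
  then show ?thesis
    by (simp add: deriv_u_fam SD.deriv_simps SD.deriv_fam_star[OF u_fam_mem u_fam_mem] S.fam_star_linear)
qed

lemma deriv_S_diff: "b \<in> S_gens \<Longrightarrow> SD.deriv (S_diff b :: _ \<Rightarrow>\<^sub>0 'k::field_char_0) = 0"
proof (cases b)
  case (U n)
  assume "b \<in> S_gens"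
  then have "SD.deriv (basis_vec (corolla b (S_ar b))) = (S_diff b :: _ \<Rightarrow>\<^sub>0 'k)"
    by (rule SD.deriv_corolla)
  then have "(S_diff b :: _ \<Rightarrow>\<^sub>0 'k) = SD.deriv (u_fam n)"
    using \<open>b \<in> S_gens\<close> by (simp add: U u_fam_def del: SD.deriv_single S_diff.simps)
  then show ?thesis
    by (simp only: deriv_square_x)
next
  case (V n)
  then show ?thesis
    using deriv_chain[of 0 n] by (simp add: SD.deriv_simps)
qed

theorem SD_square_zero:
  "x \<in> S.free_operad S_gens n p \<Longrightarrow> SD.deriv (SD.deriv (x :: _ \<Rightarrow>\<^sub>0 'k::field_char_0)) = 0"
  using SD.deriv_square deriv_S_diff by blast

section \<open>Chains as sums over type II data\<close>

text \<open>
  Type II data with \<open>e\<close> inputs of the middle vertex left free.  Removing the lowest vertex of a chain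
  turns a datum with \<open>e\<close> free inputs into one with \<open>e + 1\<close>, which matches the recursion for chains.
\<close>

definition free_typeII_data :: "nat \<Rightarrow> nat \<Rightarrow> (nat \<times> nat \<times> nat list \<times> nat list \<times> nat list) set" where
  "free_typeII_data e n = {(p, t, rs, is, ks).
     2 \<le> p \<and> t + e \<le> p \<and>
     length rs = p - e \<and> (\<forall>r\<in>set rs. 1 \<le> r) \<and> sum_list rs + e = n \<and>
     length is = t \<and> (\<forall>h<t. 1 \<le> is ! h \<and> is ! h \<le> rs ! h) \<and>
     length ks = p - e - t \<and> sorted_wrt (<) ks \<and> (\<forall>k\<in>set ks. 1 \<le> k \<and> k \<le> p)}"

lemma length_le_sum_list: "\<forall>r\<in>set rs. 1 \<le> r \<Longrightarrow> length rs \<le> sum_list (rs :: nat list)"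
  by (induction rs) auto

lemma typeII_data_eq: "typeII_data n = free_typeII_data 0 n"
  using length_le_sum_list by (fastforce simp: typeII_data_def free_typeII_data_def)

lemma finite_free_typeII_data: "finite (free_typeII_data e n)"
proof (rule finite_subset)
  let ?L = "{xs :: nat list. set xs \<subseteq> {..n} \<and> length xs \<le> n}"
  show "free_typeII_data e n \<subseteq> {..n} \<times> {..n} \<times> ?L \<times> ?L \<times> ?L"
  proof
    fix x assume "x \<in> free_typeII_data e n"
    then obtain p t rs "is" ks where x: "x = (p, t, rs, is, ks)" "t + e \<le> p"
      "length rs = p - e" "\<forall>r\<in>set rs. 1 \<le> r" "sum_list rs + e = n"
      "length is = t" "\<forall>h<t. is ! h \<le> rs ! h"
      "length ks = p - e - t" "\<forall>k\<in>set ks. k \<le> p"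
      by (auto simp: free_typeII_data_def)
    have "length rs \<le> sum_list rs"
      using x by (intro length_le_sum_list)
    with x have p: "p \<le> n" by auto
    have rs: "r \<le> n" if "r \<in> set rs" for r
      using member_le_sum_list[OF that] x by auto
    have "i \<le> n" if "i \<in> set is" for i
    proof -
      from that obtain h where h: "h < t" "i = is ! h"
        using x by (auto simp: in_set_conv_nth)
      moreover have "rs ! h \<in> set rs"
        using h x by (intro nth_mem) auto
      ultimately have "i \<le> rs ! h" "rs ! h \<le> n"
        using rs x(7) by auto
      then show ?thesis by simp
    qed
    then show "x \<in> {..n} \<times> {..n} \<times> ?L \<times> ?L \<times> ?L"
      using x p rs by fastforce
  qed
qed (auto intro!: finite_cartesian_product finite_lists_length_le)

text \<open>
  The construction of the upper part in \<open>typeII_tree\<close>; \<open>positions\<close> and \<open>top_arities\<close> recover its arguments.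
\<close>

definition place :: "nat list \<Rightarrow> nat list \<Rightarrow> sbasis ptree list \<Rightarrow> sbasis ptree list" where
  "place ks rs ts = fold (\<lambda>(k, r) ts. ts[k - 1 := v_corolla r]) (zip ks rs) ts"

lemma place_shift:
  "\<forall>k\<in>set ks. 1 \<le> k \<Longrightarrow> place (map Suc ks) rs (t # ts) = t # place ks rs ts"
proof (induction ks arbitrary: rs ts)
  case (Cons k ks)
  then obtain k' where k: "k = Suc k'" by (cases k) auto
  show ?case
    using Cons k by (cases rs) (simp_all add: place_def)
qed (simp add: place_def)

lemma place_1: "place (1 # map Suc ks) (r # rs) (t # ts) = place (map Suc ks) rs (v_corolla r # ts)"
  by (simp add: place_def)

fun positions :: "sbasis ptree list \<Rightarrow> nat list" where
  "positions [] = []"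
| "positions (t # ts) = (if t = Leaf then [] else [1]) @ map Suc (positions ts)"

definition top_arities :: "sbasis ptree list \<Rightarrow> nat list" where
  "top_arities ts = map leaves (filter (\<lambda>t. t \<noteq> Leaf) ts)"

lemma positions_ge: "k \<in> set (positions ts) \<Longrightarrow> 1 \<le> k \<and> k \<le> length ts"
  by (induction ts arbitrary: k) (auto split: if_splits)

lemma positions_sorted: "sorted_wrt (<) (positions ts)"
  using positions_ge by (induction ts) (force simp: sorted_wrt_map)+

lemma length_positions: "length (positions ts) = length (top_arities ts)"
  by (induction ts) (auto simp: top_arities_def)

lemma length_top_arities: "length (top_arities ts) + count_list ts Leaf = length ts"
  by (induction ts) (auto simp: top_arities_def)

lemma sum_top_arities: "sum_list (top_arities ts) + count_list ts Leaf = leaves_list ts"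
  by (induction ts) (auto simp: top_arities_def)

lemma place_positions:
  "set ts \<subseteq> insert Leaf (v_corolla ` {1..}) \<Longrightarrow>
     place (positions ts) (top_arities ts) (replicate (length ts) Leaf) = ts"
proof (induction ts)
  case Nil
  then show ?case by (simp add: place_def)
next
  case (Cons t ts)
  have "\<forall>k\<in>set (positions ts). 1 \<le> k"
    using positions_ge by blast
  note shift = place_shift[OF this]
  show ?case
    using Cons by (auto simp: top_arities_def shift place_1[simplified])
qed

text \<open>
  By induction on the number of inputs: an increasing list of positions either starts with \<open>1\<close>, or
  all its entries can be lowered by one.
\<close>

lemma positions_place:
  assumes "sorted_wrt (<) ks" "\<forall>k\<in>set ks. 1 \<le> k \<and> k \<le> p" "length rs = length ks" "\<forall>r\<in>set rs. 1 \<le> r"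
  shows "positions (place ks rs (replicate p Leaf)) = ks \<and> top_arities (place ks rs (replicate p Leaf)) = rs
    \<and> length (place ks rs (replicate p Leaf)) = p
    \<and> set (place ks rs (replicate p Leaf)) \<subseteq> insert Leaf (v_corolla ` {1..})"
  using assms
proof (induction p arbitrary: ks rs)
  case 0
  then show ?case by (cases ks) (auto simp: place_def top_arities_def)
next
  case (Suc p)
  have unshift: "\<exists>ks'. ks = map Suc ks' \<and> sorted_wrt (<) ks' \<and> (\<forall>k\<in>set ks'. 1 \<le> k \<and> k \<le> p)"
    if "sorted_wrt (<) ks" "\<forall>k\<in>set ks. 2 \<le> k \<and> k \<le> Suc p" for ks
  proof (intro exI[of _ "map (\<lambda>k. k - 1) ks"] conjI)
    show "ks = map Suc (map (\<lambda>k. k - 1) ks)"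
      using that by (induction ks) auto
    show "sorted_wrt (<) (map (\<lambda>k. k - 1) ks)"
      using that by (induction ks) fastforce+
  qed (use that in force)
  show ?case
  proof (cases "\<exists>ks'. ks = 1 # ks'")
    case True
    then obtain ks' where ks: "ks = 1 # ks'" by blast
    with Suc.prems obtain ks'' where ks': "ks' = map Suc ks''" "sorted_wrt (<) ks''" "\<forall>k\<in>set ks''. 1 \<le> k \<and> k \<le> p"
      using unshift[of ks'] by fastforce
    obtain r rs' where rs: "rs = r # rs'"
      using Suc.prems ks by (cases rs) auto
    have "place ks rs (replicate (Suc p) Leaf) = v_corolla r # place ks'' rs' (replicate p Leaf)"
      using ks' unfolding ks rs ks' by (simp only: replicate_Suc place_1) (simp add: place_shift)
    moreover have "\<forall>r\<in>set rs'. 1 \<le> r" "length rs' = length ks''" "1 \<le> r"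
      using Suc.prems ks ks' rs by auto
    ultimately show ?thesis
      using Suc.IH[of ks'' rs'] ks' ks rs by (simp add: top_arities_def)
  next
    case False
    have "2 \<le> k" if "k \<in> set ks" for k
    proof -
      from that obtain a ks' where ks: "ks = a # ks'" by (cases ks) auto
      with False Suc.prems(2) have "2 \<le> a" by auto
      then show ?thesis
        using that Suc.prems(1) ks by auto
    qed
    then have "\<forall>k\<in>set ks. 2 \<le> k \<and> k \<le> Suc p"
      using Suc.prems(2) by blast
    then obtain ks'' where ks': "ks = map Suc ks''" "sorted_wrt (<) ks''" "\<forall>k\<in>set ks''. 1 \<le> k \<and> k \<le> p"
      using unshift[of ks] Suc.prems by blast
    have "place ks rs (replicate (Suc p) Leaf) = Leaf # place ks'' rs (replicate p Leaf)"
      using ks' by (simp add: place_shift)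
    then show ?thesis
      using Suc.IH[of ks'' rs] Suc.prems ks' by (simp add: top_arities_def)
  qed
qed

lemma typeII_tree_0: "typeII_tree p 0 rs is ks = Node (U p) (place ks rs (replicate p Leaf))"
  by (simp add: typeII_tree_def place_def v_corolla_def)

lemma typeII_tree_Suc:
  "typeII_tree p (Suc t) (r # rs) (i # is) ks = plug (V r) r i (typeII_tree p t rs is ks)"
  by (simp add: typeII_tree_def)

lemma crown_sum_typeII:
  "crown_sum e n = (\<Sum>(p, t, rs, is, ks)\<in>{x \<in> free_typeII_data e n. fst (snd x) = 0}. basis_vec (typeII_tree p t rs is ks))"
  unfolding crown_sum_def
proof (rule sum.reindex_bij_witness[of _ "\<lambda>(p, t, rs, is, ks). place ks rs (replicate p Leaf)"
      "\<lambda>ts. (length ts, 0, top_arities ts, [], positions ts)"], goal_cases)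
  case (1 ts)
  then show ?case
    by (simp add: place_positions crowns_def tops_def)
next
  case (2 ts)
  have "\<forall>r\<in>set (top_arities ts). 1 \<le> r"
    using 2 by (auto simp: top_arities_def crowns_def tops_def)
  then show ?case
    using 2 length_top_arities[of ts] sum_top_arities[of ts] positions_ge positions_sorted[of ts]
    by (auto simp: free_typeII_data_def crowns_def tops_def length_positions)
next
  case (3 x)
  then show ?case
    using positions_place by (auto simp: free_typeII_data_def)
next
  case (4 x)
  then obtain p rs ks where x: "x = (p, 0, rs, [], ks)" "2 \<le> p" "e \<le> p" "length rs = p - e" "\<forall>r\<in>set rs. 1 \<le> r"
      "sum_list rs + e = n" "length ks = p - e" "sorted_wrt (<) ks" "\<forall>k\<in>set ks. 1 \<le> k \<and> k \<le> p"
    by (auto simp: free_typeII_data_def)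
  let ?ts = "place ks rs (replicate p Leaf)"
  have ts: "top_arities ?ts = rs" "length ?ts = p" "set ?ts \<subseteq> insert Leaf (v_corolla ` {1..})"
    using positions_place[of ks p rs] x by auto
  have "count_list ?ts Leaf = e" "leaves_list ?ts = n"
    using length_top_arities[of ?ts] sum_top_arities[of ?ts] ts x by auto
  then show ?case
    using x ts by (auto simp: crowns_def tops_def)
next
  case (5 ts)
  then show ?case
    by (simp add: typeII_tree_0 place_positions crowns_def tops_def)
qed

text \<open>
  Data with \<open>t = 0\<close> correspond to crowns.  Otherwise the lowest vertex contributes a factor \<open>y\<close> on
  the left and a sign.
\<close>

theorem chain_sum_typeII:
  "(chain_sum e n :: _ \<Rightarrow>\<^sub>0 'k::field) =
    (\<Sum>(p, t, rs, is, ks)\<in>free_typeII_data e n. Poly_Mapping.single (typeII_tree p t rs is ks) ((-1) ^ t))"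
proof (induction "Suc n - e" arbitrary: e n rule: less_induct)
  case less
  let ?f = "\<lambda>(p, t, rs, is, ks). Poly_Mapping.single (typeII_tree p t rs is ks) ((-1) ^ t) :: _ \<Rightarrow>\<^sub>0 'k"
  show ?case
  proof (cases "n < e")
    case True
    then have "free_typeII_data e n = {}" by (auto simp: free_typeII_data_def)
    then show ?thesis using True by (simp add: chain_sum_less)
  next
    case False
    let ?P = "{x \<in> free_typeII_data e n. fst (snd x) \<noteq> 0}"
    let ?X = "Sigma {1..n} (\<lambda>a. free_typeII_data (Suc e) (Suc n - a) \<times> {1..a})"
    have "S.fam_star v_fam (chain_sum (Suc e)) n =
        (\<Sum>a=1..n. \<Sum>x\<in>free_typeII_data (Suc e) (Suc n - a). S.star (v_fam a) (?f x))"
      unfolding S.fam_star_def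
    proof (intro sum.cong refl)
      fix a assume "a \<in> {1..n}"
      then have "chain_sum (Suc e) (Suc n - a) = (\<Sum>x\<in>free_typeII_data (Suc e) (Suc n - a). ?f x)"
        using False by (intro less) auto
      then show "S.star (v_fam a) (chain_sum (Suc e) (Suc n - a)) =
          (\<Sum>x\<in>free_typeII_data (Suc e) (Suc n - a). S.star (v_fam a) (?f x))"
        by (simp only: S.star_simps)
    qed
    also have "\<dots> = (\<Sum>a=1..n. \<Sum>(p, t, rs, is, ks)\<in>free_typeII_data (Suc e) (Suc n - a). \<Sum>i=1..a.
         Poly_Mapping.single (plug (V a) a i (typeII_tree p t rs is ks)) ((-1) ^ t))"
    proof -
      have "S.star (v_fam a) (Poly_Mapping.single s c) = (\<Sum>i=1..a. Poly_Mapping.single (plug (V a) a i s) c :: _ \<Rightarrow>\<^sub>0 'k)" for a s c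
        using S.star_simps(4)[of "v_fam a" c "basis_vec s"] by (simp add: star_v_fam pm_scale_sum)
      then show ?thesis by (simp add: case_prod_unfold)
    qed
    also have "\<dots> = (\<Sum>(a, (p, t, rs, is, ks), i)\<in>?X.
         Poly_Mapping.single (plug (V a) a i (typeII_tree p t rs is ks)) ((-1) ^ t))"
      by (simp add: sum.Sigma finite_free_typeII_data sum.cartesian_product case_prod_unfold)
    finally have star_sum: "S.fam_star v_fam (chain_sum (Suc e)) n = \<dots>" .
    have tail: "\<exists>p t rs is ks a i. x = (p, Suc t, a # rs, i # is, ks) \<and> x \<in> free_typeII_data e n" if xP: "x \<in> ?P" for x
    proof -
      obtain p t rs "is" ks where x: "x = (p, t, rs, is, ks)" by (cases x)
      with xP obtain t' where t: "t = Suc t'" by (cases t) auto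
      obtain a rs' where "rs = a # rs'" using xP x t by (cases rs) (auto simp: free_typeII_data_def)
      moreover obtain i is' where "is = i # is'" using xP x t by (cases "is") (auto simp: free_typeII_data_def)
      ultimately show ?thesis using xP x t by auto
    qed
    have "(\<Sum>(a, (p, t, rs, is, ks), i)\<in>?X.
         Poly_Mapping.single (plug (V a) a i (typeII_tree p t rs is ks)) ((-1) ^ t)) = (\<Sum>x\<in>?P. - ?f x)"
    proof (rule sum.reindex_bij_witness[of _ "\<lambda>(p, t, rs, is, ks). (hd rs, (p, t - 1, tl rs, tl is, ks), hd is)"
          "\<lambda>(a, (p, t, rs, is, ks), i). (p, Suc t, a # rs, i # is, ks)"], goal_cases)
      case (2 x)
      then obtain a p t rs "is" ks i where x: "x = (a, (p, t, rs, is, ks), i)"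
        "a \<in> {1..n}" "i \<in> {1..a}" "(p, t, rs, is, ks) \<in> free_typeII_data (Suc e) (Suc n - a)" by auto
      then show ?case
        by (auto simp: free_typeII_data_def nth_Cons split: nat.splits)
    next
      case (4 x)
      then obtain p t rs "is" ks a i where x: "x = (p, Suc t, a # rs, i # is, ks)" "x \<in> free_typeII_data e n"
        using tail by blast
      have *: "1 \<le> (i # is) ! h \<and> (i # is) ! h \<le> (a # rs) ! h" if "h < Suc t" for h
        using x that by (auto simp: free_typeII_data_def)
      have "1 \<le> i" "i \<le> a" "\<forall>h<t. 1 \<le> is ! h \<and> is ! h \<le> rs ! h"
        using *[of 0] *[of "Suc _"] by auto
      then show ?case
        using x(2) unfolding x(1) by (auto simp: free_typeII_data_def)
    next
      case (3 x)
      then obtain p t rs "is" ks a i where "x = (p, Suc t, a # rs, i # is, ks)"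
        using tail by blast
      then show ?case by simp
    next
      case (1 x)
      then show ?case by auto
    next
      case (5 x)
      then show ?case by (auto simp: typeII_tree_Suc single_uminus)
    qed
    then have "S.fam_star v_fam (chain_sum (Suc e)) n = - (\<Sum>x\<in>?P. ?f x)"
      by (simp only: star_sum sum_negf)
    moreover have "crown_sum e n = (\<Sum>x\<in>{x \<in> free_typeII_data e n. fst (snd x) = 0}. ?f x)"
      unfolding crown_sum_typeII by (rule sum.cong) auto
    moreover have "(\<Sum>x\<in>free_typeII_data e n. ?f x) = (\<Sum>x\<in>{x \<in> free_typeII_data e n. fst (snd x) = 0}. ?f x) + (\<Sum>x\<in>?P. ?f x)"
      by (subst sum.union_disjoint[symmetric]) (auto simp: finite_free_typeII_data intro!: sum.cong)
    ultimately show ?thesis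
      by (simp add: chain_sum_rec[of e n])
  qed
qed

section \<open>Shapes and weights of the trees in a decomposition\<close>

lemma shape_mem_trees:
  "well_labelled S_basis S_ar t \<Longrightarrow> 1 \<le> weight t \<Longrightarrow> shape t \<in> trees"
proof -
  assume t: "well_labelled S_basis S_ar t" "1 \<le> weight t"
  then have "1 \<le> m" if "m \<in> set (vertex_arities t)" for m
    using that unfolding well_labelled_def S_basis_def by (metis (mono_tags, lifting) in_set_conv_nth length_map mem_Collect_eq nth_map nth_mem subsetD)
  then show ?thesis
    using t by (auto simp: trees_def)
qed

definition two_shape :: "nat \<Rightarrow> nat \<Rightarrow> nat \<Rightarrow> unit ptree" where
  "two_shape a i j = Node () ((replicate a Leaf)[i - 1 := Node () (replicate j Leaf)])"

lemma shape_two_vertex: "shape (two_vertex a i b) = two_shape (S_ar a) i (S_ar b)"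
  by (simp add: two_vertex_def plug_def corolla_def two_shape_def map_update)

lemma two_shape_inject:
  assumes "1 \<le> i" "i \<le> a" "1 \<le> i'" "i' \<le> a'" "two_shape a i j = two_shape a' i' j'"
  shows "a = a' \<and> i = i' \<and> j = j'"
proof -
  let ?l = "(replicate a Leaf)[i - 1 := Node () (replicate j Leaf)]"
  let ?l' = "(replicate a' Leaf)[i' - 1 := Node () (replicate j' Leaf)]"
  have eq: "?l = ?l'" using assms by (simp add: two_shape_def)
  then have a: "a = a'" by (metis length_list_update length_replicate)
  have "?l ! (i - 1) = Node () (replicate j Leaf)" using assms by simp
  moreover have "?l' ! (i - 1) = (if i - 1 = i' - 1 then Node () (replicate j' Leaf) else Leaf)"
    using assms a by (simp add: nth_list_update)
  ultimately have "i - 1 = i' - 1" "replicate j Leaf = (replicate j' Leaf :: unit ptree list)"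
    using eq by (auto split: if_splits)
  then show ?thesis
    using a assms by (auto simp: replicate_eq_replicate)
qed

lemma two_vertex_tree:
  assumes "1 \<le> i" "i \<le> S_ar a" "a \<in> S_basis" "b \<in> S_basis"
  shows "labels (two_vertex a i b) = [a, b]" "leaves (two_vertex a i b) + 1 = S_ar a + S_ar b"
    "well_labelled S_basis S_ar (two_vertex a i b)" "weight (two_vertex a i b) = 2"
proof -
  have eq: "two_vertex a i b = Node a (replicate (i - 1) Leaf @ Node b (replicate (S_ar b) Leaf) # replicate (S_ar a - i) Leaf)"
    using assms by (simp add: two_vertex_def plug_def corolla_def upd_conv_take_nth_drop)
  show "labels (two_vertex a i b) = [a, b]" "leaves (two_vertex a i b) + 1 = S_ar a + S_ar b"
    "well_labelled S_basis S_ar (two_vertex a i b)" "weight (two_vertex a i b) = 2"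
    using assms by (auto simp: eq sum_list_replicate map_replicate_const concat_replicate_trivial weight_def)
qed

lemma labels_list_tops: "set ts \<subseteq> insert Leaf (v_corolla ` {1..}) \<Longrightarrow> labels_list ts = map V (top_arities ts)"
  by (induction ts) (auto simp: top_arities_def)

lemma typeII_tree_facts:
  "(p, t, rs, is, ks) \<in> free_typeII_data e n \<Longrightarrow>
     well_labelled S_gens S_ar (typeII_tree p t rs is ks) \<and> leaves (typeII_tree p t rs is ks) = n \<and>
     labels (typeII_tree p t rs is ks) = map V (take t rs) @ U p # map V (drop t rs)"
proof (induction t arbitrary: e n rs "is")
  case 0
  then have x: "2 \<le> p" "e \<le> p" "length rs = p - e" "\<forall>r\<in>set rs. 1 \<le> r"
      "sum_list rs + e = n" "length ks = p - e" "sorted_wrt (<) ks" "\<forall>k\<in>set ks. 1 \<le> k \<and> k \<le> p"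
    by (auto simp: free_typeII_data_def)
  let ?ts = "place ks rs (replicate p Leaf)"
  have ts: "top_arities ?ts = rs" "length ?ts = p" "set ?ts \<subseteq> insert Leaf (v_corolla ` {1..})"
    using positions_place[of ks p rs] x by auto
  have "leaves_list ?ts = n"
    using length_top_arities[of ?ts] sum_top_arities[of ?ts] ts x by auto
  moreover have "\<forall>t\<in>set ?ts. well_labelled S_gens S_ar t"
    using ts(3) by auto
  ultimately show ?case
    using ts x labels_list_tops[of ?ts] by (simp add: typeII_tree_0)
next
  case (Suc t)
  obtain r rs' where rs: "rs = r # rs'" using Suc.prems by (cases rs) (auto simp: free_typeII_data_def)
  obtain i is' where "is": "is = i # is'" using Suc.prems by (cases "is") (auto simp: free_typeII_data_def)
  have *: "1 \<le> is ! h \<and> is ! h \<le> rs ! h" if "h < Suc t" for h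
    using Suc.prems that by (auto simp: free_typeII_data_def)
  have i: "1 \<le> i" "i \<le> r" "\<forall>h<t. 1 \<le> is' ! h \<and> is' ! h \<le> rs' ! h"
    using *[of 0] *[of "Suc _"] by (auto simp: rs "is")
  then have "(p, t, rs', is', ks) \<in> free_typeII_data (Suc e) (Suc n - r)"
    using Suc.prems unfolding rs "is" by (auto simp: free_typeII_data_def)
  note IH = Suc.IH[OF this]
  have n: "r \<le> n" using Suc.prems by (auto simp: free_typeII_data_def rs)
  have plug: "plug (V r) r i s = Node (V r) (replicate (i - 1) Leaf @ s # replicate (r - i) Leaf)" for s
    using i by (simp add: plug_def upd_conv_take_nth_drop)
  show ?case
    using IH i n unfolding rs "is" typeII_tree_Suc plug
    by (auto simp: sum_list_replicate map_replicate_const concat_replicate_trivial)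
qed

lemma typeII_facts:
  assumes "(p, t, rs, is, ks) \<in> typeII_data n"
  shows "well_labelled S_gens S_ar (typeII_tree p t rs is ks)" "well_labelled S_basis S_ar (typeII_tree p t rs is ks)"
    "leaves (typeII_tree p t rs is ks) = n"
    "labels (typeII_tree p t rs is ks) = map V (take t rs) @ U p # map V (drop t rs)"
    "weight (typeII_tree p t rs is ks) = p + 1" "2 \<le> p" "t \<le> p" "length rs = p"
  using typeII_tree_facts[of p t rs "is" ks 0 n] assms
    well_labelled_mono[of S_gens S_ar "typeII_tree p t rs is ks" S_basis]
  by (auto simp: typeII_data_eq weight_def) (auto simp: free_typeII_data_def S_gens_def)

lemma finite_typeI_data: "finite (typeI_data n)"
  by (rule finite_subset[of _ "{..n} \<times> {..n + 1}"]) (auto simp: typeI_data_def)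

lemma finite_typeII_data: "finite (typeII_data n)"
  by (simp add: typeII_data_eq finite_free_typeII_data)

text \<open>
  The decorated trees that occur in the decompositions of a basis element.
\<close>

fun S_terms :: "sbasis \<Rightarrow> sbasis ptree set" where
  "S_terms (U n) = (\<lambda>(j, i). two_vertex (U (n - j + 1)) i (U j)) ` typeI_data n"
| "S_terms (V n) = (\<lambda>i. two_vertex (V n) i (U 1)) ` {1..n} \<union> {two_vertex (U 1) 1 (V n)}
     \<union> (\<lambda>(p, t, rs, is, ks). typeII_tree p t rs is ks) ` typeII_data n"

lemma finite_S_terms: "finite (S_terms b)"
  by (cases b) (auto simp: finite_typeI_data finite_typeII_data)

lemma S_terms_facts:
  assumes "b \<in> S_basis" "t \<in> S_terms b"
  shows "well_labelled S_basis S_ar t" "leaves t = S_ar b" "2 \<le> weight t"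
    "sum_list (map S_deg (labels t)) = S_deg b + int (weight t) - 2"
proof -
  have "well_labelled S_basis S_ar t \<and> leaves t = S_ar b \<and> 2 \<le> weight t \<and>
    sum_list (map S_deg (labels t)) = S_deg b + int (weight t) - 2"
  proof (cases b)
    case (U n)
    then obtain j i where t: "t = two_vertex (U (n - j + 1)) i (U j)" "1 \<le> j" "j \<le> n" "1 \<le> i" "i \<le> n - j + 1"
      using assms by (auto simp: typeI_data_def)
    have "U (n - j + 1) \<in> S_basis" "U j \<in> S_basis"
      using t by (auto simp: S_basis_def)
    then show ?thesis
      using two_vertex_tree[of i "U (n - j + 1)" "U j"] t U by simp
  next
    case (V n)
    then have n: "1 \<le> n" "V n \<in> S_basis" "U 1 \<in> S_basis"
      using assms by (auto simp: S_basis_def)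
    consider i where "t = two_vertex (V n) i (U 1)" "1 \<le> i" "i \<le> n" | "t = two_vertex (U 1) 1 (V n)"
      | p s rs "is" ks where "t = typeII_tree p s rs is ks" "(p, s, rs, is, ks) \<in> typeII_data n"
      using assms V by auto
    then show ?thesis
    proof cases
      case (1 i)
      then show ?thesis using two_vertex_tree[of i "V n" "U 1"] n V by simp
    next
      case 2
      then show ?thesis using two_vertex_tree[of 1 "U 1" "V n"] n V by simp
    next
      case (3 p s rs "is" ks)
      have "sum_list (map S_deg (map V xs)) = int (length xs)" for xs
        by (induction xs) auto
      then show ?thesis
        using typeII_facts[OF 3(2)] 3 V by simp
    qed
  qed
  then show "well_labelled S_basis S_ar t" "leaves t = S_ar b" "2 \<le> weight t"
    "sum_list (map S_deg (labels t)) = S_deg b + int (weight t) - 2" by auto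
qed

lemma keys_S_Delta_basis:
  "Poly_Mapping.keys (S_Delta_basis T b :: _ \<Rightarrow>\<^sub>0 'k::field) \<subseteq> {t \<in> S_terms b. shape t = T}"
proof (cases b)
  case (U n)
  show ?thesis
    unfolding U S_Delta_basis.simps by (rule keys_subset_sum) (force split: if_splits)
next
  case (V n)
  show ?thesis
    unfolding V S_Delta_basis.simps
  proof (intro keys_subset_add keys_subset_sum, goal_cases)
    case (1 x)
    then obtain j i where x: "x = (j, i)" "1 \<le> j" "j \<le> n" "1 \<le> i" "i \<le> n - j + 1"
      by (auto simp: typeI_data_def)
    let ?S = "{t \<in> S_terms (V n). shape t = T}"
    have *: "Poly_Mapping.keys (if j = 1 then basis_vec (two_vertex (V n) i (U 1)) else 0 :: _ \<Rightarrow>\<^sub>0 'k) \<subseteq> ?S"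
      "Poly_Mapping.keys (if j = n then basis_vec (two_vertex (U 1) i (V n)) else 0 :: _ \<Rightarrow>\<^sub>0 'k) \<subseteq> ?S"
      if "two_shape (n - j + 1) i j = T"
      using x that by (auto simp: shape_two_vertex)
    show ?case
    proof (cases "two_shape (n - j + 1) i j = T")
      case True
      show ?thesis
        unfolding x(1) prod.case shape_two_vertex S_ar.simps if_P[OF True]
        using * True by (intro keys_subset_add)
    qed (simp add: x(1) shape_two_vertex)
  next
    case (2 x)
    then obtain p t rs "is" ks where x: "x = (p, t, rs, is, ks)"
      by (cases x) auto
    have "typeII_tree p t rs is ks \<in> S_terms (V n)"
      using 2 by (force simp: x)
    then show ?case by (auto simp: x split: if_splits)
  qed
qed

lemma S_Delta_single [simp]: "S_Delta T (Poly_Mapping.single b c) = pm_scale c (S_Delta_basis T b)"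
  by (simp add: S_Delta_def)

lemma keys_S_Delta: "Poly_Mapping.keys (S_Delta T c) \<subseteq> {t. shape t = T \<and> (\<exists>b\<in>Poly_Mapping.keys c. t \<in> S_terms b)}"
  unfolding S_Delta_def
  by (rule keys_subset_lin_ext) (use keys_S_Delta_basis in fastforce)

lemma reduced_basis_S: "S.reduced_basis (S_coaug :: 'k::field \<Rightarrow> _) = S_gens"
proof -
  have "basis_vec b = (basis_vec (U 1) :: _ \<Rightarrow>\<^sub>0 'k) \<longleftrightarrow> b = U 1" for b
    by (metis lookup_single_eq lookup_single_not_eq zero_neq_one)
  then show ?thesis
    by (auto simp: S.reduced_basis_def S_coaug_def S_gens_def)
qed

section \<open>Decompositions of weight two and the counit\<close>

lemma typeI_mem: "1 \<le> i \<Longrightarrow> 1 \<le> j \<Longrightarrow> i \<le> a \<Longrightarrow> (j, i) \<in> typeI_data (a + j - 1)"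
  by (auto simp: typeI_data_def)

text \<open>
  A tree of weight \<open>2\<close> determines its type I datum.
\<close>

lemma typeI_sum:
  fixes f :: "nat \<Rightarrow> nat \<Rightarrow> 'a::comm_monoid_add"
  assumes "1 \<le> i" "i \<le> a" "1 \<le> j" "n = a + j - 1"
  shows "(\<Sum>(j', i')\<in>typeI_data n. if shape (two_vertex (U (n - j' + 1)) i' (U j')) = two_shape a i j
     then f j' i' else 0) = f j i"
proof -
  have "shape (two_vertex (U (n - j' + 1)) i' (U j')) = two_shape a i j \<longleftrightarrow> (j', i') = (j, i)"
    if "(j', i') \<in> typeI_data n" for j' i'
    using two_shape_inject[of i' "n - j' + 1" i a j' j] that assms by (auto simp: shape_two_vertex typeI_data_def)
  then have "(case x of (j', i') \<Rightarrow> if shape (two_vertex (U (n - j' + 1)) i' (U j')) = two_shape a i j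
     then f j' i' else 0) = (if x = (j, i) then f (fst x) (snd x) else 0)" if "x \<in> typeI_data n" for x
    using that by (cases x) (simp only: prod.case fst_conv snd_conv)
  then have "(\<Sum>(j', i')\<in>typeI_data n. if shape (two_vertex (U (n - j' + 1)) i' (U j')) = two_shape a i j
     then f j' i' else 0) = (\<Sum>x\<in>typeI_data n. if x = (j, i) then f (fst x) (snd x) else 0)"
    by (intro sum.cong[OF refl])
  also have "\<dots> = f j i"
    using typeI_mem[of i j a] assms by (simp add: finite_typeI_data)
  finally show ?thesis .
qed

lemma S_Delta_basis_two_shape:
  assumes "1 \<le> i" "i \<le> a" "1 \<le> j" "n = a + j - 1"
  shows "(S_Delta_basis (two_shape a i j) (U n) :: _ \<Rightarrow>\<^sub>0 'k::field) = basis_vec (two_vertex (U a) i (U j))"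
    and "(S_Delta_basis (two_shape a i j) (V n) :: _ \<Rightarrow>\<^sub>0 'k) =
      (if j = 1 then basis_vec (two_vertex (V n) i (U 1)) else 0) + (if j = n then basis_vec (two_vertex (U 1) i (V n)) else 0)"
proof -
  have a: "n - j + 1 = a" using assms by simp
  show "(S_Delta_basis (two_shape a i j) (U n) :: _ \<Rightarrow>\<^sub>0 'k) = basis_vec (two_vertex (U a) i (U j))"
    unfolding S_Delta_basis.simps typeI_sum[OF assms] a ..
  have w: "weight (two_shape a i j) = 2"
    using two_vertex_tree(4)[of i "U a" "U j"] assms shape_two_vertex[of "U a" i "U j"] weight_shape[of "two_vertex (U a) i (U j)"]
    by (simp add: S_basis_def)
  have "shape (typeII_tree p t rs is ks) \<noteq> two_shape a i j" if "(p, t, rs, is, ks) \<in> typeII_data n" for p t rs "is" ks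
  proof
    assume "shape (typeII_tree p t rs is ks) = two_shape a i j"
    then have "weight (typeII_tree p t rs is ks) = 2"
      using w by (metis weight_shape)
    then show False
      using typeII_facts(5,6)[OF that] by simp
  qed
  then have "(\<Sum>(p, t, rs, is, ks)\<in>typeII_data n. if shape (typeII_tree p t rs is ks) = two_shape a i j
        then Poly_Mapping.single (typeII_tree p t rs is ks) ((- 1) ^ (p * (p - 1) div 2)) else 0) = (0 :: _ \<Rightarrow>\<^sub>0 'k)"
    by (intro sum.neutral) auto
  then show "S_Delta_basis (two_shape a i j) (V n) =
      ((if j = 1 then basis_vec (two_vertex (V n) i (U 1)) else 0) + (if j = n then basis_vec (two_vertex (U 1) i (V n)) else 0) :: _ \<Rightarrow>\<^sub>0 'k)"
    unfolding S_Delta_basis.simps typeI_sum[OF assms] by simp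
qed

lemma weight_2_tree:
  assumes "T \<in> trees" "weight T = 2"
  shows "\<exists>a i j. T = two_shape a i j \<and> 1 \<le> i \<and> i \<le> a \<and> 1 \<le> j \<and> leaves T = a + j - 1 \<and> vertex_arities T = [a, j]"
proof -
  obtain ts where T: "T = Node () ts"
    using assms by (cases T) (auto simp: weight_def)
  then obtain l r j where ts: "ts = replicate l Leaf @ Node () (replicate j Leaf) # replicate r Leaf"
    using labels_list_single[of ts] assms by (auto simp: weight_def)
  have "T = two_shape (l + 1 + r) (l + 1) j"
  proof -
    have "replicate (l + 1 + r) Leaf = replicate l Leaf @ Leaf # (replicate r Leaf :: unit ptree list)"
      by (simp add: replicate_add replicate_app_Cons_same)
    then show ?thesis
      unfolding two_shape_def T ts by (simp add: list_update_append del: replicate_Suc)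
  qed
  moreover have "vertex_arities T = [l + 1 + r, j]" "leaves T = l + 1 + r + j - 1"
    by (simp_all add: T ts map_replicate_const concat_replicate_trivial sum_list_replicate)
  moreover have "1 \<le> j"
    using assms calculation by (auto simp: trees_def)
  ultimately show ?thesis
    by (intro exI[of _ "l + 1 + r"] exI[of _ "l + 1"] exI[of _ j]) simp
qed

lemma apply_at_linear:
  "S.apply_at \<epsilon> i 0 = 0" "S.apply_at \<epsilon> i (x + y) = S.apply_at \<epsilon> i x + S.apply_at \<epsilon> i y"
  "S.apply_at \<epsilon> i (pm_scale c x) = pm_scale c (S.apply_at \<epsilon> i x)"
  by (simp_all add: S.apply_at_def lin_ext_simps)

lemma S_counit_basis [simp]: "S_counit (basis_vec b) = (if b = U 1 then 1 else 0)"
  by (simp add: S_counit_def lookup_single when_def)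

lemma apply_at_basis:
  "S.apply_at S_counit i (basis_vec t) =
    (if labels t ! i = U 1 then basis_vec (take i (labels t) @ drop (Suc i) (labels t)) else 0)"
  by (simp add: S.apply_at_def)

lemma counit_weight_2_basis:
  assumes T: "T \<in> trees" "weight T = 2" "i < 2" "vertex_arities T ! i = 1" and b: "b \<in> S_basis" "S_ar b = leaves T"
  shows "S.apply_at S_counit i (S_Delta_basis T b) = (basis_vec [b] :: _ \<Rightarrow>\<^sub>0 'k::field)"
proof -
  obtain a k j where T': "T = two_shape a k j" "1 \<le> k" "k \<le> a" "1 \<le> j" "leaves T = a + j - 1" "vertex_arities T = [a, j]"
    using weight_2_tree[OF T(1,2)] by blast
  have i: "i = 0 \<and> a = 1 \<and> k = 1 \<or> i = 1 \<and> j = 1"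
    using T T' by (cases i) auto
  have labels: "labels (two_vertex c k d) = [c, d]" if "S_ar c = a" "S_ar d = j" for c d
    using that T' by (intro two_vertex_tree) (auto simp: S_basis_def)
  show ?thesis
  proof (cases b)
    case (U n)
    then have n: "n = a + j - 1" using b T' by simp
    show ?thesis
      unfolding U T' S_Delta_basis_two_shape(1)[OF T'(2-4) n]
      using i n T' by (auto simp: apply_at_basis labels)
  next
    case (V n)
    then have n: "n = a + j - 1" using b T' by simp
    show ?thesis
      unfolding V T' S_Delta_basis_two_shape(2)[OF T'(2-4) n]
      using i n T' by (auto simp: apply_at_basis apply_at_linear labels)
  qed
qed

text \<open>
  In weight different from \<open>2\<close> only type II terms occur, and they do not contain \<open>U 1\<close> because the
  middle vertex has arity \<open>p \<ge> 2\<close>.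
\<close>

lemma counit_other_basis:
  assumes T: "weight T \<noteq> 2" "i < weight T" and b: "b \<in> S_basis"
  shows "S.apply_at S_counit i (S_Delta_basis T b :: _ \<Rightarrow>\<^sub>0 'k::field) = 0"
proof -
  have "S.apply_at S_counit i (basis_vec t) = (0 :: _ \<Rightarrow>\<^sub>0 'k)" if t: "t \<in> S_terms b" "shape t = T" for t
  proof -
    have w: "weight t \<noteq> 2" "i < weight t"
      using T t weight_shape[of t] by auto
    show ?thesis
    proof (cases b)
      case (U n)
      then obtain j k where "t = two_vertex (U (n - j + 1)) k (U j)" "1 \<le> j" "j \<le> n" "1 \<le> k" "k \<le> n - j + 1"
        using t by (auto simp: typeI_data_def)
      then have "weight t = 2"
        using two_vertex_tree(4)[of k "U (n - j + 1)" "U j"] by (simp add: S_basis_def)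
      with w show ?thesis by simp
    next
      case (V n)
      then have n: "V n \<in> S_basis" "U 1 \<in> S_basis" "1 \<le> n"
        using b by (auto simp: S_basis_def)
      have "weight (two_vertex (V n) k (U 1)) = 2" if "k \<in> {1..n}" for k
        using two_vertex_tree(4)[of k "V n" "U 1"] n that by simp
      moreover have "weight (two_vertex (U 1) 1 (V n)) = 2"
        using two_vertex_tree(4)[of 1 "U 1" "V n"] n by simp
      ultimately obtain p s rs "is" ks where x: "t = typeII_tree p s rs is ks" "(p, s, rs, is, ks) \<in> typeII_data n"
        using t w V by auto
      have "labels t ! i \<in> set (labels t)"
        using w by (auto simp: weight_def)
      then have "labels t ! i \<noteq> U 1"
        using typeII_facts[OF x(2)] x by auto
      then show ?thesis
        by (simp add: apply_at_basis)
    qed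
  qed
  then show ?thesis
    by (induction rule: pm_keys_induct[OF keys_S_Delta_basis]) (auto simp: apply_at_linear)
qed

section \<open>The cobar differential on the generators\<close>

text \<open>
  All labels except the one at position \<open>t\<close> have degree \<open>1\<close>, so the exponent of the desuspension sign is
  \<open>p (p + 1) / 2 - (p - t)\<close>.  Together with \<open>p (p - 1) / 2\<close> this is \<open>p\<^sup>2 - p + t\<close>, which has the parity of \<open>t\<close>.
\<close>

lemma sum_degrees_desusp:
  assumes "t \<le> p" "length rs = p"
  shows "(-1) ^ (p * (p - 1) div 2) * koszul (\<Sum>i<p + 1. (int (p + 1) - 1 - int i) *
      S_deg ((map V (take t rs) @ U p # map V (drop t rs)) ! i)) = ((-1) ^ t :: 'k::field)"
proof -
  let ?l = "map V (take t rs) @ U p # map V (drop t rs)"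
  have deg: "S_deg (?l ! i) = (if i = t then 0 else 1)" if "i < p + 1" for i
    using that assms by (auto simp: nth_append nth_Cons min_def split: nat.splits)
  have "(\<Sum>i<p + 1. (int (p + 1) - 1 - int i) * S_deg (?l ! i))
      = (\<Sum>i<p + 1. (int p - int i) - (if i = t then int p - int i else 0))"
    by (intro sum.cong refl) (simp add: deg del: One_nat_def)
  also have "\<dots> = (\<Sum>i<p + 1. int p - int i) - (int p - int t)"
    using assms by (simp add: sum_subtractf)
  also have "(\<Sum>i<p + 1. int p - int i) = int (p * (p + 1) div 2)"
  proof -
    have "(\<Sum>i<p + 1. int p - int i) = (\<Sum>i<p + 1. int i)"
      by (rule sum.reindex_bij_witness[of _ "\<lambda>i. p - i" "\<lambda>i. p - i"]) auto
    also have "\<dots> = int (\<Sum>{0..p})"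
      by (simp add: lessThan_Suc_atMost atMost_atLeast0 del: sum.lessThan_Suc)
    also have "\<Sum>{0..p} = p * (p + 1) div 2"
      using gauss_sum_nat[of p] by simp
    finally show ?thesis .
  qed
  finally have sum: "(\<Sum>i<p + 1. (int (p + 1) - 1 - int i) * S_deg (?l ! i)) = int (p * (p + 1) div 2) - (int p - int t)" .
  have "p * (p + 1) div 2 = p * (p - 1) div 2 + p"
  proof (cases p)
    case (Suc q)
    have "Suc q * (Suc q + 1) = Suc q * q + Suc q * 2" by (simp add: algebra_simps)
    then have "Suc q * (Suc q + 1) div 2 = (Suc q * q + Suc q * 2) div 2" by (simp only:)
    then show ?thesis unfolding Suc by (simp only: div_mult_self3) simp
  qed simp
  then have sum': "(\<Sum>i<p + 1. (int (p + 1) - 1 - int i) * S_deg (?l ! i)) = int (p * (p - 1) div 2) + int t"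
    using sum by simp
  have "(-1) ^ m = (koszul (int m) :: 'k)" for m
    by (auto simp: koszul_def)
  then show ?thesis
    unfolding sum' by (simp add: koszul_add)
qed

lemma desusp_reduce_linear:
  "S.desusp (S.reduce G 0) = 0" "S.desusp (S.reduce G (x + y)) = S.desusp (S.reduce G x) + S.desusp (S.reduce G y)"
  by (simp_all add: S.desusp_def S.reduce_def lin_ext_simps)

lemma desusp_reduce_sum:
  "S.desusp (S.reduce G (sum h I)) = (\<Sum>i\<in>I. S.desusp (S.reduce G (h i)))"
  by (simp add: S.desusp_def S.reduce_def lin_ext_sum)

lemma desusp_reduce_single:
  "S.desusp (S.reduce G (Poly_Mapping.single t c)) = (if set (labels t) \<subseteq> G then
     Poly_Mapping.single t (c * koszul (\<Sum>i<weight t. (int (weight t) - 1 - int i) * S_deg (labels t ! i))) else 0)"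
  by (simp add: S.desusp_def S.reduce_def)

text \<open>
  Terms containing \<open>U 1\<close> vanish in the quotient.  This leaves the type I terms with two vertices of arity
  at least \<open>2\<close> for \<open>U n\<close>, and only the type II terms for \<open>V n\<close>.
\<close>

lemma cobar_differential:
  assumes b: "b \<in> S_gens"
  shows "(S_diff b :: _ \<Rightarrow>\<^sub>0 'k::field) = - (\<Sum>T | T \<in> trees \<and> leaves T = S_ar b \<and> S_Delta T (basis_vec b :: _ \<Rightarrow>\<^sub>0 'k) \<noteq> 0.
     S.desusp (S.reduce S_gens (S_Delta T (basis_vec b))))"
proof -
  let ?f = "\<lambda>x :: sbasis ptree \<Rightarrow>\<^sub>0 'k. S.desusp (S.reduce S_gens x)"
  let ?Sh = "shape ` S_terms b"
  have bB: "b \<in> S_basis" using b by (simp add: S_gens_def)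
  have zero: "S_Delta_basis T b = (0 :: _ \<Rightarrow>\<^sub>0 'k)" if "T \<notin> ?Sh" for T
    using keys_S_Delta_basis[of T b, where ?'k = 'k] that by (auto simp flip: keys_eq_empty)
  have Sh: "T \<in> trees \<and> leaves T = S_ar b" if "T \<in> ?Sh" for T
    using that S_terms_facts[OF bB] by (force intro!: shape_mem_trees)
  have "(\<Sum>T | T \<in> trees \<and> leaves T = S_ar b \<and> S_Delta T (basis_vec b :: _ \<Rightarrow>\<^sub>0 'k) \<noteq> 0.
     ?f (S_Delta T (basis_vec b))) = (\<Sum>T\<in>?Sh. ?f (S_Delta_basis T b))"
    using Sh zero by (intro sum.mono_neutral_cong_left) (auto simp: finite_S_terms desusp_reduce_linear)
  also have "\<dots> = - S_diff b"
  proof (cases b)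
    case (U n)
    have "(\<Sum>T\<in>?Sh. ?f (S_Delta_basis T b)) = (\<Sum>(j, i)\<in>typeI_data n. ?f (basis_vec (two_vertex (U (n - j + 1)) i (U j))))"
      using sum_over_shapes[of "typeI_data n" ?Sh "\<lambda>(j, i). shape (two_vertex (U (n - j + 1)) i (U j))" ?f
          "\<lambda>(j, i). basis_vec (two_vertex (U (n - j + 1)) i (U j))"]
      by (auto simp: U finite_typeI_data finite_S_terms[of "U n", simplified] desusp_reduce_linear case_prod_unfold cong: if_cong)
    also have "\<dots> = (\<Sum>(j, i)\<in>typeI_data n. if 2 \<le> j \<and> j < n then basis_vec (two_vertex (U (n - j + 1)) i (U j)) else 0)"
    proof (rule sum.cong[OF refl])
      fix x assume "x \<in> typeI_data n"
      then obtain j i where x: "x = (j, i)" "1 \<le> j" "j \<le> n" "1 \<le> i" "i \<le> n - j + 1"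
        by (auto simp: typeI_data_def)
      have "labels (two_vertex (U (n - j + 1)) i (U j)) = [U (n - j + 1), U j]" "weight (two_vertex (U (n - j + 1)) i (U j)) = 2"
        using x by (auto intro!: two_vertex_tree simp: S_basis_def)
      then show "(case x of (j, i) \<Rightarrow> ?f (basis_vec (two_vertex (U (n - j + 1)) i (U j)))) =
          (case x of (j, i) \<Rightarrow> if 2 \<le> j \<and> j < n then basis_vec (two_vertex (U (n - j + 1)) i (U j)) else 0)"
        using x by (auto simp: desusp_reduce_single numeral_2_eq_2)
    qed
    also have "\<dots> = (\<Sum>(j, i)\<in>Sigma {2..<n} (\<lambda>j. {1..n - j + 1}). basis_vec (two_vertex (U (n - j + 1)) i (U j)))"
      by (rule sum.mono_neutral_cong_right) (auto simp: finite_typeI_data, auto simp: typeI_data_def split: if_splits)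
    also have "\<dots> = - S_diff b"
      unfolding U S_diff.simps by (simp only: minus_minus) (rule sum.Sigma[symmetric]; simp)
    finally show ?thesis .
  next
    case (V n)
    let ?f1 = "\<lambda>(j, i). (if j = 1 then basis_vec (two_vertex (V n) i (U 1)) else 0)
           + (if j = n then basis_vec (two_vertex (U 1) i (V n)) else 0) :: _ \<Rightarrow>\<^sub>0 'k"
    have n: "1 \<le> n" using b V by simp
    have "(\<Sum>T\<in>?Sh. ?f (S_Delta_basis T b)) =
        (\<Sum>T\<in>?Sh. ?f (\<Sum>x\<in>typeI_data n. if (case x of (j, i) \<Rightarrow> shape (two_vertex (U (n - j + 1)) i (U j))) = T then ?f1 x else 0))
      + (\<Sum>T\<in>?Sh. ?f (\<Sum>x\<in>typeII_data n. if (case x of (p, t, rs, is, ks) \<Rightarrow> shape (typeII_tree p t rs is ks)) = T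
           then (case x of (p, t, rs, is, ks) \<Rightarrow> Poly_Mapping.single (typeII_tree p t rs is ks) ((- 1) ^ (p * (p - 1) div 2))) else 0))"
      unfolding sum.distrib[symmetric] desusp_reduce_linear(2)[symmetric] V S_Delta_basis.simps
      by (intro sum.cong refl arg_cong[where f = ?f] arg_cong2[where f = plus]) auto
    also have "(\<Sum>T\<in>?Sh. ?f (\<Sum>x\<in>typeI_data n. if (case x of (j, i) \<Rightarrow> shape (two_vertex (U (n - j + 1)) i (U j))) = T then ?f1 x else 0)) = 0"
    proof (intro sum.neutral ballI)
      fix T
      have "?f (?f1 x) = 0" if x_mem: "x \<in> typeI_data n" for x
      proof -
        obtain j i where x: "x = (j, i)" "1 \<le> j" "j \<le> n" "1 \<le> i" "i \<le> n - j + 1"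
          using x_mem by (auto simp: typeI_data_def)
        have "labels (two_vertex (V n) i (U 1)) = [V n, U 1]" if "j = 1"
          using x that n by (intro two_vertex_tree) (auto simp: S_basis_def)
        moreover have "labels (two_vertex (U 1) i (V n)) = [U 1, V n]" if "j = n"
          using x that n by (intro two_vertex_tree) (auto simp: S_basis_def)
        ultimately show ?thesis
          using x by (auto simp: desusp_reduce_linear desusp_reduce_single)
      qed
      moreover have "?f (if Q then y else 0) = 0" if "?f y = 0" for Q y
        using that by (simp add: desusp_reduce_linear)
      ultimately show "?f (\<Sum>x\<in>typeI_data n. if (case x of (j, i) \<Rightarrow> shape (two_vertex (U (n - j + 1)) i (U j))) = T then ?f1 x else 0) = 0"
        unfolding desusp_reduce_sum by (intro sum.neutral ballI) blast
    qed
    also have "(\<Sum>T\<in>?Sh. ?f (\<Sum>x\<in>typeII_data n. if (case x of (p, t, rs, is, ks) \<Rightarrow> shape (typeII_tree p t rs is ks)) = T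
           then (case x of (p, t, rs, is, ks) \<Rightarrow> Poly_Mapping.single (typeII_tree p t rs is ks) ((- 1) ^ (p * (p - 1) div 2))) else 0))
      = (\<Sum>x\<in>typeII_data n. ?f (case x of (p, t, rs, is, ks) \<Rightarrow> Poly_Mapping.single (typeII_tree p t rs is ks) ((- 1) ^ (p * (p - 1) div 2))))"
    proof (rule sum_over_shapes)
      show "finite ?Sh" by (simp add: finite_S_terms)
      show "(case x of (p, t, rs, is, ks) \<Rightarrow> shape (typeII_tree p t rs is ks)) \<in> ?Sh" if "x \<in> typeII_data n" for x
      proof -
        obtain p t rs "is" ks where x: "x = (p, t, rs, is, ks)" by (cases x)
        then have "typeII_tree p t rs is ks \<in> S_terms b"
          using that by (force simp: V)
        then show ?thesis by (simp add: x)
      qed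
    qed (simp_all add: finite_typeII_data desusp_reduce_linear)
    also have "\<dots> = (\<Sum>(p, t, rs, is, ks)\<in>typeII_data n. Poly_Mapping.single (typeII_tree p t rs is ks) ((-1) ^ t))"
    proof (rule sum.cong[OF refl])
      fix x assume "x \<in> typeII_data n"
      then obtain p t rs "is" ks where x: "x = (p, t, rs, is, ks)" "(p, t, rs, is, ks) \<in> typeII_data n"
        by (cases x) auto
      note facts = typeII_facts[OF x(2)]
      have "set (map V (take t rs) @ U p # map V (drop t rs)) \<subseteq> S_gens"
        using facts(1) unfolding well_labelled_def facts(4) by blast
      then show "?f (case x of (p, t, rs, is, ks) \<Rightarrow> Poly_Mapping.single (typeII_tree p t rs is ks) ((- 1) ^ (p * (p - 1) div 2))) =
         (case x of (p, t, rs, is, ks) \<Rightarrow> Poly_Mapping.single (typeII_tree p t rs is ks) ((-1) ^ t))"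
        unfolding x prod.case desusp_reduce_single facts(4,5)
          sum_degrees_desusp[OF facts(7,8)] by (rule if_P)
    qed
    also have "\<dots> = - S_diff b"
      by (simp add: V chain_sum_typeII typeII_data_eq)
    finally show ?thesis by simp
  qed
  finally show ?thesis by simp
qed

section \<open>The homotopy cooperad\<close>

theorem proposition3p1:
  shows "coaugmented_homotopy_cooperad S_basis S_ar S_deg
           (S_Delta :: unit ptree \<Rightarrow> (sbasis \<Rightarrow>\<^sub>0 'k::field_char_0) \<Rightarrow> (sbasis ptree \<Rightarrow>\<^sub>0 'k))
           S_counit S_coaug"
proof (intro coaugmented_homotopy_cooperad.intro coaugmented_homotopy_cooperad_axioms.intro S.based_collection_axioms)
  have vs: "vector_space ((*) :: 'k \<Rightarrow> 'k \<Rightarrow> 'k)"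
    by unfold_locales (simp_all add: algebra_simps)
  have U1: "U 1 \<in> S_basis"
    by (simp add: S_basis_def)
  fix T :: "unit ptree" and c :: "sbasis \<Rightarrow>\<^sub>0 'k" and n i :: nat and p :: int and a :: 'k
  show "Vector_Spaces.linear pm_scale pm_scale (S_Delta T :: (sbasis \<Rightarrow>\<^sub>0 'k) \<Rightarrow> _)"
    unfolding S_Delta_def by (rule linear_lin_ext)
  show "S_Delta T c \<in> S.tensor_space T (p + int (weight T) - 2)" if "c \<in> S.comp_space (leaves T) p"
    unfolding S.tensor_space_def
  proof (intro CollectI ballI)
    fix t assume "t \<in> Poly_Mapping.keys (S_Delta T c)"
    then obtain b where t: "shape t = T" "b \<in> Poly_Mapping.keys c" "t \<in> S_terms b"
      using keys_S_Delta[of T c] by auto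
    then have "b \<in> S_basis" "S_deg b = p"
      using that by (auto simp: S.comp_space_def)
    then show "t \<in> S.dec_trees S_basis \<and> shape t = T \<and> sum_list (map S_deg (labels t)) = p + int (weight T) - 2"
      using S_terms_facts[of b t] t weight_shape[of t] by (simp add: S.dec_trees_iff)
  qed
  show "finite {T \<in> trees. leaves T = n \<and> S_Delta T c \<noteq> 0}"
  proof (rule finite_subset)
    show "{T \<in> trees. leaves T = n \<and> S_Delta T c \<noteq> 0} \<subseteq> (\<Union>b\<in>Poly_Mapping.keys c. shape ` S_terms b)"
    proof
      fix T assume "T \<in> {T \<in> trees. leaves T = n \<and> S_Delta T c \<noteq> 0}"
      then obtain t where "t \<in> Poly_Mapping.keys (S_Delta T c)"
        by (auto simp flip: keys_eq_empty)
      then show "T \<in> (\<Union>b\<in>Poly_Mapping.keys c. shape ` S_terms b)"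
        using keys_S_Delta[of T c] by fastforce
    qed
  qed (simp add: finite_S_terms)
  show "Vector_Spaces.linear pm_scale (*) (S_counit :: (sbasis \<Rightarrow>\<^sub>0 'k) \<Rightarrow> 'k)"
    by (simp add: Vector_Spaces.linear_iff vs vector_space_pm_scale S_counit_def lookup_add)
  show "S_counit c = 0" if "c \<in> S.comp_space n p" "(n, p) \<noteq> (1, 0)"
    using that by (force simp: S.comp_space_def S_counit_def in_keys_iff)
  show "S.apply_at S_counit i (S_Delta T c) = lin_ext (\<lambda>b. basis_vec [b]) c"
    if "T \<in> trees" "c \<in> S.arity_space (leaves T)" "weight T = 2" "i < 2" "vertex_arities T ! i = 1"
  proof -
    have "Poly_Mapping.keys c \<subseteq> {b \<in> S_basis. S_ar b = leaves T}"
      using that by (auto simp: S.arity_space_def)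
    then show ?thesis
    proof (induction rule: pm_keys_induct)
      case (basis b)
      then show ?case
        using counit_weight_2_basis[of T i b] that by simp
    qed (simp_all add: S_Delta_def lin_ext_simps apply_at_linear)
  qed
  show "S.apply_at S_counit i (S_Delta T c) = 0"
    if "T \<in> trees" "c \<in> S.arity_space (leaves T)" "weight T \<noteq> 2" "i < weight T"
  proof -
    have "Poly_Mapping.keys c \<subseteq> S_basis"
      using that by (auto simp: S.arity_space_def)
    then show ?thesis
    proof (induction rule: pm_keys_induct)
      case (basis b)
      then show ?case
        using counit_other_basis[of T i b] that by simp
    qed (simp_all add: S_Delta_def lin_ext_simps apply_at_linear)
  qed
  show "Vector_Spaces.linear (*) pm_scale (S_coaug :: 'k \<Rightarrow> _)"
    by (simp add: Vector_Spaces.linear_iff vs vector_space_pm_scale S_coaug_def single_add)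
  show "S_coaug a \<in> S.comp_space 1 0"
    using U1 by (auto simp: S.comp_space_def S_coaug_def)
  show "\<exists>e\<in>S_basis. S_coaug (1 :: 'k) = basis_vec e"
    using U1 by (auto simp: S_coaug_def)
  show "S_counit (S_coaug a) = a"
    by (simp add: S_counit_def S_coaug_def)
  have unit_tree: "two_shape 1 1 1 = Node () [Node () [Leaf]]"
    by (simp add: two_shape_def)
  show "S_Delta (Node () [Node () [Leaf]]) (S_coaug 1) =
      lin_ext (\<lambda>a. lin_ext (\<lambda>b. basis_vec (Node a [Node b [Leaf]])) (S_coaug 1)) (S_coaug (1 :: 'k))"
    using S_Delta_basis_two_shape(1)[of 1 1 1 1, where ?'k = 'k]
    by (simp add: S_coaug_def unit_tree[simplified] two_vertex_def plug_def corolla_def)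
  show "S_Delta T (S_coaug (1 :: 'k)) = 0" if "T \<in> trees" "leaves T = 1" "T \<noteq> Node () [Node () [Leaf]]"
  proof -
    have "typeI_data 1 = {(1, 1)}"
      by (auto simp: typeI_data_def)
    then have "S_Delta_basis T (U 1) = (0 :: _ \<Rightarrow>\<^sub>0 'k)"
      using that(3) by (simp add: shape_two_vertex unit_tree[simplified])
    then show ?thesis
      by (simp add: S_coaug_def)
  qed
  show "\<exists>d. S.operad_derivation (S.reduced_basis (S_coaug :: 'k \<Rightarrow> _)) d \<and>
        (\<forall>b\<in>S.reduced_basis (S_coaug :: 'k \<Rightarrow> _). d (basis_vec (corolla b (S_ar b))) =
           - (\<Sum>T | T \<in> trees \<and> leaves T = S_ar b \<and> S_Delta T (basis_vec b :: _ \<Rightarrow>\<^sub>0 'k) \<noteq> 0.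
                S.desusp (S.reduce (S.reduced_basis (S_coaug :: 'k \<Rightarrow> _)) (S_Delta T (basis_vec b :: _ \<Rightarrow>\<^sub>0 'k))))) \<and>
        (\<forall>n p. \<forall>x\<in>S.free_operad (S.reduced_basis (S_coaug :: 'k \<Rightarrow> _)) n p. d (d x) = 0)"
    unfolding reduced_basis_S
  proof (rule exI[of _ "SD.deriv :: _ \<Rightarrow> _ \<Rightarrow>\<^sub>0 'k"], intro conjI ballI allI)
    show "S.operad_derivation S_gens (SD.deriv :: _ \<Rightarrow> _ \<Rightarrow>\<^sub>0 'k)"
      by (rule SD.operad_derivation_deriv)
    show "SD.deriv (SD.deriv x) = 0" if "x \<in> S.free_operad S_gens n p" for n p and x :: "_ \<Rightarrow>\<^sub>0 'k"
      using that by (rule SD_square_zero)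
    show "SD.deriv (basis_vec (corolla b (S_ar b))) =
        - (\<Sum>T | T \<in> trees \<and> leaves T = S_ar b \<and> S_Delta T (basis_vec b :: _ \<Rightarrow>\<^sub>0 'k) \<noteq> 0.
             S.desusp (S.reduce S_gens (S_Delta T (basis_vec b :: _ \<Rightarrow>\<^sub>0 'k))))" if "b \<in> S_gens" for b
      using SD.deriv_corolla[OF that] cobar_differential[OF that] by (rule trans)
  qed
qed

end
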